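(* Let $d\ge 2$, let $\Omega\subset\mathbb{R}^d$ be a bounded $C^{1,1}$ domain, let $\delta,K>0$, let $\alpha\in[0,(d+1)/2)$ and $\beta=(d+1-2\alpha)/(2d)$. Then there is a constant $N$, depending only on $\Omega,\delta,\alpha$ and $K$, such that the following holds. Let $a=(a^{ij}(x))$ be a measurable function on $\mathbb{R}^d$ with values in symmetric $d\times d$ matrices, $b=(b^i(x))$ a measurable $\mathbb{R}^d$-valued function on $\mathbb{R}^d$, and $c=c(x)$ a bounded measurable real function on $\mathbb{R}^d$, such that for all $x,\lambda\in\mathbb{R}^d$ $$\delta^{-1}|\lambda|^2\ge a^{ij}(x)\lambda^i\lambda^j\ge\delta|\lambda|^2,\qquad |b(x)|\le K,\qquad c(x)\ge 0,$$ and set $Lu=a^{ij}D_{ij}u+b^iD_iu-cu$. Let $u\in W^2_{d,\mathrm{loc}}(\Omega)\cap C(\bar\Omega)$. Then for every $x\in\Omega$ $$u(x)\le\sup_{\partial\Omega}u_+ + N\rho_\Omega^{\beta}(x)\,\big\|\rho_\Omega^{\alpha/d}(Lu)_-\big\|_{L_d(\Omega)}.$$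
   Context: Summation over repeated indices is understood; $D_i=\partial/\partial x^i$, $D_{ij}=D_iD_j$. For a real number $t$: $t_\pm=(|t|\pm t)/2$. $\rho_\Omega(x)=\mathrm{dist}(x,\Omega^c)$. $W^2_{d,\mathrm{loc}}(\Omega)$ is the local Sobolev space of functions with generalized derivatives up to order two in $L_{d,\mathrm{loc}}(\Omega)$. The right-hand side may be $+\infty$. *)

theory Defs
  imports "HOL-Analysis.Analysis"
begin

definition posp :: "real \<Rightarrow> real" where
  "posp t = (\<bar>t\<bar> + t) / 2"

definition negp :: "real \<Rightarrow> real" where
  "negp t = (\<bar>t\<bar> - t) / 2"


text \<open>
  Near each boundary point the domain is, after a rigid motion, the strict epigraph of a
  \<open>C\<^sup>1\<^sup>,\<^sup>1\<close> function of \<open>d - 1\<close> variables. The vertical direction is the unit vector \<open>\<nu>\<close>, and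
  \<open>\<gamma>\<close> is only evaluated on the hyperplane orthogonal to \<open>\<nu>\<close>; every \<open>C\<^sup>1\<^sup>,\<^sup>1\<close> function on that
  hyperplane extends to the whole space by composition with the orthogonal projection.
\<close>

definition C11_boundary :: "('a :: euclidean_space) set \<Rightarrow> bool" where
  "C11_boundary \<Omega> \<longleftrightarrow>
     (\<forall>z \<in> frontier \<Omega>. \<exists>r > 0. \<exists>\<nu> (\<gamma> :: 'a \<Rightarrow> real) \<gamma>' M.
        norm \<nu> = 1 \<and>
        (\<forall>y. GDERIV \<gamma> y :> \<gamma>' y) \<and>
        M-lipschitz_on UNIV \<gamma>' \<and>
        \<Omega> \<inter> ball z r = {y \<in> ball z r. \<gamma> (y - (y \<bullet> \<nu>) *\<^sub>R \<nu>) < y \<bullet> \<nu>})"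

definition bounded_C11_domain :: "('a :: euclidean_space) set \<Rightarrow> bool" where
  "bounded_C11_domain \<Omega> \<longleftrightarrow>
     open \<Omega> \<and> connected \<Omega> \<and> \<Omega> \<noteq> {} \<and> bounded \<Omega> \<and> C11_boundary \<Omega>"


definition classical_partial :: "'n \<Rightarrow> (real ^ 'n \<Rightarrow> real) \<Rightarrow> real ^ 'n \<Rightarrow> real" where
  "classical_partial i f x = frechet_derivative f (at x) (axis i 1)"

primrec Ck :: "nat \<Rightarrow> (real ^ 'n \<Rightarrow> real) \<Rightarrow> bool" where
  "Ck 0 f \<longleftrightarrow> continuous_on UNIV f"
| "Ck (Suc k) f \<longleftrightarrow> f differentiable_on UNIV \<and> (\<forall>i. Ck k (classical_partial i f))"

definition test_functions :: "(real ^ 'n) set \<Rightarrow> (real ^ 'n \<Rightarrow> real) set" where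
  "test_functions \<Omega> = {\<phi>. (\<forall>k. Ck k \<phi>) \<and>
     compact (closure {x. \<phi> x \<noteq> 0}) \<and> closure {x. \<phi> x \<noteq> 0} \<subseteq> \<Omega>}"


definition Lp_loc :: "real \<Rightarrow> ('a :: euclidean_space) set \<Rightarrow> ('a \<Rightarrow> real) set" where
  "Lp_loc p \<Omega> = {f. f \<in> borel_measurable (lebesgue_on \<Omega>) \<and>
     (\<forall>S. compact S \<and> S \<subseteq> \<Omega> \<longrightarrow> set_integrable lebesgue S (\<lambda>x. \<bar>f x\<bar> powr p))}"

definition Lp_norm :: "real \<Rightarrow> ('a :: euclidean_space) set \<Rightarrow> ('a \<Rightarrow> real) \<Rightarrow> ennreal" where
  "Lp_norm p \<Omega> f =
     (let I = (\<integral>\<^sup>+x\<in>\<Omega>. ennreal (\<bar>f x\<bar> powr p) \<partial>lebesgue)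
      in if I = \<infinity> then \<infinity> else ennreal (enn2real I powr (1 / p)))"


definition has_weak_partial ::
    "(real ^ 'n) set \<Rightarrow> 'n \<Rightarrow> (real ^ 'n \<Rightarrow> real) \<Rightarrow> (real ^ 'n \<Rightarrow> real) \<Rightarrow> bool" where
  "has_weak_partial \<Omega> i f g \<longleftrightarrow>
     f \<in> Lp_loc 1 \<Omega> \<and> g \<in> Lp_loc 1 \<Omega> \<and>
     (\<forall>\<phi> \<in> test_functions \<Omega>.
        (LINT x:\<Omega>|lebesgue. f x * classical_partial i \<phi> x) = - (LINT x:\<Omega>|lebesgue. g x * \<phi> x))"

text \<open>
  A representative of the weak derivative, which is unique almost everywhere on \<open>\<Omega>\<close>;
  meaningful only when a weak derivative exists.
\<close>

definition weak_partial ::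
    "(real ^ 'n) set \<Rightarrow> 'n \<Rightarrow> (real ^ 'n \<Rightarrow> real) \<Rightarrow> real ^ 'n \<Rightarrow> real" where
  "weak_partial \<Omega> i f = (SOME g. has_weak_partial \<Omega> i f g)"

definition W2_loc :: "real \<Rightarrow> (real ^ 'n) set \<Rightarrow> (real ^ 'n \<Rightarrow> real) set" where
  "W2_loc p \<Omega> = {u. u \<in> Lp_loc p \<Omega> \<and>
     (\<exists>Du D2u. \<forall>i. Du i \<in> Lp_loc p \<Omega> \<and> has_weak_partial \<Omega> i u (Du i) \<and>
        (\<forall>j. D2u i j \<in> Lp_loc p \<Omega> \<and> has_weak_partial \<Omega> i (Du j) (D2u i j)))}"


definition elliptic_op ::
    "(real ^ 'n) set \<Rightarrow> (real ^ 'n \<Rightarrow> real ^ 'n ^ 'n) \<Rightarrow> (real ^ 'n \<Rightarrow> real ^ 'n) \<Rightarrow>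
     (real ^ 'n \<Rightarrow> real) \<Rightarrow> (real ^ 'n \<Rightarrow> real) \<Rightarrow> real ^ 'n \<Rightarrow> real" where
  "elliptic_op \<Omega> a b c u x =
     (\<Sum>i\<in>UNIV. \<Sum>j\<in>UNIV. a x $ i $ j * weak_partial \<Omega> i (weak_partial \<Omega> j u) x)
     + (\<Sum>i\<in>UNIV. b x $ i * weak_partial \<Omega> i u x) - c x * u x"

definition coeff_conditions ::
    "real \<Rightarrow> real \<Rightarrow> (real ^ 'n \<Rightarrow> real ^ 'n ^ 'n) \<Rightarrow> (real ^ 'n \<Rightarrow> real ^ 'n) \<Rightarrow>
     (real ^ 'n \<Rightarrow> real) \<Rightarrow> bool" where
  "coeff_conditions \<delta> K a b c \<longleftrightarrow>
     a \<in> borel_measurable lebesgue \<and> b \<in> borel_measurable lebesgue \<and>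
     c \<in> borel_measurable lebesgue \<and> bounded (range c) \<and>
     (\<forall>x. transpose (a x) = a x) \<and>
     (\<forall>x l. (\<Sum>i\<in>UNIV. \<Sum>j\<in>UNIV. a x $ i $ j * l $ i * l $ j) \<le> inverse \<delta> * (norm l)\<^sup>2 \<and>
            \<delta> * (norm l)\<^sup>2 \<le> (\<Sum>i\<in>UNIV. \<Sum>j\<in>UNIV. a x $ i $ j * l $ i * l $ j)) \<and>
     (\<forall>x. norm (b x) \<le> K) \<and> (\<forall>x. 0 \<le> c x)"

definition dist_compl :: "('a :: euclidean_space) set \<Rightarrow> 'a \<Rightarrow> real" where
  "dist_compl \<Omega> x = infdist x (- \<Omega>)"

end

theory Submission
  imports Defs
begin

text \<open>
  Let \<open>\<rho>\<close> be the distance to the complement of \<open>\<Omega>\<close>, let \<open>f = (Lu)\<^sub>-\<close> and let \<open>d\<close> be the dimension.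
  Everything rests on one unweighted estimate. Suppose that a bounded open set \<open>D\<close> stays outside a ball of
  fixed radius, that \<open>x \<in> D\<close> lies at distance \<open>h\<close> from that ball, and that \<open>u \<le> S\<close> on the boundary
  of \<open>D\<close>, where \<open>S \<ge> 0\<close>. Then \<open>(u x - S)\<^sup>d \<le> N h\<^bsup>(d+1)/2\<^esup> \<integral>\<^sub>D f\<^sup>d\<close>.

  This is an Aleksandrov estimate. Let \<open>m = u x - S\<close> and let \<open>\<xi>\<close> be the position relative to the
  point of the ball nearest to \<open>x\<close>, with \<open>\<nu>\<close> the outer normal there. The function \<open>u\<close> is touched from
  above by vertical translates of the functions \<open>\<phi>\<^sub>q = t \<psi> + q \<bullet> \<xi>\<close>, where \<open>\<psi>\<close> is a fixed radial barrier,
  \<open>t\<close> is comparable to \<open>m / h\<close>, and \<open>q\<close> ranges over the set \<open>Q\<close> of vectors with normal component at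
  most a multiple of \<open>m / h\<close> and tangential component at most a multiple of \<open>m / sqrt h\<close>. The barrier
  grows at least quadratically in the tangential directions away from the touching point, because it
  is built on a smaller ball inside the exterior ball; this is what allows the tangential components
  to be as large as \<open>m / sqrt h\<close>. The barrier is a strict supersolution, which absorbs the drift for
  every \<open>q \<in> Q\<close>. Hence \<open>Q\<close> is covered by the image of the contact set under \<open>Du - t D\<psi>\<close>, whose
  Jacobian there is at most a multiple of \<open>f\<^sup>d\<close>, while the volume of \<open>Q\<close> is comparable to
  \<open>m\<^sup>d h\<^bsup>-(d+1)/2\<^esup>\<close> (lemmas \<open>contact_measure_estimate\<close> and \<open>smooth_exterior_ball_estimate\<close>).
  Functions in the Sobolev space are mollified: all coefficients are bounded, so \<open>Lu\<close> converges in
  \<open>L\<^sub>d\<close> on compact subsets (\<open>smooth_approximation\<close>, \<open>W2_exterior_ball_estimate\<close>).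

  The weight enters only through a doubling argument. Let \<open>\<rho> x = 2 h\<close> and \<open>D = {\<rho> > h}\<close>. Moving the
  exterior ball of \<open>\<Omega>\<close> at the boundary point nearest to \<open>x\<close> inwards by \<open>h\<close> gives a ball that misses
  \<open>D\<close> and lies at distance \<open>h\<close> from \<open>x\<close>. On \<open>D\<close> the weight is at least \<open>h\<^sup>\<alpha>\<close>, so with \<open>F\<close> the
  weighted norm of \<open>f\<close> the bound \<open>u \<le> S\<close> on \<open>{\<rho> = h}\<close> gives \<open>u x \<le> S + N h\<^sup>\<beta> F\<close>
  (\<open>doubling_step\<close>). Along the distances \<open>2\<^sup>-\<^sup>j \<rho>(x)\<close> the increments form a geometric series because
  \<open>\<beta> > 0\<close>, and \<open>u\<close> is uniformly close to its boundary values at small distances.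
\<close>

section \<open>The area inequality for arbitrary finite index types\<close>

text \<open>
  The area inequality \<open>measure_differentiable_image\<close> refers to coordinates indexed by a well-ordered
  type. A copy of an arbitrary finite index type, ordered along an enumeration, carries the
  inequality over to all of them.
\<close>

typedef 'a ordered_copy = "UNIV :: 'a set" by simp

definition index_code :: "'a::finite \<Rightarrow> nat" where
  "index_code = (SOME f. inj f)"

lemma inj_index_code: "inj (index_code :: 'a::finite \<Rightarrow> nat)"
  unfolding index_code_def
  by (rule someI_ex[of inj]) (use finite_imp_inj_to_nat_seg[OF finite[of "UNIV :: 'a set"]] in blast)

instance ordered_copy :: (finite) finite
proof
  have "(UNIV :: 'a ordered_copy set) = range Abs_ordered_copy"
    by (metis Rep_ordered_copy_inverse surj_def)
  thus "finite (UNIV :: 'a ordered_copy set)"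
    by (metis finite finite_imageI)
qed

instantiation ordered_copy :: (finite) wellorder
begin

definition "x \<le> y \<longleftrightarrow> index_code (Rep_ordered_copy x) \<le> index_code (Rep_ordered_copy y)"
definition "x < y \<longleftrightarrow> index_code (Rep_ordered_copy x) < index_code (Rep_ordered_copy y)"

instance
proof
  fix P :: "'a ordered_copy \<Rightarrow> bool" and a
  assume step: "\<And>x. (\<And>y. y < x \<Longrightarrow> P y) \<Longrightarrow> P x"
  show "P a"
  proof (induction a rule: measure_induct_rule[of "\<lambda>x. index_code (Rep_ordered_copy x)"])
    case (less x)
    show ?case by (rule step) (rule less, simp add: less_ordered_copy_def)
  qed
next
  fix x y :: "'a ordered_copy"
  assume "x \<le> y" "y \<le> x"
  thus "x = y"
    by (simp add: less_eq_ordered_copy_def Rep_ordered_copy_inject inj_eq[OF inj_index_code])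
next
  fix x y :: "'a ordered_copy"
  show "x < y \<longleftrightarrow> x \<le> y \<and> \<not> y \<le> x" "x \<le> y \<or> y \<le> x" "x \<le> x"
    unfolding less_eq_ordered_copy_def less_ordered_copy_def by linarith+
next
  fix x y z :: "'a ordered_copy"
  assume "x \<le> y" "y \<le> z"
  thus "x \<le> z" unfolding less_eq_ordered_copy_def by (rule order.trans)
qed

end

definition relabel :: "real ^ 'n \<Rightarrow> real ^ ('n::finite ordered_copy)" where
  "relabel x = (\<chi> i. x $ Rep_ordered_copy i)"

definition unlabel :: "real ^ ('n::finite ordered_copy) \<Rightarrow> real ^ 'n" where
  "unlabel x = (\<chi> i. x $ Abs_ordered_copy i)"

lemma relabel_unlabel [simp]: "relabel (unlabel x) = x" "unlabel (relabel y) = y"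
  by (simp_all add: relabel_def unlabel_def vec_eq_iff Rep_ordered_copy_inverse
      Abs_ordered_copy_inverse)

lemma linear_relabel: "linear relabel" and linear_unlabel: "linear unlabel"
  by (auto intro!: linearI simp: relabel_def unlabel_def vec_eq_iff)

lemma bij_Rep_ordered_copy: "bij Rep_ordered_copy"
  by (metis Abs_ordered_copy_inverse Rep_ordered_copy_inverse UNIV_I bijI' )

lemma cont_relabel: "continuous_on S relabel"
  by (simp add: linear_continuous_on linear_conv_bounded_linear[symmetric] linear_relabel)

lemma cont_unlabel: "continuous_on S unlabel"
  by (simp add: linear_continuous_on linear_conv_bounded_linear[symmetric] linear_unlabel)

lemma measurable_relabel [measurable]: "relabel \<in> borel_measurable (borel :: (real^'n::finite) measure)"
  using borel_measurable_continuous_onI[OF cont_relabel] by simp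

lemma measurable_unlabel [measurable]: "unlabel \<in> borel_measurable borel"
  by (rule borel_measurable_continuous_onI[OF cont_unlabel])

lemma box_cart_prod:
  fixes l u :: "real ^ 'm"
  assumes "\<And>i. l $ i \<le> u $ i"
  shows "emeasure lborel (box l u) = ennreal (\<Prod>i\<in>UNIV. u $ i - l $ i)"
proof -
  have "emeasure lborel (box l u) = ennreal (\<Prod>b\<in>Basis. (u - l) \<bullet> b)"
    by (rule emeasure_lborel_box) (use assms in \<open>auto simp: Basis_vec_def inner_axis\<close>)
  also have "(\<Prod>b\<in>Basis. (u - l) \<bullet> b) = (\<Prod>i\<in>UNIV. (u - l) \<bullet> axis i 1)"
    by (simp add: Basis_vec_def prod.UNION_disjoint axis_eq_axis prod.reindex inj_on_def UNION_singleton_eq_range)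
  finally show ?thesis by (simp add: inner_axis)
qed

text \<open>
  Renaming coordinates maps boxes to boxes with the same side lengths, and boxes determine
  Lebesgue measure.
\<close>

lemma distr_relabel: "distr lborel borel relabel = (lborel :: (real ^ ('n::finite ordered_copy)) measure)"
proof (rule lborel_eqI[symmetric])
  fix l u :: "real ^ ('n ordered_copy)"
  assume lu: "\<And>b. b \<in> Basis \<Longrightarrow> l \<bullet> b \<le> u \<bullet> b"
  have le: "l $ i \<le> u $ i" for i
    using lu[of "axis i 1"] by (auto simp: Basis_vec_def inner_axis)
  have all_idx: "(\<forall>i. P (Rep_ordered_copy i) i) \<longleftrightarrow> (\<forall>j. P j (Abs_ordered_copy j))"
    for P :: "'n \<Rightarrow> 'n ordered_copy \<Rightarrow> bool"
    by (metis Abs_ordered_copy_inverse Rep_ordered_copy_inverse UNIV_I)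
  have "relabel -` box l u = box (unlabel l) (unlabel u)"
    using all_idx[of "\<lambda>j i. l $ i < _ $ j \<and> _ $ j < u $ i"]
    by (simp add: set_eq_iff mem_box_cart relabel_def unlabel_def all_idx[of "\<lambda>j i. l $ i < x $ j \<and> x $ j < u $ i" for x])
  hence "emeasure (distr lborel borel relabel) (box l u) = emeasure lborel (box (unlabel l) (unlabel u))"
    by (simp add: emeasure_distr)
  also have "\<dots> = ennreal (\<Prod>i\<in>UNIV. unlabel u $ i - unlabel l $ i)"
    by (rule box_cart_prod) (simp add: unlabel_def le)
  also have "(\<Prod>i\<in>UNIV. unlabel u $ i - unlabel l $ i) = (\<Prod>i\<in>UNIV. u $ i - l $ i)"
    by (rule prod.reindex_bij_betw[OF bij_Rep_ordered_copy, symmetric, THEN trans])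
      (simp add: unlabel_def Rep_ordered_copy_inverse)
  also have "\<dots> = (\<Prod>b\<in>Basis. (u - l) \<bullet> b)"
    by (simp add: Basis_vec_def prod.UNION_disjoint axis_eq_axis prod.reindex inj_on_def
       UNION_singleton_eq_range inner_axis)
  finally show "emeasure (distr lborel borel relabel) (box l u) = ennreal (\<Prod>b\<in>Basis. (u - l) \<bullet> b)" .
qed simp

text \<open>
  Conjugation with the renaming is a bijection between the permutations of the two index sets that
  preserves signs, so the two Leibniz expansions agree term by term.
\<close>

lemma det_relabel:
  fixes M :: "real ^ 'n ^ 'n::finite"
  shows "det (\<chi> i j. M $ Rep_ordered_copy i $ Rep_ordered_copy j) = det M"
proof -
  let ?R = "Rep_ordered_copy :: 'n ordered_copy \<Rightarrow> 'n"
  let ?A = "Abs_ordered_copy :: 'n \<Rightarrow> 'n ordered_copy"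
  have RA[simp]: "?R (?A x) = x" "?A (?R y) = y" for x y
    by (simp_all add: Rep_ordered_copy_inverse Abs_ordered_copy_inverse)
  have injR: "inj ?R" and bijR: "bij_betw ?R UNIV UNIV"
    using bij_Rep_ordered_copy by (auto simp: bij_def)
  have bij_R_range: "range ?R = UNIV" using bijR by (simp add: bij_betw_def)
  let ?c = "map_permutation UNIV ?R"
  have c_eq: "?c p (?R i) = ?R (p i)" if "p permutes UNIV" for p i
    using map_permutation_apply[OF injR, of i p] by simp
  have bij_c: "bij_betw ?c {p. p permutes UNIV} {p. p permutes UNIV}"
    using bij_betw_permutations[OF bijR]
    unfolding map_permutation_def restrict_id_def o_def bij_R_range by simp
  have "det M = (\<Sum>p | p permutes UNIV. of_int (sign (?c p)) * (\<Prod>i\<in>UNIV. M $ i $ ?c p i))"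
    unfolding det_def by (rule sum.reindex_bij_betw[OF bij_c, symmetric])
  also have "\<dots> = (\<Sum>p | p permutes UNIV. of_int (sign p) * (\<Prod>i\<in>UNIV. M $ ?R i $ ?R (p i)))"
  proof (intro sum.cong refl)
    fix p :: "'n ordered_copy \<Rightarrow> 'n ordered_copy" assume p: "p \<in> {p. p permutes UNIV}"
    have "(\<Prod>i\<in>UNIV. M $ i $ ?c p i) = (\<Prod>i\<in>UNIV. M $ ?R i $ ?c p (?R i))"
      by (rule prod.reindex_bij_betw[OF bij_Rep_ordered_copy, symmetric])
    thus "of_int (sign (?c p)) * (\<Prod>i\<in>UNIV. M $ i $ ?c p i)
       = of_int (sign p) * (\<Prod>i\<in>UNIV. M $ ?R i $ ?R (p i))"
      using p by (simp add: c_eq sign_map_permutation[OF injR])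
  qed
  also have "\<dots> = det (\<chi> i j. M $ ?R i $ ?R j)" by (simp add: det_def)
  finally show ?thesis ..
qed

lemma emeasure_image_le_nn_integral_det_wellorder:
  fixes f :: "real ^ 'n::{finite,wellorder} \<Rightarrow> real ^ 'n::_"
  assumes S: "S \<in> sets borel" "bounded S" and Q: "Q \<in> sets borel" "Q \<subseteq> f ` S"
    and f': "\<And>x. (f has_derivative (*v) (M x)) (at x)" and M: "continuous_on UNIV M"
  shows "emeasure lborel Q \<le> (\<integral>\<^sup>+x\<in>S. ennreal \<bar>det (M x)\<bar> \<partial>lborel)"
proof -
  let ?h = "\<lambda>x. \<bar>det (M x)\<bar>"
  have contM: "continuous_on A (\<lambda>x. M x $ i $ j)" for A i j
    by (intro continuous_intros continuous_on_subset[OF M]) auto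
  have cont: "continuous_on A ?h" for A
    unfolding det_def by (intro continuous_intros contM)
  have [measurable]: "?h \<in> borel_measurable borel" "S \<in> sets borel"
    using cont S by (auto intro: borel_measurable_continuous_onI)
  have "bounded (?h ` closure S)"
    by (intro compact_imp_bounded compact_continuous_image cont) (use S in simp)
  then obtain B where B: "\<And>x. x \<in> S \<Longrightarrow> ?h x \<le> B"
    unfolding bounded_iff using closure_subset by fastforce
  have fin: "emeasure lborel S < \<infinity>"
    by (rule emeasure_bounded_finite) (use S in simp)
  have int: "integrable lborel (\<lambda>x. indicator S x *\<^sub>R ?h x)"
    by (rule integrableI_bounded_set_indicator[of _ _ _ B]) (use B fin in \<open>auto\<close>)
  have set_int: "?h absolutely_integrable_on S"
    unfolding set_integrable_def by (rule integrable_completion[THEN iffD2]) (use int in auto)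
  hence intS: "?h integrable_on S" by (rule set_lebesgue_integral_eq_integral(1))
  have detM: "det (matrix ((*v) (M x))) = det (M x)" for x by simp
  have SL: "S \<in> sets lebesgue" using S by auto
  have der: "(f has_derivative (*v) (M x)) (at x within S)" if "x \<in> S" for x
    using f' has_derivative_at_withinI by blast
  have meas: "f ` S \<in> lmeasurable" "measure lebesgue (f ` S) \<le> integral S ?h"
    using measurable_differentiable_image[OF SL der] measure_differentiable_image[OF SL der] intS
    by simp_all
  have "emeasure lborel Q = emeasure lebesgue Q" using Q by simp
  also have "\<dots> \<le> emeasure lebesgue (f ` S)"
    by (rule emeasure_mono) (use Q meas in auto)
  also have "\<dots> = ennreal (measure lebesgue (f ` S))"
    using meas(1) by (simp add: emeasure_eq_measure2)
  also have "\<dots> \<le> ennreal (integral S ?h)" using meas(2) by (rule ennreal_leI)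
  also have "integral S ?h = (LINT x:S|lebesgue. ?h x)"
    using set_lebesgue_integral_eq_integral(2)[OF set_int] by simp
  also have "\<dots> = (LINT x|lborel. indicator S x *\<^sub>R ?h x)"
    unfolding set_lebesgue_integral_def by (rule integral_completion) measurable
  also have "ennreal \<dots> = (\<integral>\<^sup>+x. ennreal (indicator S x *\<^sub>R ?h x) \<partial>lborel)"
    by (rule nn_integral_eq_integral[symmetric]) (use int in auto)
  also have "\<dots> = (\<integral>\<^sup>+x\<in>S. ennreal (?h x) \<partial>lborel)"
    by (intro nn_integral_cong) (auto split: split_indicator)
  finally show ?thesis .
qed

text \<open>
  The map \<open>f\<close> may take values several times: only covering \<open>Q\<close> matters. Using the Borel set \<open>Q\<close> in
  place of the image of \<open>S\<close> keeps every set in the Borel algebra, which the renaming of coordinates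
  respects.
\<close>

lemma emeasure_image_le_nn_integral_det:
  fixes f :: "real ^ 'n::finite \<Rightarrow> real ^ 'n"
  assumes S: "S \<in> sets borel" "bounded S" and Q: "Q \<in> sets borel" "Q \<subseteq> f ` S"
    and f': "\<And>x. (f has_derivative (*v) (M x)) (at x)" and M: "continuous_on UNIV M"
  shows "emeasure lborel Q \<le> (\<integral>\<^sup>+x\<in>S. ennreal \<bar>det (M x)\<bar> \<partial>lborel)"
proof -
  let ?f = "\<lambda>y. relabel (f (unlabel y))"
  let ?M = "\<lambda>y. \<chi> i j. M (unlabel y) $ Rep_ordered_copy i $ Rep_ordered_copy j"
  note [measurable] = S(1) Q(1)
  have vimage: "unlabel -` A \<in> sets borel" if "A \<in> sets borel" for A :: "(real^'n) set"
    using measurable_sets[OF measurable_unlabel that] by simp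
  have cont_comp: "continuous_on UNIV (\<lambda>y. M (unlabel y) $ i $ j)" for i j
    by (intro continuous_intros continuous_on_compose2[OF M cont_unlabel]) auto
  have contM: "continuous_on A (\<lambda>x. M x $ i $ j)" for A i j
    by (intro continuous_intros continuous_on_subset[OF M]) auto
  have [measurable]: "(\<lambda>x. \<bar>det (M x)\<bar>) \<in> borel_measurable borel"
    unfolding det_def by (intro borel_measurable_continuous_onI continuous_intros contM)
  have eq: "relabel ` A = unlabel -` A" for A :: "(real^'n) set"
    by (auto simp: image_iff) (metis relabel_unlabel)
  have lin_eq: "relabel (M (unlabel y) *v unlabel v) = ?M y *v v" for y v
  proof -
    have "(\<Sum>j\<in>UNIV. M (unlabel y) $ Rep_ordered_copy i $ j * v $ Abs_ordered_copy j) =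
      (\<Sum>j\<in>UNIV. M (unlabel y) $ Rep_ordered_copy i $ Rep_ordered_copy j * v $ j)" for i
      by (rule sum.reindex_bij_betw[OF bij_Rep_ordered_copy, symmetric, THEN trans])
        (simp add: Rep_ordered_copy_inverse)
    thus ?thesis by (simp add: vec_eq_iff relabel_def unlabel_def matrix_vector_mult_def)
  qed
  have bl: "bounded_linear relabel" "bounded_linear unlabel"
    by (simp_all add: linear_conv_bounded_linear[symmetric] linear_relabel linear_unlabel)
  have der: "(?f has_derivative (*v) (?M y)) (at y)" for y
  proof -
    have "((\<lambda>y. f (unlabel y)) has_derivative (\<lambda>v. M (unlabel y) *v unlabel v)) (at y)"
      by (rule has_derivative_compose[OF bounded_linear_imp_has_derivative[OF bl(2)] f'])
    hence "(?f has_derivative (\<lambda>v. relabel (M (unlabel y) *v unlabel v))) (at y)"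
      by (rule bounded_linear.has_derivative[OF bl(1)])
    thus ?thesis by (simp add: lin_eq)
  qed
  have "emeasure lborel (unlabel -` Q) \<le> (\<integral>\<^sup>+y\<in>unlabel -` S. ennreal \<bar>det (?M y)\<bar> \<partial>lborel)"
  proof (rule emeasure_image_le_nn_integral_det_wellorder[where f = ?f])
    show "bounded (unlabel -` S)"
      unfolding eq[symmetric] by (rule bounded_linear_image[OF S(2) bl(1)])
    show "unlabel -` Q \<subseteq> ?f ` (unlabel -` S)"
      using Q(2) by (auto simp: eq[symmetric] image_image)
    show "continuous_on UNIV ?M"
      by (intro continuous_on_vec_lambda cont_comp)
  qed (use der vimage S Q in auto)
  also have "emeasure lborel (unlabel -` Q) = emeasure (distr lborel borel relabel) (unlabel -` Q)"
    by (simp add: distr_relabel)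
  also have "\<dots> = emeasure lborel (relabel -` unlabel -` Q)"
    using vimage[OF Q(1)] by (simp add: emeasure_distr)
  also have "relabel -` unlabel -` Q = Q" by auto
  also have "(\<integral>\<^sup>+y\<in>unlabel -` S. ennreal \<bar>det (?M y)\<bar> \<partial>lborel) =
      (\<integral>\<^sup>+y. ennreal \<bar>det (M (unlabel y))\<bar> * indicator S (unlabel y) \<partial>distr lborel borel relabel)"
    unfolding det_relabel distr_relabel by (intro nn_integral_cong) (auto split: split_indicator)
  also have "\<dots> = (\<integral>\<^sup>+x\<in>S. ennreal \<bar>det (M x)\<bar> \<partial>lborel)"
    by (subst nn_integral_distr) simp_all
  finally show ?thesis .
qed

section \<open>Positive semidefinite matrices\<close>

text \<open>
  By induction on the index set: splitting off the row and column \<open>k\<close> of \<open>h\<close> leaves the Schur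
  complement, which is again positive semidefinite, plus a matrix of rank one, on which \<open>B\<close> acts as a
  quadratic form. If \<open>h k k = 0\<close>, the whole row vanishes, and division by zero gives the right formula.
\<close>

lemma psd_trace_prod_nonneg_on:
  fixes h B :: "'i \<Rightarrow> 'i \<Rightarrow> real"
  assumes "finite S"
    and sym: "\<And>i j. i \<in> S \<Longrightarrow> j \<in> S \<Longrightarrow> h i j = h j i"
    and psd: "\<And>l. (\<Sum>i\<in>S. \<Sum>j\<in>S. h i j * l i * l j) \<ge> 0"
    and B: "\<And>l. (\<Sum>i\<in>S. \<Sum>j\<in>S. B i j * l i * l j) \<ge> 0"
  shows "(\<Sum>i\<in>S. \<Sum>j\<in>S. B i j * h i j) \<ge> 0"
  using assms
proof (induction S arbitrary: h rule: finite_induct)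
  case (insert k S)
  note split = sum.insert[OF insert(1,2)]
  have expand: "(\<Sum>i\<in>insert k S. \<Sum>j\<in>insert k S. F i j) =
      F k k + (\<Sum>j\<in>S. F k j) + (\<Sum>i\<in>S. F i k) + (\<Sum>i\<in>S. \<Sum>j\<in>S. F i j)" for F :: "'i \<Rightarrow> 'i \<Rightarrow> real"
    by (simp add: split sum.distrib)
  have hsym: "h i k = h k i" if "i \<in> S" for i using insert(4) that by auto
  have quad: "(\<Sum>i\<in>insert k S. \<Sum>j\<in>insert k S. h i j * l i * l j) =
      h k k * (l k)\<^sup>2 + 2 * l k * (\<Sum>i\<in>S. h k i * l i) + (\<Sum>i\<in>S. \<Sum>j\<in>S. h i j * l i * l j)" for l
  proof -
    have "(\<Sum>i\<in>S. h i k * l i * l k) = l k * (\<Sum>i\<in>S. h k i * l i)"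
      "(\<Sum>i\<in>S. h k i * l k * l i) = l k * (\<Sum>i\<in>S. h k i * l i)"
      by (simp_all add: sum_distrib_left hsym mult_ac)
    thus ?thesis by (simp add: expand power2_eq_square)
  qed
  have upd: "(\<Sum>i\<in>S. h k i * (l(k := s)) i) = (\<Sum>i\<in>S. h k i * l i)"
    "(\<Sum>i\<in>S. \<Sum>j\<in>S. h i j * (l(k := s)) i * (l(k := s)) j) = (\<Sum>i\<in>S. \<Sum>j\<in>S. h i j * l i * l j)" for l s
    using insert(2) by (auto intro!: sum.cong)
  have psd_upd: "h k k * s\<^sup>2 + 2 * s * (\<Sum>i\<in>S. h k i * l i) + (\<Sum>i\<in>S. \<Sum>j\<in>S. h i j * l i * l j) \<ge> 0" for l s
    using insert(5)[of "l(k := s)"] unfolding quad upd by simp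
  have kk: "h k k \<ge> 0" using psd_upd[of 1 "\<lambda>_. 0"] by simp
  have row0: "h k i = 0" if "h k k = 0" "i \<in> S" for i
  proof (rule ccontr)
    assume ne: "h k i \<noteq> 0"
    let ?l = "\<lambda>j. if j = i then 1 else 0 :: real"
    have sm: "(\<Sum>j\<in>S. h k j * ?l j) = h k i"
      using that insert(1) by (simp add: sum.delta' if_distrib cong: if_cong)
    define c where "c = (\<Sum>i\<in>S. \<Sum>j\<in>S. h i j * ?l i * ?l j)"
    have "2 * s * h k i + c \<ge> 0" for s
      using psd_upd[of s ?l] unfolding sm c_def[symmetric] that(1) by simp
    note this[of "- (\<bar>c\<bar> + 1) / (2 * h k i)"]
    moreover have "2 * (- (\<bar>c\<bar> + 1) / (2 * h k i)) * h k i = - (\<bar>c\<bar> + 1)" using ne by simp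
    ultimately show False by linarith
  qed
  define h' where "h' i j = h i j - h i k * h j k / h k k" for i j
  have rank1: "(\<Sum>i\<in>S. \<Sum>j\<in>S. h i k * h j k / h k k * l i * l j) = (\<Sum>i\<in>S. h k i * l i)\<^sup>2 / h k k" for l
    by (simp add: power2_eq_square sum_product sum_divide_distrib hsym mult_ac)
  have "(\<Sum>i\<in>S. \<Sum>j\<in>S. B i j * h' i j) \<ge> 0"
  proof (rule insert.IH)
    show "h' i j = h' j i" if "i \<in> S" "j \<in> S" for i j
      using insert(4)[of i j] that by (simp add: h'_def)
    show "0 \<le> (\<Sum>i\<in>S. \<Sum>j\<in>S. h' i j * l i * l j)" for l
    proof -
      let ?T = "\<Sum>i\<in>S. h k i * l i"
      have eq: "(\<Sum>i\<in>S. \<Sum>j\<in>S. h' i j * l i * l j) = (\<Sum>i\<in>S. \<Sum>j\<in>S. h i j * l i * l j) - ?T\<^sup>2 / h k k"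
        unfolding rank1[symmetric] by (simp add: h'_def left_diff_distrib sum_subtractf)
      show ?thesis
      proof (cases "h k k = 0")
        case True
        thus ?thesis using psd_upd[of 0 l] eq by simp
      next
        case False
        have "h k k * (?T / h k k)\<^sup>2 - 2 * (?T / h k k) * ?T = - (?T\<^sup>2 / h k k)"
          using False by (simp add: field_simps power2_eq_square)
        thus ?thesis using psd_upd[of "- (?T / h k k)" l] unfolding eq by simp
      qed
    qed
    show "0 \<le> (\<Sum>i\<in>S. \<Sum>j\<in>S. B i j * l i * l j)" for l
    proof -
      have "(\<Sum>i\<in>insert k S. \<Sum>j\<in>insert k S. B i j * (l(k := 0)) i * (l(k := 0)) j)
        = (\<Sum>i\<in>S. \<Sum>j\<in>S. B i j * (l(k := 0)) i * (l(k := 0)) j)"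
        by (simp add: expand)
      also have "\<dots> = (\<Sum>i\<in>S. \<Sum>j\<in>S. B i j * l i * l j)"
        using insert(2) by (auto intro!: sum.cong)
      finally show ?thesis using insert(6)[of "l(k := 0)"] by simp
    qed
  qed
  moreover have "(\<Sum>i\<in>insert k S. \<Sum>j\<in>insert k S. B i j * h i j) =
     (\<Sum>i\<in>insert k S. \<Sum>j\<in>insert k S. B i j * h i k * h j k) / h k k + (\<Sum>i\<in>S. \<Sum>j\<in>S. B i j * h' i j)"
  proof (cases "h k k = 0")
    case True
    thus ?thesis by (simp add: expand h'_def row0 hsym)
  next
    case False
    have "(\<Sum>i\<in>insert k S. \<Sum>j\<in>insert k S. B i j * h' i j) = (\<Sum>i\<in>S. \<Sum>j\<in>S. B i j * h' i j)"
      using False by (simp add: expand) (simp add: h'_def hsym)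
    moreover have "(\<Sum>i\<in>insert k S. \<Sum>j\<in>insert k S. B i j * h i j) =
       (\<Sum>i\<in>insert k S. \<Sum>j\<in>insert k S. B i j * h i k * h j k / h k k + B i j * h' i j)"
      by (intro sum.cong refl) (simp add: h'_def algebra_simps)
    ultimately show ?thesis by (simp add: sum.distrib sum_divide_distrib)
  qed
  ultimately show ?case
    using insert(6)[of "\<lambda>i. h i k"] kk by simp
qed simp

definition quad :: "real ^ 'n ^ 'n \<Rightarrow> real ^ 'n \<Rightarrow> real" where
  "quad A l = (\<Sum>i\<in>UNIV. \<Sum>j\<in>UNIV. A $ i $ j * l $ i * l $ j)"

text \<open>
  The trace of \<open>A B\<^sup>T\<close>; applied to the coefficient matrix and the Hessian of \<open>u\<close> it is the
  second-order part of the operator.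
\<close>

definition contract :: "real ^ 'n ^ 'n \<Rightarrow> real ^ 'n ^ 'n \<Rightarrow> real" where
  "contract A B = (\<Sum>i\<in>UNIV. \<Sum>j\<in>UNIV. A $ i $ j * B $ i $ j)"

lemma symmetric_entry:
  fixes H :: "real ^ 'n ^ 'n"
  assumes "transpose H = H"
  shows "H $ i $ j = H $ j $ i"
  by (subst assms[symmetric]) (simp only: transpose_def vec_lambda_beta)

lemma quad_eq_inner: "quad A l = l \<bullet> (A *v l)"
  by (simp add: quad_def inner_vec_def matrix_vector_mult_def sum_distrib_left mult_ac)

lemma contract_psd_nonneg:
  fixes A H :: "real ^ 'n ^ 'n"
  assumes "transpose H = H" "\<And>l. quad H l \<ge> 0" "\<And>l. quad A l \<ge> 0"
  shows "contract A H \<ge> 0"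
  unfolding contract_def
proof (rule psd_trace_prod_nonneg_on)
  show "H $ i $ j = H $ j $ i" for i j
    by (rule symmetric_entry[OF assms(1)])
  show "0 \<le> (\<Sum>i\<in>UNIV. \<Sum>j\<in>UNIV. H $ i $ j * l i * l j)" for l
    using assms(2)[of "\<chi> i. l i"] by (simp add: quad_def)
  show "0 \<le> (\<Sum>i\<in>UNIV. \<Sum>j\<in>UNIV. A $ i $ j * l i * l j)" for l
    using assms(3)[of "\<chi> i. l i"] by (simp add: quad_def)
qed simp

lemma quad_mat_1: "quad (mat 1) l = (norm l)\<^sup>2"
  by (simp add: quad_def mat_def power2_norm_eq_inner inner_vec_def if_distrib
     if_distribR cong: if_cong)

lemma contract_mat_1: "contract (mat 1) H = trace H"
  by (simp add: contract_def mat_def trace_def if_distrib if_distribR cong: if_cong)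

text \<open>
  Ellipticity says that \<open>A - \<delta> I\<close> is positive semidefinite.
\<close>

lemma trace_le_contract:
  fixes A H :: "real ^ 'n ^ 'n"
  assumes "transpose H = H" "\<And>l. quad H l \<ge> 0" "\<And>l. \<delta> * (norm l)\<^sup>2 \<le> quad A l"
  shows "\<delta> * trace H \<le> contract A H"
proof -
  have "0 \<le> contract (A - \<delta> *\<^sub>R mat 1) H"
  proof (rule contract_psd_nonneg[OF assms(1,2)])
    have "quad (A - \<delta> *\<^sub>R mat 1) l = quad A l - \<delta> * quad (mat 1) l" for l
      by (simp add: quad_def algebra_simps sum_subtractf sum_distrib_left)
    thus "quad (A - \<delta> *\<^sub>R mat 1) l \<ge> 0" for l using assms(3)[of l] by (simp add: quad_mat_1)
  qed
  also have "contract (A - \<delta> *\<^sub>R mat 1) H = contract A H - \<delta> * contract (mat 1) H"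
    by (simp add: contract_def algebra_simps sum_subtractf sum_distrib_left)
  finally show ?thesis by (simp add: contract_mat_1)
qed

text \<open>
  Testing the form with the sum and the difference of two basis vectors bounds an off-diagonal entry
  by the sum of two diagonal ones.
\<close>

lemma psd_entry_le_trace:
  fixes H :: "real ^ 'n ^ 'n"
  assumes sym: "transpose H = H" and psd: "\<And>l. quad H l \<ge> 0"
  shows "\<bar>H $ i $ j\<bar> \<le> trace H"
proof -
  have sym': "H $ j $ i = H $ i $ j" by (rule symmetric_entry[OF sym])
  have diag: "H $ k $ k \<ge> 0" for k
    using psd[of "axis k 1"]
    by (simp add: quad_eq_inner matrix_vector_mult_basis column_def inner_axis')
  have le: "H $ k $ k \<le> trace H" for k
    unfolding trace_def by (rule member_le_sum) (use diag in auto)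
  show ?thesis
  proof (cases "i = j")
    case True
    thus ?thesis using le diag by simp
  next
    case False
    have q: "quad H (axis i 1 + s *\<^sub>R axis j 1) = H $ i $ i + 2 * s * H $ i $ j + s\<^sup>2 * H $ j $ j" for s
      by (simp add: quad_eq_inner matrix_vector_right_distrib matrix_vector_mult_scaleR
          matrix_vector_mult_basis inner_add_left inner_add_right inner_axis' column_def sym'
          power2_eq_square algebra_simps)
    have "H $ i $ i + H $ j $ j = (\<Sum>k\<in>{i, j}. H $ k $ k)" using False by simp
    also have "\<dots> \<le> trace H"
      unfolding trace_def by (rule sum_mono2) (use diag in auto)
    finally have "H $ i $ i + H $ j $ j \<le> trace H" .
    moreover have "0 \<le> H $ i $ i + 2 * H $ i $ j + H $ j $ j"
      using psd[of "axis i 1 + 1 *\<^sub>R axis j 1"] q[of 1] by simp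
    moreover have "0 \<le> H $ i $ i - 2 * H $ i $ j + H $ j $ j"
      using psd[of "axis i 1 + (-1) *\<^sub>R axis j 1"] q[of "-1"] by simp
    ultimately show ?thesis using diag[of i] diag[of j] by linarith
  qed
qed

lemma abs_det_le_trace_power:
  fixes H :: "real ^ 'n ^ 'n"
  assumes sym: "transpose H = H" and psd: "\<And>l. quad H l \<ge> 0"
  shows "\<bar>det H\<bar> \<le> fact (CARD('n)) * trace H ^ CARD('n)"
proof -
  have "\<bar>det H\<bar> \<le> (\<Sum>p | p permutes (UNIV :: 'n set). \<bar>of_int (sign p) * (\<Prod>i\<in>UNIV. H $ i $ p i)\<bar>)"
    unfolding det_def by (rule sum_abs)
  also have "\<dots> \<le> (\<Sum>p | p permutes (UNIV :: 'n set). trace H ^ CARD('n))"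
  proof (rule sum_mono)
    fix p
    have "(\<Prod>i\<in>(UNIV::'n set). \<bar>H $ i $ p i\<bar>) \<le> (\<Prod>i\<in>(UNIV::'n set). trace H)"
      by (rule prod_mono) (use psd_entry_le_trace[OF assms] in auto)
    thus "\<bar>of_int (sign p) * (\<Prod>i\<in>UNIV. H $ i $ p i)\<bar> \<le> trace H ^ CARD('n)"
      by (simp add: abs_mult abs_prod flip: of_int_abs)
  qed
  also have "\<dots> = fact (CARD('n)) * trace H ^ CARD('n)"
    by (simp add: card_permutations)
  finally show ?thesis .
qed

text \<open>
  A form of the inequality between arithmetic and geometric mean of the eigenvalues. Estimating each
  term of the Leibniz expansion by the trace costs only a factor that depends on the dimension.
\<close>

lemma abs_det_le_contract_power:
  fixes A H :: "real ^ 'n ^ 'n"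
  assumes "transpose H = H" "\<And>l. quad H l \<ge> 0" "\<And>l. \<delta> * (norm l)\<^sup>2 \<le> quad A l"
    "\<delta> > 0" "contract A H \<le> f"
  shows "\<bar>det H\<bar> \<le> fact (CARD('n)) * (f / \<delta>) ^ CARD('n)"
proof -
  have "trace H \<ge> 0" using psd_entry_le_trace[OF assms(1,2)] by (meson abs_ge_zero order_trans)
  moreover have "trace H \<le> f / \<delta>"
    using trace_le_contract[OF assms(1-3)] assms(4,5) by (simp add: pos_le_divide_eq mult.commute)
  ultimately have "trace H ^ CARD('n) \<le> (f / \<delta>) ^ CARD('n)"
    by (intro power_mono)
  thus ?thesis using abs_det_le_trace_power[OF assms(1,2)]
    by (meson fact_ge_zero mult_left_mono order_trans)
qed

section \<open>The contact set of a twice differentiable function\<close>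

text \<open>
  If the Hessian form were positive in direction \<open>v\<close>, the directional derivative, which vanishes at
  the maximum, would be positive shortly after it, and \<open>w\<close> would increase.
\<close>

lemma interior_max_second_order:
  fixes w :: "real ^ 'n \<Rightarrow> real"
  assumes w: "\<And>z. (w has_derivative (\<lambda>v. g z \<bullet> v)) (at z)"
    and g: "(g has_derivative (*v) H) (at y)"
    and D: "open D" "y \<in> D" and max: "\<And>z. z \<in> D \<Longrightarrow> w z \<le> w y"
  shows "g y = 0" and "quad H v \<le> 0"
proof -
  have "(\<lambda>v. g y \<bullet> v) = (\<lambda>v. 0)"
    using differential_zero_maxmin[OF D(2,1) w] max by blast
  from fun_cong[OF this, of "g y"] show gy: "g y = 0" by simp
  show "quad H v \<le> 0"
  proof (rule ccontr)
    assume "\<not> quad H v \<le> 0"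
    define p where "p s = g (y + s *\<^sub>R v) \<bullet> v" for s
    have line: "((\<lambda>s. y + s *\<^sub>R v) has_derivative (\<lambda>s. s *\<^sub>R v)) (at s)" for s
      by (auto intro!: derivative_eq_intros)
    have "((\<lambda>s. g (y + s *\<^sub>R v)) has_derivative (\<lambda>s. H *v (s *\<^sub>R v))) (at 0)"
      by (rule has_derivative_compose[OF line]) (use g in simp)
    hence "(p has_derivative (\<lambda>s. (H *v (s *\<^sub>R v)) \<bullet> v)) (at 0)"
      unfolding p_def by (rule has_derivative_inner_left)
    hence p': "(p has_real_derivative quad H v) (at 0)"
      by (simp add: has_field_derivative_def quad_eq_inner matrix_vector_mult_scaleR inner_commute
          mult_commute_abs)
    from DERIV_pos_inc_right[OF p'] \<open>\<not> quad H v \<le> 0\<close>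
    obtain d where d: "d > 0" "\<And>s. 0 < s \<Longrightarrow> s < d \<Longrightarrow> p 0 < p s" by auto
    have "continuous (at 0) (\<lambda>s::real. y + s *\<^sub>R v)" by (intro continuous_intros)
    hence "\<forall>\<^sub>F s in at (0::real). y + s *\<^sub>R v \<in> D"
      unfolding continuous_at by (rule topological_tendstoD) (use D in auto)
    then obtain e where e: "e > 0" "\<And>s. s \<noteq> 0 \<Longrightarrow> \<bar>s\<bar> < e \<Longrightarrow> y + s *\<^sub>R v \<in> D"
      by (auto simp: eventually_at dist_real_def)
    define s where "s = min d e / 2"
    have s: "0 < s" "s < d" "s < e" using d(1) e(1) by (auto simp: s_def)
    have dw: "((\<lambda>s. w (y + s *\<^sub>R v)) has_real_derivative p s) (at s)" for s
    proof -
      have "((\<lambda>s. w (y + s *\<^sub>R v)) has_derivative (\<lambda>r. g (y + s *\<^sub>R v) \<bullet> (r *\<^sub>R v))) (at s)"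
        by (rule has_derivative_compose[OF line w])
      thus ?thesis by (simp add: has_field_derivative_def p_def mult_commute_abs)
    qed
    obtain r where r: "0 < r" "r < s" "w (y + s *\<^sub>R v) - w (y + 0 *\<^sub>R v) = (s - 0) * p r"
      using MVT2[OF s(1), of "\<lambda>s. w (y + s *\<^sub>R v)" p] dw by blast
    have "p r > 0" using d(2)[of r] r s gy by (simp add: p_def)
    hence "w (y + s *\<^sub>R v) > w y" using r(3) mult_pos_pos[OF s(1), of "p r"] by simp
    moreover have "w (y + s *\<^sub>R v) \<le> w y" by (rule max, rule e(2)) (use s in auto)
    ultimately show False by simp
  qed
qed

lemma measurable_times_indicator:
  fixes w :: "'a::euclidean_space \<Rightarrow> real"
  assumes "w \<in> borel_measurable (lebesgue_on D)" "D \<in> sets lebesgue"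
  shows "(\<lambda>y. ennreal (w y) * indicator D y) \<in> borel_measurable lebesgue"
proof -
  have "(\<lambda>y. ennreal (w y)) \<in> borel_measurable (lebesgue_on D)" using assms(1) by measurable
  thus ?thesis using assms(2) by (subst (asm) borel_measurable_restrict_space_iff_ennreal) auto
qed

text \<open>
  At a point \<open>y\<close> where \<open>u - \<phi> - q \<bullet> z\<close> has an interior maximum, \<open>Du - D\<phi> = q\<close> and \<open>D\<^sup>2\<phi> - D\<^sup>2u\<close> is
  positive semidefinite. Since \<open>\<phi>\<close> plus the linear function is a supersolution for the part of the
  operator without zeroth order term, and \<open>u y \<ge> 0\<close>, the contraction of this matrix with the
  coefficients is at most \<open>f y\<close>, which bounds its determinant. Up to sign that determinant is the
  Jacobian of \<open>Du - D\<phi>\<close>, whose image of the contact points covers \<open>Q\<close>.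
\<close>

lemma contact_measure_estimate:
  fixes u \<phi> f :: "real ^ 'n \<Rightarrow> real"
  assumes D: "open D" "bounded D" and Q: "Q \<in> sets borel" and \<delta>: "\<delta> > 0"
    and u: "\<And>y. (u has_derivative (\<lambda>v. Du y \<bullet> v)) (at y)" "\<And>y. (Du has_derivative (*v) (D2u y)) (at y)"
      "continuous_on UNIV D2u" "\<And>y. transpose (D2u y) = D2u y"
    and \<phi>: "\<And>y. (\<phi> has_derivative (\<lambda>v. D\<phi> y \<bullet> v)) (at y)" "\<And>y. (D\<phi> has_derivative (*v) (D2\<phi> y)) (at y)"
      "continuous_on UNIV D2\<phi>" "\<And>y. transpose (D2\<phi> y) = D2\<phi> y"
    and ell: "\<And>y l. y \<in> D \<Longrightarrow> \<delta> * (norm l)\<^sup>2 \<le> quad (a y) l" and c: "\<And>y. y \<in> D \<Longrightarrow> c y \<ge> 0"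
    and Lu: "\<And>y. y \<in> D \<Longrightarrow> - f y \<le> contract (a y) (D2u y) + b y \<bullet> Du y - c y * u y"
    and L\<phi>: "\<And>y q. y \<in> D \<Longrightarrow> q \<in> Q \<Longrightarrow> contract (a y) (D2\<phi> y) + b y \<bullet> (D\<phi> y + q) \<le> 0"
    and contact: "\<And>q. q \<in> Q \<Longrightarrow> \<exists>y\<in>D. 0 \<le> u y \<and> (\<forall>z\<in>D. u z - \<phi> z - q \<bullet> z \<le> u y - \<phi> y - q \<bullet> y)"
    and f: "f \<in> borel_measurable (lebesgue_on D)"
  shows "emeasure lborel Q \<le> ennreal (fact CARD('n) / \<delta> ^ CARD('n)) * (\<integral>\<^sup>+y\<in>D. ennreal (f y ^ CARD('n)) \<partial>lebesgue)"
proof -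
  define P where "P y = Du y - D\<phi> y" for y
  define H where "H y = D2\<phi> y - D2u y" for y
  have P': "(P has_derivative (*v) (- H y)) (at y)" for y
  proof -
    have "(P has_derivative (\<lambda>v. D2u y *v v - D2\<phi> y *v v)) (at y)"
      unfolding P_def by (intro has_derivative_diff u \<phi>)
    moreover have "(\<lambda>v. D2u y *v v - D2\<phi> y *v v) = (*v) (- H y)"
      by (rule ext) (simp add: H_def matrix_vector_mult_diff_rdistrib[symmetric])
    ultimately show ?thesis by simp
  qed
  have contP: "continuous_on UNIV P"
    by (rule has_derivative_continuous_on[OF has_derivative_at_withinI[OF P']])
  have contu: "continuous_on UNIV u"
    by (rule has_derivative_continuous_on[OF has_derivative_at_withinI[OF u(1)]])
  have contH: "continuous_on UNIV (\<lambda>y. - H y)"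
    unfolding H_def by (intro continuous_intros u \<phi>)
  have contq: "continuous_on UNIV (\<lambda>y. quad (H y) l)" for l
    unfolding quad_def H_def by (intro continuous_intros u \<phi>)
  \<comment> \<open>A Borel set that contains the contact points and on which the bound for the determinant still holds.\<close>
  define S where "S = D \<inter> {y. 0 \<le> u y} \<inter> P -` Q \<inter> (\<Inter>l. {y. 0 \<le> quad (H y) l})"
  have S: "S \<in> sets borel"
    unfolding S_def
  proof (intro sets.Int)
    show "P -` Q \<in> sets borel"
      using measurable_sets[OF borel_measurable_continuous_onI[OF contP] Q] by simp
    show "(\<Inter>l. {y. 0 \<le> quad (H y) l}) \<in> sets borel"
      by (intro borel_closed closed_INT ballI closed_Collect_le continuous_intros contq)
    show "{y. 0 \<le> u y} \<in> sets borel"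
      by (intro borel_closed closed_Collect_le continuous_intros contu)
  qed (use D in auto)
  have QS: "Q \<subseteq> P ` S"
  proof
    fix q assume q: "q \<in> Q"
    then obtain y where y: "y \<in> D" "0 \<le> u y" "\<And>z. z \<in> D \<Longrightarrow> u z - \<phi> z - q \<bullet> z \<le> u y - \<phi> y - q \<bullet> y"
      using contact by blast
    have w': "((\<lambda>z. u z - \<phi> z - q \<bullet> z) has_derivative (\<lambda>v. (P z - q) \<bullet> v)) (at z)" for z
      by (auto intro!: derivative_eq_intros u \<phi> simp: P_def inner_diff_left)
    have g': "((\<lambda>z. P z - q) has_derivative (*v) (- H y)) (at y)"
      using P'[of y] by (auto intro!: derivative_eq_intros)
    have Py: "P y = q" using interior_max_second_order(1)[OF w' g' D(1) y(1,3)] by simp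
    have "quad (- H y) l \<le> 0" for l by (rule interior_max_second_order(2)[OF w' g' D(1) y(1,3)])
    hence "y \<in> S" using y Py q by (auto simp: S_def quad_def sum_negf)
    thus "q \<in> P ` S" using Py by blast
  qed
  have det_le: "\<bar>det (- H y)\<bar> \<le> fact CARD('n) / \<delta> ^ CARD('n) * f y ^ CARD('n)" if "y \<in> S" for y
  proof -
    have y: "y \<in> D" "0 \<le> u y" "P y \<in> Q" "\<And>l. 0 \<le> quad (H y) l" using that by (auto simp: S_def)
    have "det (- H y) = (-1) ^ CARD('n) * det (H y)"
      using det_rows_mul[of "\<lambda>_. -1" "\<lambda>i. H y $ i"] by (simp add: uminus_vec_def)
    hence "\<bar>det (- H y)\<bar> = \<bar>det (H y)\<bar>" by (simp add: abs_mult)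
    also have "\<dots> \<le> fact (CARD('n)) * (f y / \<delta>) ^ CARD('n)"
    proof (rule abs_det_le_contract_power[OF _ y(4) ell[OF y(1)] \<delta>])
      show "transpose (H y) = H y"
        using u(4)[of y] \<phi>(4)[of y] by (simp add: H_def transpose_def vec_eq_iff)
      have "contract (a y) (H y) = contract (a y) (D2\<phi> y) - contract (a y) (D2u y)"
        by (simp add: contract_def H_def algebra_simps sum_subtractf)
      also have "\<dots> \<le> f y"
        using L\<phi>[OF y(1,3)] Lu[OF y(1)] mult_nonneg_nonneg[OF c[OF y(1)] y(2)]
        by (simp add: P_def)
      finally show "contract (a y) (H y) \<le> f y" .
    qed
    finally show ?thesis by (simp add: power_divide)
  qed
  have "emeasure lborel Q \<le> (\<integral>\<^sup>+y\<in>S. ennreal \<bar>det (- H y)\<bar> \<partial>lborel)"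
    by (rule emeasure_image_le_nn_integral_det[OF S _ Q QS P' contH])
      (use D(2) in \<open>auto simp: S_def intro: bounded_subset\<close>)
  also have "\<dots> = (\<integral>\<^sup>+y. ennreal \<bar>det (- H y)\<bar> * indicator S y \<partial>lebesgue)"
    by (rule nn_integral_completion[symmetric])
  also have "\<dots> \<le> (\<integral>\<^sup>+y. ennreal (fact CARD('n) / \<delta> ^ CARD('n)) * (ennreal (f y ^ CARD('n)) * indicator D y) \<partial>lebesgue)"
  proof (rule nn_integral_mono)
    fix y
    show "ennreal \<bar>det (- H y)\<bar> * indicator S y \<le> ennreal (fact CARD('n) / \<delta> ^ CARD('n)) * (ennreal (f y ^ CARD('n)) * indicator D y)"
    proof (cases "y \<in> S")
      case True
      hence "y \<in> D" by (simp add: S_def)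
      moreover have "ennreal (fact CARD('n) / \<delta> ^ CARD('n) * f y ^ CARD('n)) =
          ennreal (fact CARD('n) / \<delta> ^ CARD('n)) * ennreal (f y ^ CARD('n))"
        by (rule ennreal_mult') (use \<delta> in simp)
      ultimately show ?thesis using True ennreal_leI[OF det_le[OF True]] by simp
    qed simp
  qed
  also have "\<dots> = ennreal (fact CARD('n) / \<delta> ^ CARD('n)) * (\<integral>\<^sup>+y\<in>D. ennreal (f y ^ CARD('n)) \<partial>lebesgue)"
    by (rule nn_integral_cmult, rule measurable_times_indicator) (use f D(1) in auto)
  finally show ?thesis .
qed

text \<open>
  After a rotation that takes a basis vector to \<open>\<nu>\<close>, the set contains a box. The area inequality,
  applied to the inverse rotation, shows that the rotation does not decrease its measure.
\<close>

lemma emeasure_cylinder_ge: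
  fixes \<nu> :: "real ^ 'n" and s t :: real
  assumes \<nu>: "norm \<nu> = 1" and st: "s > 0" "t > 0"
  defines "Q \<equiv> {q. \<bar>q \<bullet> \<nu>\<bar> \<le> s \<and> norm (q - (q \<bullet> \<nu>) *\<^sub>R \<nu>) \<le> t}"
  shows "Q \<in> sets borel"
    and "ennreal (s * (t / CARD('n)) ^ (CARD('n) - 1)) \<le> emeasure lborel Q"
proof -
  show Q: "Q \<in> sets borel"
    unfolding Q_def by (intro borel_closed closed_Collect_conj closed_Collect_le continuous_intros)
  fix k :: 'n
  obtain U :: "real ^ 'n \<Rightarrow> real ^ 'n" where U: "orthogonal_transformation U" "U (axis k 1) = \<nu>"
  proof (rule orthogonal_transformation_exists_1[of "axis k (1::real)" \<nu>])
    fix f :: "real ^ 'n \<Rightarrow> real ^ 'n"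
    assume "orthogonal_transformation f" "f (axis k 1) = \<nu>"
    thus thesis by (rule that)
  qed (use \<nu> in auto)
  define T where "T = inv U"
  have T: "orthogonal_transformation T" "\<And>x. T (U x) = x" "\<And>x. U (T x) = x"
    using orthogonal_transformation_inv[OF U(1)] orthogonal_transformation_inj[OF U(1)]
      orthogonal_transformation_surj[OF U(1)]
    by (auto simp: T_def inv_f_f surj_f_inv_f)
  define b where "b = (\<chi> i. if i = k then s else t / CARD('n))"
  have b: "b $ i > 0" for i using st by (simp add: b_def)
  have lin: "linear U" "linear T" using U T orthogonal_transformation_linear by blast+
  have UQ: "U ` cbox (- b) b \<subseteq> Q"
  proof
    fix q assume "q \<in> U ` cbox (- b) b"
    then obtain p where p: "q = U p" "\<And>i. \<bar>p $ i\<bar> \<le> b $ i"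
      by (force simp: mem_box_cart abs_le_iff minus_le_iff)
    have q\<nu>: "q \<bullet> \<nu> = p $ k"
    proof -
      have "U p \<bullet> U (axis k 1) = p \<bullet> axis k 1"
        using U(1) by (simp add: orthogonal_transformation_def)
      thus ?thesis by (simp add: p(1) U(2) inner_axis)
    qed
    have "q - (q \<bullet> \<nu>) *\<^sub>R \<nu> = U (p - p $ k *\<^sub>R axis k 1)"
      unfolding q\<nu> unfolding p(1) by (simp add: linear_diff[OF lin(1)] linear_scale[OF lin(1)] U(2))
    hence "norm (q - (q \<bullet> \<nu>) *\<^sub>R \<nu>) = norm (p - p $ k *\<^sub>R axis k 1)"
      using U(1) by (simp add: orthogonal_transformation)
    also have "\<dots> \<le> (\<Sum>i\<in>UNIV. \<bar>(p - p $ k *\<^sub>R axis k 1) $ i\<bar>)" by (rule norm_le_l1_cart)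
    also have "\<dots> \<le> (\<Sum>i\<in>(UNIV :: 'n set). t / CARD('n))"
    proof (rule sum_mono)
      fix i show "\<bar>(p - p $ k *\<^sub>R axis k 1) $ i\<bar> \<le> t / CARD('n)"
        using p(2)[of i] st by (auto simp: axis_def b_def split: if_splits)
    qed
    also have "\<dots> = t" by simp
    finally show "q \<in> Q" using q\<nu> p(2)[of k] by (simp add: Q_def b_def)
  qed
  have compU: "compact (U ` cbox (- b) b)"
    by (intro compact_continuous_image linear_continuous_on) (use lin in \<open>auto simp: linear_conv_bounded_linear\<close>)
  have UB: "U ` cbox (- b) b \<in> sets borel"
    using compU by (intro borel_closed compact_imp_closed)
  have detT: "\<bar>det (matrix T)\<bar> = 1"
    using T(1) orthogonal_transformation_matrix[of T] det_orthogonal_matrix[of "matrix T"] by auto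
  have Tm: "(*v) (matrix T) = T" using lin(2) by (auto simp: matrix_works)
  have "ennreal (s * (t / CARD('n)) ^ (CARD('n) - 1)) \<le> ennreal (\<Prod>i\<in>UNIV. b $ i - (- b) $ i)"
  proof (rule ennreal_leI)
    have "(\<Prod>i\<in>(UNIV::'n set). b $ i) = b $ k * (\<Prod>i\<in>UNIV - {k}. b $ i)"
      by (simp add: prod.remove)
    also have "(\<Prod>i\<in>UNIV - {k}. b $ i) = (\<Prod>i\<in>(UNIV :: 'n set) - {k}. t / CARD('n))"
      by (rule prod.cong) (auto simp: b_def)
    also have "\<dots> = (t / CARD('n)) ^ (CARD('n) - 1)" by (simp add: card_Diff_singleton)
    finally have "s * (t / CARD('n)) ^ (CARD('n) - 1) = (\<Prod>i\<in>UNIV. b $ i)" by (simp add: b_def)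
    also have "\<dots> \<le> (\<Prod>i\<in>UNIV. b $ i - (- b) $ i)"
      by (rule prod_mono) (use b in \<open>auto simp: less_imp_le\<close>)
    finally show "s * (t / CARD('n)) ^ (CARD('n) - 1) \<le> (\<Prod>i\<in>UNIV. b $ i - (- b) $ i)" .
  qed
  also have "\<dots> = emeasure lborel (box (- b) b)"
    by (rule box_cart_prod[symmetric]) (use b in \<open>auto simp: less_imp_le\<close>)
  also have "\<dots> \<le> emeasure lborel (cbox (- b) b)"
    by (rule emeasure_mono) (auto simp: box_subset_cbox)
  also have "\<dots> \<le> (\<integral>\<^sup>+x\<in>U ` cbox (- b) b. ennreal \<bar>det (matrix T)\<bar> \<partial>lborel)"
  proof (rule emeasure_image_le_nn_integral_det[where f = T and M = "\<lambda>_. matrix T"])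
    show "cbox (- b) b \<subseteq> T ` U ` cbox (- b) b" using T(2) by (auto simp: image_image)
    show "(T has_derivative (*v) (matrix T)) (at x)" for x
      unfolding Tm using lin(2) by (simp add: linear_conv_bounded_linear bounded_linear_imp_has_derivative)
  qed (use UB compact_imp_bounded[OF compU] in auto)
  also have "\<dots> = emeasure lborel (U ` cbox (- b) b)"
    using UB by (simp add: detT)
  also have "\<dots> \<le> emeasure lborel Q" by (rule emeasure_mono[OF UQ]) (use Q in simp)
  finally show "ennreal (s * (t / CARD('n)) ^ (CARD('n) - 1)) \<le> emeasure lborel Q" .
qed

section \<open>Pointwise estimate at an exterior ball, smooth case\<close>

text \<open>
  The estimate at an exterior ball for functions that are twice continuously differentiable on the
  whole space. The ball has radius \<open>r0\<close> and centre \<open>x - (h + r0) \<nu>\<close>, so \<open>x\<close> lies at distance \<open>h\<close>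
  from it. The constant \<open>N\<close> is a parameter because it has to be chosen before the domain, the
  coefficients and the solution.
\<close>

definition smooth_estimate :: "(real ^ 'n::finite) itself \<Rightarrow> real \<Rightarrow> real \<Rightarrow> real \<Rightarrow> real \<Rightarrow> real \<Rightarrow> bool" where
  "smooth_estimate _ r0 R1 \<delta> K N \<longleftrightarrow> (\<forall>D x \<nu> h S a b c f Du D2u u.
    open D \<and> D \<subseteq> cball x R1 \<and> x \<in> D \<and> norm \<nu> = 1 \<and> 0 < h \<and> h \<le> R1 \<and>
    D \<inter> ball (x - (h + r0) *\<^sub>R \<nu>) r0 = {} \<and>
    (\<forall>y\<in>D. \<forall>l. quad (a y) l \<le> inverse \<delta> * (norm l)\<^sup>2 \<and> \<delta> * (norm l)\<^sup>2 \<le> quad (a y) l) \<and>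
    (\<forall>y\<in>D. norm (b y) \<le> K \<and> 0 \<le> c y) \<and>
    (\<forall>y. (u has_derivative (\<lambda>v. Du y \<bullet> v)) (at y)) \<and> (\<forall>y. (Du has_derivative (*v) (D2u y)) (at y)) \<and>
    continuous_on UNIV D2u \<and> (\<forall>y. transpose (D2u y) = D2u y) \<and>
    (\<forall>y\<in>D. - f y \<le> contract (a y) (D2u y) + b y \<bullet> Du y - c y * u y) \<and>
    f \<in> borel_measurable (lebesgue_on D) \<and>
    0 \<le> S \<and> (\<forall>y\<in>frontier D. u y \<le> S) \<and> S < u x \<longrightarrow>
    ennreal ((u x - S) ^ CARD('n)) \<le> ennreal (N * h powr ((real CARD('n) + 1) / 2)) *
      (\<integral>\<^sup>+y\<in>D. ennreal (f (y :: real ^ 'n) ^ CARD('n)) \<partial>lebesgue))"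

text \<open>
  Let \<open>xh\<close> be the point of the exterior ball nearest to \<open>x\<close>, and \<open>z\<close> the centre of the ball of half the
  radius touching the exterior ball from inside at \<open>xh\<close>. The power \<open>\<sigma>\<close> of a point with respect to
  this smaller ball vanishes at \<open>xh\<close>; outside the exterior ball it dominates both the squared distance
  from \<open>xh\<close> and the normal displacement. The barrier \<open>\<psi> = 1 - exp (- A \<sigma>)\<close> inherits these bounds,
  and for large \<open>A\<close> it is a strict supersolution. Choosing \<open>t\<close> so that \<open>t \<psi> x \<le> m / 4\<close>, the quadratic
  lower bound for \<open>t \<psi>\<close> compensates \<open>q \<bullet> (y - xh)\<close> up to \<open>m / 4\<close> for all \<open>q \<in> Q\<close>. So
  \<open>u - \<phi> - q \<bullet> (y - xh)\<close> is larger at \<open>x\<close> than on the boundary and has an interior maximum, where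
  \<open>u\<close> is positive.
\<close>

lemma smooth_exterior_ball_estimate:
  fixes r0 R1 \<delta> K :: real
  assumes "r0 > 0" "R1 > 0" "\<delta> > 0" "K > 0"
  shows "\<exists>N>0. smooth_estimate TYPE(real ^ 'n) r0 R1 \<delta> K N"
proof -
  define d where "d = real CARD('n)"
  have d: "d \<ge> 1" unfolding d_def using one_le_card_finite[where 'a='n] by simp
  define r1 where "r1 = r0 / 2"
  \<comment> \<open>With this \<open>A\<close> the second-order decay exceeds the trace and drift terms by one, see the proof of \<open>L\<phi>\<close>.\<close>
  define A where "A = (d / (\<delta> * r1\<^sup>2) + K / r1 + 1 / r1\<^sup>2) / (2 * \<delta>)"
  define smax where "smax = (2 * R1 + r1)\<^sup>2"
  define C0 where "C0 = R1 + 2 * r1"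
  define \<kappa>0 where "\<kappa>0 = 2 * A * exp (- A * smax)"
  define \<kappa>1 where "\<kappa>1 = exp (- A * smax) / (4 * C0)"
  \<comment> \<open>The first two entries control \<open>q \<bullet> \<xi>\<close> by the barrier, the third one at the point \<open>x\<close>, and the last one lets the barrier absorb \<open>b \<bullet> q\<close>.\<close>
  define c0 where "c0 = min (min (\<kappa>1 * r1 / 3) (sqrt \<kappa>1 / 2)) (min (1 / 8) (\<kappa>0 / (4 * A * C0 * K * (1 + sqrt R1))))"
  have pos: "r1 > 0" "A > 0" "smax > 0" "C0 > 0" "\<kappa>0 > 0" "\<kappa>1 > 0"
    using assms d by (auto simp: r1_def A_def smax_def C0_def \<kappa>0_def \<kappa>1_def intro!: divide_pos_pos add_pos_pos mult_pos_pos)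
  have c0: "c0 > 0"
    unfolding c0_def using pos assms by (auto intro!: divide_pos_pos mult_pos_pos add_pos_nonneg)
  have c0_le: "c0 \<le> \<kappa>1 * r1 / 3" "c0 \<le> sqrt \<kappa>1 / 2" "c0 \<le> 1 / 8" "c0 \<le> \<kappa>0 / (4 * A * C0 * K * (1 + sqrt R1))"
    unfolding c0_def by linarith+
  define N where "N = (d / c0) ^ CARD('n) * (fact CARD('n) / \<delta> ^ CARD('n))"
  have N: "N > 0" using d c0 assms by (auto simp: N_def intro!: mult_pos_pos divide_pos_pos)
  show ?thesis
    unfolding smooth_estimate_def
  proof (intro exI[of _ N] conjI N allI impI, elim conjE)
    fix D :: "(real^'n) set" and x \<nu> :: "real^'n" and h S :: real and a b c f Du D2u and u :: "real^'n \<Rightarrow> real"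
    assume D: "open D" "D \<subseteq> cball x R1" "x \<in> D" and \<nu>: "norm \<nu> = 1" and h: "0 < h" "h \<le> R1"
      and ext: "D \<inter> ball (x - (h + r0) *\<^sub>R \<nu>) r0 = {}"
      and a: "\<forall>y\<in>D. \<forall>l. quad (a y) l \<le> inverse \<delta> * (norm l)\<^sup>2 \<and> \<delta> * (norm l)\<^sup>2 \<le> quad (a y) l"
      and bc: "\<forall>y\<in>D. norm (b y) \<le> K \<and> 0 \<le> c y"
      and u: "\<forall>y. (u has_derivative (\<lambda>v. Du y \<bullet> v)) (at y)" "\<forall>y. (Du has_derivative (*v) (D2u y)) (at y)"
        "continuous_on UNIV D2u" "\<forall>y. transpose (D2u y) = D2u y"
      and Lu: "\<forall>y\<in>D. - f y \<le> contract (a y) (D2u y) + b y \<bullet> Du y - c y * u y"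
      and f: "f \<in> borel_measurable (lebesgue_on D)"
      and S: "0 \<le> S" "\<forall>y\<in>frontier D. u y \<le> S" "S < u x"
    define m where "m = u x - S"
    have m: "m > 0" using S by (simp add: m_def)
    define xh where "xh = x - h *\<^sub>R \<nu>"
    define z where "z = xh - r1 *\<^sub>R \<nu>"
    define \<sigma> where "\<sigma> y = (norm (y - z))\<^sup>2 - r1\<^sup>2" for y
    have \<nu>\<nu>: "\<nu> \<bullet> \<nu> = 1" using \<nu> by (simp add: dot_square_norm)
    have norm_shift: "(norm (\<xi> + r *\<^sub>R \<nu>))\<^sup>2 = (norm \<xi>)\<^sup>2 + 2 * r * (\<xi> \<bullet> \<nu>) + r\<^sup>2" for \<xi> r
      unfolding power2_norm_eq_inner
      by (simp add: inner_add_left inner_add_right \<nu>\<nu> inner_commute power2_eq_square)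
    have \<sigma>_xh: "\<sigma> y = (norm (y - xh))\<^sup>2 + 2 * r1 * ((y - xh) \<bullet> \<nu>)" for y
    proof -
      have "y - z = (y - xh) + r1 *\<^sub>R \<nu>" by (simp add: z_def algebra_simps)
      hence "(norm (y - z))\<^sup>2 = (norm ((y - xh) + r1 *\<^sub>R \<nu>))\<^sup>2" by (simp only:)
      also have "\<dots> = (norm (y - xh))\<^sup>2 + 2 * r1 * ((y - xh) \<bullet> \<nu>) + r1\<^sup>2"
        by (rule norm_shift)
      finally show ?thesis unfolding \<sigma>_def by linarith
    qed
    have cl_ext: "closure D \<inter> ball (x - (h + r0) *\<^sub>R \<nu>) r0 = {}"
      using ext open_Int_closure_eq_empty[OF open_ball, of "x - (h + r0) *\<^sub>R \<nu>" r0 D]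
      by (simp add: Int_commute)
    have cl_D: "closure D \<subseteq> cball x R1" by (rule closure_minimal[OF D(2) closed_cball])
    \<comment> \<open>Points of \<open>D\<close> lie outside the exterior ball, whose radius is \<open>2 * r1\<close>.\<close>
    have \<sigma>_lower: "(norm (y - xh))\<^sup>2 / 2 \<le> \<sigma> y" "\<bar>(y - xh) \<bullet> \<nu>\<bar> \<le> 3 * \<sigma> y / (2 * r1)" if "y \<in> closure D" for y
    proof -
      let ?\<xi> = "y - xh"
      have eq: "y - (x - (h + r0) *\<^sub>R \<nu>) = ?\<xi> + r0 *\<^sub>R \<nu>" by (simp add: xh_def algebra_simps)
      have "r0 \<le> norm (y - (x - (h + r0) *\<^sub>R \<nu>))"
        using cl_ext that by (auto simp: dist_norm norm_minus_commute)
      hence "r0\<^sup>2 \<le> (norm (?\<xi> + r0 *\<^sub>R \<nu>))\<^sup>2"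
        unfolding eq using assms(1) by (intro power_mono) auto
      hence ge: "0 \<le> (norm ?\<xi>)\<^sup>2 + 4 * r1 * (?\<xi> \<bullet> \<nu>)"
        unfolding norm_shift by (simp add: r1_def)
      thus 1: "(norm ?\<xi>)\<^sup>2 / 2 \<le> \<sigma> y" by (simp add: \<sigma>_xh)
      have "2 * r1 * \<bar>?\<xi> \<bullet> \<nu>\<bar> = \<bar>\<sigma> y - (norm ?\<xi>)\<^sup>2\<bar>" using pos(1) by (simp add: \<sigma>_xh abs_mult)
      also have "\<dots> \<le> 3 * \<sigma> y"
        using 1 zero_le_power2[of "norm ?\<xi>"] by (intro abs_leI) linarith+
      finally show "\<bar>?\<xi> \<bullet> \<nu>\<bar> \<le> 3 * \<sigma> y / (2 * r1)" using pos(1) by (simp add: field_simps)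
    qed
    have \<sigma>_nonneg: "0 \<le> \<sigma> y" if "y \<in> closure D" for y
      using \<sigma>_lower(1)[OF that] zero_le_power2[of "norm (y - xh)"] by linarith
    have \<sigma>_upper: "\<sigma> y \<le> smax" if "y \<in> closure D" for y
    proof -
      have eq: "y - z = (y - x) + (h + r1) *\<^sub>R \<nu>" by (simp add: z_def xh_def algebra_simps)
      have "norm (y - z) \<le> norm (y - x) + norm ((h + r1) *\<^sub>R \<nu>)"
        unfolding eq by (rule norm_triangle_ineq)
      also have "\<dots> \<le> R1 + (R1 + r1)"
        using cl_D that \<nu> h pos(1) by (intro add_mono) (auto simp: dist_norm norm_minus_commute)
      finally have "norm (y - z) \<le> 2 * R1 + r1" by simp
      hence "(norm (y - z))\<^sup>2 \<le> smax" unfolding smax_def by (intro power_mono) auto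
      thus ?thesis unfolding \<sigma>_def using zero_le_power2[of r1] by linarith
    qed
    define \<psi> where "\<psi> y = 1 - exp (- A * \<sigma> y)" for y
    define t where "t = m / (4 * A * C0 * h)"
    have t: "t > 0" using m pos h by (simp add: t_def)
    define \<phi> where "\<phi> y = t * \<psi> y" for y
    define E where "E y = 2 * A * t * exp (- A * \<sigma> y)" for y
    define D\<phi> where "D\<phi> y = E y *\<^sub>R (y - z)" for y
    define D2\<phi> where "D2\<phi> y = (\<chi> i j. E y * ((if i = j then 1 else 0) - 2 * A * (y - z) $ i * (y - z) $ j))" for y
    have \<sigma>': "(\<sigma> has_derivative (\<lambda>v. 2 * ((y - z) \<bullet> v))) (at y)" for y
      unfolding \<sigma>_def power2_norm_eq_inner
      by (auto intro!: derivative_eq_intros simp: inner_commute algebra_simps)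
    have E': "(E has_derivative (\<lambda>v. - 2 * A * E y * ((y - z) \<bullet> v))) (at y)" for y
      unfolding E_def by (auto intro!: derivative_eq_intros \<sigma>' simp: algebra_simps)
    have \<phi>': "(\<phi> has_derivative (\<lambda>v. D\<phi> y \<bullet> v)) (at y)" for y
      unfolding \<phi>_def \<psi>_def D\<phi>_def E_def by (auto intro!: derivative_eq_intros \<sigma>' simp: algebra_simps)
    have D\<phi>': "(D\<phi> has_derivative (*v) (D2\<phi> y)) (at y)" for y
    proof -
      have "(D\<phi> has_derivative (\<lambda>v. E y *\<^sub>R v + (- 2 * A * E y * ((y - z) \<bullet> v)) *\<^sub>R (y - z))) (at y)"
        unfolding D\<phi>_def by (auto intro!: derivative_eq_intros E')
      moreover have "(\<lambda>v. E y *\<^sub>R v + (- 2 * A * E y * ((y - z) \<bullet> v)) *\<^sub>R (y - z)) = (*v) (D2\<phi> y)"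
      proof
        fix v
        have row: "(\<Sum>j\<in>UNIV. e * ((if i = j then 1 else 0) - 2 * A * p $ i * p $ j) * v $ j) =
            e * v $ i - 2 * A * e * p $ i * (\<Sum>j\<in>UNIV. p $ j * v $ j)" for e i and p :: "real ^ 'n"
        proof -
          have "(\<Sum>j\<in>UNIV. e * ((if i = j then 1 else 0) - 2 * A * p $ i * p $ j) * v $ j) =
            (\<Sum>j\<in>UNIV. (if i = j then e * v $ j else 0) - 2 * A * e * p $ i * (p $ j * v $ j))"
            by (intro sum.cong refl) (simp add: algebra_simps)
          thus ?thesis by (simp add: sum_subtractf sum_distrib_left)
        qed
        show "E y *\<^sub>R v + (- 2 * A * E y * ((y - z) \<bullet> v)) *\<^sub>R (y - z) = D2\<phi> y *v v"
          unfolding vec_eq_iff D2\<phi>_def matrix_vector_mult_def vec_lambda_beta row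
          by (simp add: inner_vec_def mult_ac)
      qed
      ultimately show ?thesis by simp
    qed
    have contE: "continuous_on UNIV E"
      by (rule has_derivative_continuous_on[OF has_derivative_at_withinI[OF E']])
    have cont_D2\<phi>: "continuous_on UNIV D2\<phi>"
      unfolding D2\<phi>_def by (intro continuous_on_vec_lambda continuous_intros contE)
    have sym\<phi>: "transpose (D2\<phi> y) = D2\<phi> y" for y
      by (simp add: D2\<phi>_def transpose_def vec_eq_iff mult_ac eq_commute del: vector_minus_component)
    define Q where "Q = {q. \<bar>q \<bullet> \<nu>\<bar> \<le> c0 * m / h \<and> norm (q - (q \<bullet> \<nu>) *\<^sub>R \<nu>) \<le> c0 * m / sqrt h}"
    have Q_pos: "c0 * m / h > 0" "c0 * m / sqrt h > 0" using c0 m h by auto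
    have Q: "Q \<in> sets borel" and Q_large: "ennreal (c0 * m / h * (c0 * m / sqrt h / CARD('n)) ^ (CARD('n) - 1)) \<le> emeasure lborel Q"
      unfolding Q_def using emeasure_cylinder_ge[OF \<nu> Q_pos] by auto
    have L\<phi>: "contract (a y) (D2\<phi> y) + b y \<bullet> (D\<phi> y + q) \<le> 0" if y: "y \<in> D" and q: "q \<in> Q" for y q
    proof -
      define s where "s = norm (y - z)"
      have ycl: "y \<in> closure D" using y closure_subset by blast
      have "r1\<^sup>2 \<le> s\<^sup>2" using \<sigma>_nonneg[OF ycl] by (simp add: \<sigma>_def s_def)
      hence s: "r1 \<le> s" by (rule power2_le_imp_le) (simp add: s_def)
      have Epos: "E y > 0" using pos t by (simp add: E_def)
      have trace: "trace (a y) \<le> d / \<delta>"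
      proof -
        have "trace (a y) \<le> (\<Sum>i\<in>(UNIV :: 'n set). inverse \<delta>)"
          unfolding trace_def
        proof (rule sum_mono)
          fix i
          have "quad (a y) (axis i 1) \<le> inverse \<delta> * (norm (axis i (1::real)))\<^sup>2" using a y by blast
          thus "a y $ i $ i \<le> inverse \<delta>"
            by (simp add: quad_eq_inner matrix_vector_mult_basis column_def inner_axis')
        qed
        thus ?thesis by (simp add: d_def field_simps)
      qed
      have "contract (a y) (D2\<phi> y) = E y * (contract (a y) (mat 1) - 2 * A * quad (a y) (y - z))"
        unfolding contract_def D2\<phi>_def quad_def mat_def
        by (simp add: sum_distrib_left sum_subtractf[symmetric] algebra_simps)
      also have "contract (a y) (mat 1) = trace (a y)"
        by (simp add: contract_def mat_def trace_def if_distrib if_distribR cong: if_cong)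
      finally have contr: "contract (a y) (D2\<phi> y) = E y * (trace (a y) - 2 * A * quad (a y) (y - z))" .
      have quad: "\<delta> * s\<^sup>2 \<le> quad (a y) (y - z)" using a y by (simp add: s_def)
      have bb: "b y \<bullet> v \<le> K * norm v" for v
        using norm_cauchy_schwarz[of "b y" v] mult_right_mono[of "norm (b y)" K "norm v"] bc y by fastforce
      have bD: "b y \<bullet> D\<phi> y \<le> E y * (K * s)"
        using mult_left_mono[OF bb[of "y - z"], of "E y"] Epos by (simp add: D\<phi>_def s_def)
      have sr: "1 \<le> s / r1" using s pos by simp
      have "d / \<delta> + K * s + 1 \<le> d / \<delta> * (s / r1)\<^sup>2 + K * s * (s / r1) + (s / r1)\<^sup>2"
      proof (intro add_mono)
        have sq: "1 \<le> (s / r1)\<^sup>2" using sr by (simp add: one_le_power)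
        thus "1 \<le> (s / r1)\<^sup>2" .
        show "d / \<delta> \<le> d / \<delta> * (s / r1)\<^sup>2" using mult_left_mono[OF sq, of "d / \<delta>"] d assms by simp
        have "0 \<le> K * s" using assms by (simp add: s_def)
        from mult_left_mono[OF sr this] show "K * s \<le> K * s * (s / r1)" by simp
      qed
      also have "\<dots> = 2 * A * (\<delta> * s\<^sup>2)"
        unfolding A_def using assms pos by (simp add: field_simps power2_eq_square)
      also have "\<dots> \<le> 2 * A * quad (a y) (y - z)" using quad pos by simp
      finally have "trace (a y) - 2 * A * quad (a y) (y - z) + K * s \<le> - 1" using trace by simp
      from mult_left_mono[OF this, of "E y"] Epos contr bD
      have main: "contract (a y) (D2\<phi> y) + b y \<bullet> D\<phi> y \<le> - E y" by (simp add: algebra_simps)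
      have "t * \<kappa>0 \<le> E y"
      proof -
        have "exp (- A * smax) \<le> exp (- A * \<sigma> y)" using \<sigma>_upper[OF ycl] pos by simp
        from mult_left_mono[OF this, of "2 * A * t"] pos t show ?thesis by (simp add: E_def \<kappa>0_def mult_ac)
      qed
      moreover have "b y \<bullet> q \<le> t * \<kappa>0"
      proof -
        have "norm q \<le> norm ((q \<bullet> \<nu>) *\<^sub>R \<nu>) + norm (q - (q \<bullet> \<nu>) *\<^sub>R \<nu>)"
          using norm_triangle_ineq[of "(q \<bullet> \<nu>) *\<^sub>R \<nu>" "q - (q \<bullet> \<nu>) *\<^sub>R \<nu>"] by simp
        also have "\<dots> \<le> c0 * m / h + c0 * m / sqrt h" using q \<nu> by (simp add: Q_def)
        also have "\<dots> = c0 * (m / h) * (1 + sqrt h)"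
        proof -
          have "c0 * (m / h) * sqrt h = c0 * (m / h) * (h / sqrt h)"
            using h by (simp only: real_div_sqrt[OF less_imp_le])
          also have "\<dots> = c0 * m / sqrt h" using h by simp
          finally show ?thesis by (simp only: ring_distribs mult_1_right times_divide_eq_right)
        qed
        also have "\<dots> \<le> c0 * (m / h) * (1 + sqrt R1)"
          using c0 m h by (intro mult_left_mono) auto
        also have "\<dots> \<le> \<kappa>0 / (4 * A * C0 * K * (1 + sqrt R1)) * (m / h) * (1 + sqrt R1)"
          using c0_le(4) m h assms by (intro mult_right_mono) auto
        also have "\<dots> = t * \<kappa>0 / K"
        proof -
          have "\<kappa>0 / (4 * A * C0 * K * P) * (m / h) * P = t * \<kappa>0 / K" if "P > 0" for P
            using that assms pos h by (simp add: t_def mult_ac)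
          moreover have "1 + sqrt R1 > 0" using assms by (simp add: add_pos_nonneg)
          ultimately show ?thesis by blast
        qed
        finally have "K * norm q \<le> t * \<kappa>0" using assms by (simp add: field_simps)
        thus ?thesis using bb[of q] by linarith
      qed
      ultimately show ?thesis using main by (simp add: inner_add_right)
    qed
    have \<phi>_lower: "- m / 4 \<le> \<phi> y + q \<bullet> (y - xh)" if y: "y \<in> closure D" and q: "q \<in> Q" for y q
    proof -
      define g where "g = norm (y - xh)"
      define w where "w = 1 / sqrt h"
      have w: "w > 0" "w\<^sup>2 = 1 / h" using h by (simp_all add: w_def power_divide)
      have g: "g \<ge> 0" "g\<^sup>2 \<le> 2 * \<sigma> y" using \<sigma>_lower(1)[OF y] by (simp_all add: g_def)
      have \<sigma>0: "0 \<le> \<sigma> y" by (rule \<sigma>_nonneg[OF y])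
      have "A * \<sigma> y * exp (- A * smax) \<le> A * \<sigma> y * exp (- A * \<sigma> y)"
        using \<sigma>_upper[OF y] pos \<sigma>0 by (intro mult_left_mono) auto
      also have "\<dots> \<le> \<psi> y"
      proof -
        have "(1 + A * \<sigma> y) * exp (- A * \<sigma> y) \<le> exp (A * \<sigma> y) * exp (- A * \<sigma> y)"
          by (intro mult_right_mono exp_ge_add_one_self) auto
        also have "\<dots> = 1" by (simp flip: exp_add)
        finally show ?thesis by (simp add: \<psi>_def algebra_simps)
      qed
      finally have "t * (A * \<sigma> y * exp (- A * smax)) \<le> \<phi> y" unfolding \<phi>_def using t by simp
      moreover have "t * (A * \<sigma> y * exp (- A * smax)) = \<kappa>1 * (m / h) * \<sigma> y"
        using pos h by (simp add: t_def \<kappa>1_def field_simps)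
      ultimately have 1: "\<kappa>1 * (m / h) * \<sigma> y \<le> \<phi> y" by simp
      have "q \<bullet> (y - xh) = (q \<bullet> \<nu>) * ((y - xh) \<bullet> \<nu>) + (q - (q \<bullet> \<nu>) *\<^sub>R \<nu>) \<bullet> (y - xh)"
        by (simp only: inner_diff_left[of q] inner_scaleR_left inner_commute[of "y - xh" \<nu>])
      also have "\<dots> \<ge> - (\<bar>q \<bullet> \<nu>\<bar> * \<bar>(y - xh) \<bullet> \<nu>\<bar>) - norm (q - (q \<bullet> \<nu>) *\<^sub>R \<nu>) * g"
        using Cauchy_Schwarz_ineq2[of "q - (q \<bullet> \<nu>) *\<^sub>R \<nu>" "y - xh"]
          abs_ge_minus_self[of "(q \<bullet> \<nu>) * ((y - xh) \<bullet> \<nu>)"] unfolding g_def abs_mult by linarith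
      finally have 2: "- (\<bar>q \<bullet> \<nu>\<bar> * \<bar>(y - xh) \<bullet> \<nu>\<bar>) - norm (q - (q \<bullet> \<nu>) *\<^sub>R \<nu>) * g \<le> q \<bullet> (y - xh)" .
      have "\<bar>q \<bullet> \<nu>\<bar> * \<bar>(y - xh) \<bullet> \<nu>\<bar> \<le> (c0 * m / h) * (3 * \<sigma> y / (2 * r1))"
        using q \<sigma>_lower(2)[OF y] Q_pos by (intro mult_mono) (auto simp: Q_def)
      also have "\<dots> = c0 * ((m / h) * (3 * \<sigma> y / (2 * r1)))" by simp
      also have "\<dots> \<le> (\<kappa>1 * r1 / 3) * ((m / h) * (3 * \<sigma> y / (2 * r1)))"
        using c0_le(1) m h \<sigma>0 pos by (intro mult_right_mono) auto
      also have "\<dots> = \<kappa>1 * (m / h) * \<sigma> y / 2" using pos by (simp add: field_simps)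
      finally have 3: "\<bar>q \<bullet> \<nu>\<bar> * \<bar>(y - xh) \<bullet> \<nu>\<bar> \<le> \<kappa>1 * (m / h) * \<sigma> y / 2" .
      have "norm (q - (q \<bullet> \<nu>) *\<^sub>R \<nu>) * g \<le> (c0 * m / sqrt h) * g"
        using q g by (intro mult_right_mono) (auto simp: Q_def)
      also have "\<dots> = m * (c0 * g * w)" by (simp add: w_def)
      also have "\<dots> \<le> m * (\<kappa>1 * g\<^sup>2 * w\<^sup>2 / 4 + c0\<^sup>2 / \<kappa>1)"
      proof (rule mult_left_mono)
        have "0 \<le> (\<kappa>1 * g * w / 2 - c0)\<^sup>2 / \<kappa>1" using pos by simp
        also have "\<dots> = \<kappa>1 * g\<^sup>2 * w\<^sup>2 / 4 + c0\<^sup>2 / \<kappa>1 - c0 * g * w"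
          using pos by (simp add: power2_diff power2_eq_square field_simps)
        finally show "c0 * g * w \<le> \<kappa>1 * g\<^sup>2 * w\<^sup>2 / 4 + c0\<^sup>2 / \<kappa>1" by simp
      qed (use m in simp)
      also have "\<dots> \<le> m * (\<kappa>1 * (2 * \<sigma> y) * w\<^sup>2 / 4 + 1 / 4)"
      proof (intro mult_left_mono add_mono divide_right_mono mult_right_mono)
        have "c0\<^sup>2 \<le> (sqrt \<kappa>1 / 2)\<^sup>2" using c0_le(2) c0 by (intro power_mono) auto
        hence "c0\<^sup>2 \<le> \<kappa>1 / 4" using pos by (simp add: power_divide)
        thus "c0\<^sup>2 / \<kappa>1 \<le> 1 / 4" using pos by (simp add: field_simps)
      qed (use g m pos in auto)
      also have "\<dots> = \<kappa>1 * (m / h) * \<sigma> y / 2 + m / 4" using h by (simp add: w(2) field_simps)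
      finally have 4: "norm (q - (q \<bullet> \<nu>) *\<^sub>R \<nu>) * g \<le> \<kappa>1 * (m / h) * \<sigma> y / 2 + m / 4" .
      have "- p - n \<le> r \<Longrightarrow> p \<le> k / 2 \<Longrightarrow> n \<le> k / 2 + m / 4 \<Longrightarrow> k \<le> e \<Longrightarrow> - m / 4 \<le> e + r"
        for p n r k e :: real by linarith
      from this[OF 2 3 4 1] show ?thesis .
    qed
    have \<phi>_x: "\<phi> x + q \<bullet> (x - xh) \<le> 3 * m / 8" if q: "q \<in> Q" for q
    proof -
      have xx: "x - xh = h *\<^sub>R \<nu>" by (simp add: xh_def)
      have "\<sigma> x = h * (h + 2 * r1)" using \<nu> h by (simp add: \<sigma>_xh xx \<nu>\<nu> power2_eq_square algebra_simps)
      also have "\<dots> \<le> h * C0" using h pos by (intro mult_left_mono) (auto simp: C0_def)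
      finally have "A * \<sigma> x \<le> A * (h * C0)" using pos by simp
      moreover have "\<psi> x \<le> A * \<sigma> x" using exp_ge_add_one_self[of "- A * \<sigma> x"] by (simp add: \<psi>_def)
      ultimately have "t * \<psi> x \<le> t * (A * (h * C0))" using t by simp
      also have "\<dots> = m / 4" using pos h by (simp add: t_def)
      finally have 1: "\<phi> x \<le> m / 4" by (simp add: \<phi>_def)
      have "h * (q \<bullet> \<nu>) \<le> h * (c0 * m / h)" using q h by (intro mult_left_mono) (auto simp: Q_def)
      also have "\<dots> = c0 * m" using h by simp
      also have "\<dots> \<le> (1 / 8) * m" using c0_le(3) m by (intro mult_right_mono) auto
      finally show ?thesis using 1 by (simp add: xx)
    qed
    have contact: "\<exists>y\<in>D. 0 \<le> u y \<and> (\<forall>z\<in>D. u z - \<phi> z - q \<bullet> z \<le> u y - \<phi> y - q \<bullet> y)" if q: "q \<in> Q" for q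
    proof -
      have contu: "continuous_on UNIV u" "continuous_on UNIV \<phi>"
        using has_derivative_continuous_on[of UNIV u "\<lambda>y v. Du y \<bullet> v"] u(1)
          has_derivative_continuous_on[of UNIV \<phi> "\<lambda>y v. D\<phi> y \<bullet> v"] \<phi>' by auto
      have "continuous_on (closure D) (\<lambda>y. u y - \<phi> y - q \<bullet> y)"
        by (intro continuous_intros continuous_on_subset[OF contu(1)] continuous_on_subset[OF contu(2)]) auto
      moreover have "compact (closure D)" using bounded_subset[OF bounded_cball D(2)] by simp
      moreover have "closure D \<noteq> {}" using D(3) by auto
      ultimately obtain y where y: "y \<in> closure D" "\<And>z. z \<in> closure D \<Longrightarrow> u z - \<phi> z - q \<bullet> z \<le> u y - \<phi> y - q \<bullet> y"
        using continuous_attains_sup[of "closure D"] by blast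
      have x_cl: "x \<in> closure D" using D(3) closure_subset by blast
      have *: "u x - 3 * m / 8 \<le> u y - (\<phi> y + q \<bullet> (y - xh))"
        using y(2)[OF x_cl] \<phi>_x[OF q] by (simp add: inner_diff_right)
      have above: "S < v" if "u x - 3 * m / 8 \<le> v - p" "- m / 4 \<le> p" for v p
        using that m m_def by linarith
      have "y \<in> D"
      proof (rule ccontr)
        assume "y \<notin> D"
        hence "y \<in> frontier D" using y(1) D(1) by (simp add: frontier_def interior_open)
        hence "u y \<le> S" using S by blast
        thus False using above[OF * \<phi>_lower[OF y(1) q]] by simp
      qed
      moreover have "0 \<le> u y" using above[OF * \<phi>_lower[OF y(1) q]] S(1) by simp
      ultimately show ?thesis using y(2) closure_subset[of D] by blast
    qed
    have "emeasure lborel Q \<le> ennreal (fact CARD('n) / \<delta> ^ CARD('n)) * (\<integral>\<^sup>+y\<in>D. ennreal (f y ^ CARD('n)) \<partial>lebesgue)"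
      by (rule contact_measure_estimate[where a = a and b = b and c = c, OF D(1) _ Q assms(3) _ _ u(3) _ \<phi>' D\<phi>' cont_D2\<phi> sym\<phi> _ _ _ L\<phi> contact f])
        (use u a bc Lu bounded_subset[OF bounded_cball D(2)] in auto)
    hence Q_le: "ennreal (c0 * m / h * (c0 * m / sqrt h / CARD('n)) ^ (CARD('n) - 1)) \<le>
       ennreal (fact CARD('n) / \<delta> ^ CARD('n)) * (\<integral>\<^sup>+y\<in>D. ennreal (f y ^ CARD('n)) \<partial>lebesgue)"
      using Q_large by order
    show "ennreal ((u x - S) ^ CARD('n)) \<le> ennreal (N * h powr ((real CARD('n) + 1) / 2)) *
      (\<integral>\<^sup>+y\<in>D. ennreal (f (y :: real ^ 'n) ^ CARD('n)) \<partial>lebesgue)"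
    proof -
      obtain k where k: "CARD('n) = Suc k" using not0_implies_Suc[of "CARD('n)"] by auto
      define w where "w = sqrt h"
      have w: "w > 0" "h = w * w" using h by (simp_all add: w_def)
      have hp: "h powr ((real CARD('n) + 1) / 2) = h * w ^ k"
      proof -
        have "w ^ k = h powr (real k / 2)"
          using h by (simp add: w_def powr_half_sqrt[symmetric] powr_power)
        moreover have "h = h powr 1" using h by simp
        ultimately have "h * w ^ k = h powr (1 + real k / 2)" using h by (metis powr_add)
        moreover have "(real CARD('n) + 1) / 2 = 1 + real k / 2" by (simp add: k field_simps)
        ultimately show ?thesis by (simp only:)
      qed
      define G where "G = (d / c0) ^ CARD('n) * (h * w ^ k)"
      have G: "G \<ge> 0" using d c0 h w by (simp add: G_def)
      have "G * (c0 * m / h * (c0 * m / w / CARD('n)) ^ (CARD('n) - 1)) = d * m ^ CARD('n)"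
      proof -
        have "(c0 * m / w / d) ^ k = c0 ^ k * m ^ k / (w ^ k * d ^ k)"
          by (simp add: power_divide power_mult_distrib)
        moreover have "(d / c0) ^ CARD('n) = d * d ^ k / (c0 * c0 ^ k)" by (simp add: k power_divide)
        moreover have "w ^ k > 0" "d ^ k > 0" "c0 ^ k > 0" using w d c0 by simp_all
        moreover have "(d * D' / (c0 * C')) * (h * W) * (c0 * m / h * (C' * M / (W * D'))) = d * (m * M)"
          if "W > 0" "D' > 0" "C' > 0" for W D' C' M :: real
          using that h c0 by (simp add: field_simps)
        moreover have "CARD('n) - 1 = k" "m ^ CARD('n) = m * m ^ k" by (simp_all add: k)
        ultimately show ?thesis unfolding G_def d_def[symmetric] by simp
      qed
      moreover have "m ^ CARD('n) \<le> d * m ^ CARD('n)" using d m mult_right_mono[of 1 d "m ^ CARD('n)"] by simp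
      ultimately have "m ^ CARD('n) \<le> G * (c0 * m / h * (c0 * m / sqrt h / CARD('n)) ^ (CARD('n) - 1))"
        by (simp add: w_def)
      hence "ennreal (m ^ CARD('n)) \<le> ennreal G * ennreal (c0 * m / h * (c0 * m / sqrt h / CARD('n)) ^ (CARD('n) - 1))"
        using G by (simp add: ennreal_leI flip: ennreal_mult')
      also have "\<dots> \<le> ennreal G * (ennreal (fact CARD('n) / \<delta> ^ CARD('n)) * (\<integral>\<^sup>+y\<in>D. ennreal (f y ^ CARD('n)) \<partial>lebesgue))"
        by (intro mult_left_mono Q_le) auto
      also have "\<dots> = ennreal (G * (fact CARD('n) / \<delta> ^ CARD('n))) * (\<integral>\<^sup>+y\<in>D. ennreal (f y ^ CARD('n)) \<partial>lebesgue)"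
        by (simp only: ennreal_mult'[OF G] mult.assoc)
      also have "G * (fact CARD('n) / \<delta> ^ CARD('n)) = N * h powr ((real CARD('n) + 1) / 2)"
        by (simp add: G_def N_def hp)
      finally show ?thesis by (simp add: m_def)
    qed
  qed
qed

section \<open>Smooth kernels and weak derivatives\<close>

text \<open>
  The family is closed under differentiation up to linear combinations, which makes all its members
  smooth at once.
\<close>

definition flat :: "nat \<Rightarrow> real \<Rightarrow> real" where
  "flat m t = (if t > 0 then exp (- 1 / t) / t ^ m else 0)"

lemma flat_nonneg: "flat m t \<ge> 0"
  by (simp add: flat_def)

lemma flat_div_tendsto_0: "((\<lambda>t. flat m t / t) \<longlongrightarrow> 0) (at 0)"
proof (subst filterlim_at_split, intro conjI)
  have "\<forall>\<^sub>F t in at_left 0. flat m t / t = 0"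
    by (auto simp: eventually_at_filter flat_def)
  thus "((\<lambda>t. flat m t / t) \<longlongrightarrow> 0) (at_left 0)"
    by (rule tendsto_eventually)
  have "((\<lambda>t. inverse t ^ Suc m / exp (inverse t)) \<longlongrightarrow> (0::real)) (at_right 0)"
    by (rule filterlim_compose[OF tendsto_power_div_exp_0 filterlim_inverse_at_top_right])
  moreover have "\<forall>\<^sub>F t in at_right 0. inverse t ^ Suc m / exp (inverse t) = flat m t / t"
    by (auto simp: eventually_at_filter flat_def exp_minus field_simps power_inverse)
  ultimately show "((\<lambda>t. flat m t / t) \<longlongrightarrow> 0) (at_right 0)"
    by (rule Lim_transform_eventually)
qed

lemma flat_deriv: "(flat m has_real_derivative (flat (m + 2) t - real m * flat (m + 1) t)) (at t)"
proof -
  consider "t > 0" | "t < 0" | "t = 0" by linarith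
  thus ?thesis
  proof cases
    case 1
    have "((\<lambda>t. exp (- 1 / t) / t ^ m) has_real_derivative (flat (m + 2) t - real m * flat (m + 1) t)) (at t)"
    proof (cases m)
      case 0
      thus ?thesis using 1
        by (auto intro!: derivative_eq_intros simp: flat_def field_simps power2_eq_square)
    next
      case (Suc k)
      have "t ^ k \<noteq> 0" using 1 by simp
      thus ?thesis using 1 Suc
        by (auto intro!: derivative_eq_intros simp: flat_def divide_simps power2_eq_square)
          (cases k; simp add: algebra_simps)
    qed
    thus ?thesis
      by (rule has_field_derivative_transform_within_open[of _ _ _ "{0<..}"])
        (use 1 in \<open>auto simp: flat_def\<close>)
  next
    case 2
    have "((\<lambda>t. 0) has_real_derivative 0) (at t)" by simp
    hence "(flat m has_real_derivative 0) (at t)"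
      by (rule has_field_derivative_transform_within_open[of _ _ _ "{..<0}"])
        (use 2 in \<open>auto simp: flat_def\<close>)
    thus ?thesis using 2 by (simp add: flat_def)
  next
    case 3
    thus ?thesis using flat_div_tendsto_0[of m] by (simp add: has_field_derivative_iff flat_def)
  qed
qed

lemma continuous_on_flat [continuous_intros]:
  "continuous_on S f \<Longrightarrow> continuous_on S (\<lambda>x. flat m (f x))"
  by (rule continuous_on_compose2[of UNIV "flat m"])
    (auto intro!: DERIV_continuous_on flat_deriv)

text \<open>
  An algebra of functions that contains a smooth bump around \<open>z\<close> and is closed under partial
  derivatives, so that membership implies smoothness of all orders.
\<close>

inductive bump_fun :: "real ^ 'n \<Rightarrow> real \<Rightarrow> (real ^ 'n \<Rightarrow> real) \<Rightarrow> bool" for z r where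
  const: "bump_fun z r (\<lambda>y. c)"
| coord: "bump_fun z r (\<lambda>y. y $ k)"
| bump: "bump_fun z r (\<lambda>y. flat m (r - (y - z) \<bullet> (y - z)))"
| add: "bump_fun z r f \<Longrightarrow> bump_fun z r g \<Longrightarrow> bump_fun z r (\<lambda>y. f y + g y)"
| mult: "bump_fun z r f \<Longrightarrow> bump_fun z r g \<Longrightarrow> bump_fun z r (\<lambda>y. f y * g y)"

lemma bump_fun_derivative:
  fixes f :: "real ^ 'n \<Rightarrow> real"
  assumes "bump_fun z r f"
  shows "\<exists>g. (\<forall>y. (f has_derivative (\<lambda>v. \<Sum>i\<in>UNIV. g i y * v $ i)) (at y)) \<and> (\<forall>i. bump_fun z r (g i))"
  using assms
proof induction
  case (const c)
  thus ?case by (intro exI[of _ "\<lambda>i y. 0"]) (auto intro: bump_fun.const)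
next
  case (coord k)
  have "((\<lambda>y. y $ k) has_derivative (\<lambda>v. \<Sum>i\<in>UNIV. (if i = k then 1 else 0) * v $ i)) (at y)" for y :: "real^'n"
  proof -
    have "(\<Sum>i\<in>UNIV. (if i = k then 1 else 0) * v $ i) = (\<Sum>i\<in>UNIV. if i = k then v $ i else 0)" for v :: "real ^ 'n"
      by (intro sum.cong) auto
    thus ?thesis using bounded_linear_imp_has_derivative[OF bounded_linear_vec_nth[of k]] by simp
  qed
  thus ?case by (intro exI[of _ "\<lambda>i y. if i = k then 1 else 0"]) (auto intro: bump_fun.const)
next
  case (bump m)
  define d where "d t = flat (m + 2) t - real m * flat (m + 1) t" for t
  let ?s = "\<lambda>y. r - (y - z) \<bullet> (y - z)"
  let ?g = "\<lambda>i y. (flat (m + 2) (?s y) + (- real m) * flat (m + 1) (?s y)) * ((-2) * (y $ i + (- z $ i)))"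
  have "((\<lambda>y. flat m (?s y)) has_derivative (\<lambda>v. \<Sum>i\<in>UNIV. ?g i y * v $ i)) (at y)" for y
  proof -
    have "(?s has_derivative (\<lambda>v. - 2 * ((y - z) \<bullet> v))) (at y)"
      by (auto intro!: derivative_eq_intros simp: inner_commute algebra_simps)
    moreover have "(flat m has_derivative (*) (d (?s y))) (at (?s y))"
      using flat_deriv[of m "?s y"] by (simp add: has_field_derivative_def d_def)
    ultimately have "((\<lambda>y. flat m (?s y)) has_derivative (\<lambda>v. d (?s y) * (- 2 * ((y - z) \<bullet> v)))) (at y)"
      by (rule has_derivative_compose)
    also have "(\<lambda>v. d (?s y) * (- 2 * ((y - z) \<bullet> v))) = (\<lambda>v. \<Sum>i\<in>UNIV. ?g i y * v $ i)"
    proof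
      fix v
      have "e * (- 2 * (p \<bullet> v)) = (\<Sum>i\<in>UNIV. e * (- 2 * p $ i) * v $ i)" for e and p :: "real ^ 'n"
        by (simp add: inner_vec_def sum_distrib_left mult_ac)
      from this[of "d (?s y)" "y - z"]
      show "d (?s y) * (- 2 * ((y - z) \<bullet> v)) = (\<Sum>i\<in>UNIV. ?g i y * v $ i)"
        by (simp add: d_def)
    qed
    finally show ?thesis .
  qed
  moreover have "bump_fun z r (?g i)" for i by (intro bump_fun.intros)
  ultimately show ?case by (intro exI[of _ ?g] conjI allI)
next
  case (add f g)
  then obtain f' g' where
    "\<And>y. (f has_derivative (\<lambda>v. \<Sum>i\<in>UNIV. f' i y * v $ i)) (at y)" "\<And>i. bump_fun z r (f' i)"
    "\<And>y. (g has_derivative (\<lambda>v. \<Sum>i\<in>UNIV. g' i y * v $ i)) (at y)" "\<And>i. bump_fun z r (g' i)"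
    by blast
  thus ?case
    by (intro exI[of _ "\<lambda>i y. f' i y + g' i y"] conjI allI bump_fun.add)
      (auto intro!: derivative_eq_intros simp: sum.distrib distrib_right)
next
  case (mult f g)
  then obtain f' g' where
    "\<And>y. (f has_derivative (\<lambda>v. \<Sum>i\<in>UNIV. f' i y * v $ i)) (at y)" "\<And>i. bump_fun z r (f' i)"
    "\<And>y. (g has_derivative (\<lambda>v. \<Sum>i\<in>UNIV. g' i y * v $ i)) (at y)" "\<And>i. bump_fun z r (g' i)"
    by blast
  thus ?case using mult.hyps
    by (intro exI[of _ "\<lambda>i y. f y * g' i y + f' i y * g y"] conjI allI bump_fun.add bump_fun.mult)
      (auto intro!: derivative_eq_intros simp: sum.distrib distrib_left distrib_right sum_distrib_left sum_distrib_right mult_ac)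
qed

lemma classical_partial_eq:
  assumes "(f has_derivative (\<lambda>v. \<Sum>i\<in>UNIV. g i * v $ i)) (at y)"
  shows "classical_partial k f y = g k"
proof -
  have "frechet_derivative f (at y) = (\<lambda>v. \<Sum>i\<in>UNIV. g i * v $ i)"
    using frechet_derivative_at[OF assms] by simp
  thus ?thesis by (simp add: classical_partial_def axis_def if_distrib cong: if_cong)
qed

lemma bump_fun_Ck: "bump_fun z r f \<Longrightarrow> Ck k f"
proof (induction k arbitrary: f)
  case 0
  then obtain g where "\<And>y. (f has_derivative (\<lambda>v. \<Sum>i\<in>UNIV. g i y * v $ i)) (at y)"
    using bump_fun_derivative by blast
  from has_derivative_continuous_on[OF has_derivative_at_withinI[OF this]] show ?case by simp
next
  case (Suc k)
  then obtain g where g: "\<And>y. (f has_derivative (\<lambda>v. \<Sum>i\<in>UNIV. g i y * v $ i)) (at y)" "\<And>i. bump_fun z r (g i)"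
    using bump_fun_derivative by blast
  have "classical_partial i f = g i" for i
    using classical_partial_eq[OF g(1)] by (simp add: fun_eq_iff)
  thus ?case using g Suc.IH by (auto simp: differentiable_on_def differentiable_def intro: has_derivative_at_withinI)
qed

lemma bump_fun_test_function:
  assumes "bump_fun z r f" "\<And>y. r \<le> (y - z) \<bullet> (y - z) \<Longrightarrow> f y = 0" "\<epsilon> > 0" "r = \<epsilon>\<^sup>2" "cball z \<epsilon> \<subseteq> \<Omega>"
  shows "f \<in> test_functions \<Omega>"
proof -
  have "{x. f x \<noteq> 0} \<subseteq> cball z \<epsilon>"
  proof
    fix y assume "y \<in> {x. f x \<noteq> 0}"
    hence "(norm (y - z))\<^sup>2 < \<epsilon>\<^sup>2" using assms(2,4) by (force simp: power2_norm_eq_inner)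
    hence "norm (y - z) < \<epsilon>" using assms(3) power2_less_imp_less less_imp_le by blast
    thus "y \<in> cball z \<epsilon>" by (simp add: dist_norm norm_minus_commute)
  qed
  hence cl: "closure {x. f x \<noteq> 0} \<subseteq> cball z \<epsilon>" by (rule closure_minimal) simp
  hence "compact (closure {x. f x \<noteq> 0})"
    using bounded_subset[OF bounded_cball] by (simp add: compact_eq_bounded_closed)
  thus ?thesis using cl assms(5) bump_fun_Ck[OF assms(1)] by (auto simp: test_functions_def)
qed

text \<open>
  For \<open>r = \<epsilon>\<^sup>2\<close> a smooth bump supported in the ball of radius \<open>\<epsilon>\<close>; \<open>ker1\<close> and \<open>ker2\<close> below are its
  first and second partial derivatives, written out.
\<close>

definition ker :: "real \<Rightarrow> real ^ 'n \<Rightarrow> real" where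
  "ker r w = flat 0 (r - w \<bullet> w)"

definition ker1 :: "real \<Rightarrow> 'n \<Rightarrow> real ^ 'n \<Rightarrow> real" where
  "ker1 r i w = (-2) * w $ i * flat 2 (r - w \<bullet> w)"

definition ker2 :: "real \<Rightarrow> 'n \<Rightarrow> 'n \<Rightarrow> real ^ 'n \<Rightarrow> real" where
  "ker2 r i j w = (if i = j then -2 else 0) * flat 2 (r - w \<bullet> w)
      + 4 * w $ i * w $ j * (flat 4 (r - w \<bullet> w) - 2 * flat 3 (r - w \<bullet> w))"

lemma ker2_sym: "ker2 r i j w = ker2 r j i w"
  by (auto simp: ker2_def)

lemma flat_norm_derivative:
  fixes w :: "real ^ 'n"
  shows "((\<lambda>w. flat m (r - w \<bullet> w)) has_derivative
    (\<lambda>v. (flat (m + 2) (r - w \<bullet> w) - real m * flat (m + 1) (r - w \<bullet> w)) * (- 2 * (w \<bullet> v)))) (at w)"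
proof -
  have "((\<lambda>w. r - w \<bullet> w) has_derivative (\<lambda>v. - 2 * (w \<bullet> v))) (at w)"
    by (auto intro!: derivative_eq_intros simp: inner_commute)
  from has_derivative_compose[OF this flat_deriv[of m, unfolded has_field_derivative_def]]
  show ?thesis .
qed

lemma ker_derivative: "(ker r has_derivative (\<lambda>v. (\<chi> i. ker1 r i w) \<bullet> v)) (at w)"
proof -
  define F where "F = flat 2 (r - w \<bullet> w)"
  have "(\<chi> i. ker1 r i w) \<bullet> v = F * (- 2 * (w \<bullet> v))" for v
  proof -
    have "(\<chi> i. ker1 r i w) \<bullet> v = (\<Sum>i\<in>UNIV. F * (- 2 * (w $ i * v $ i)))"
      unfolding inner_vec_def[of "vec_lambda _"] ker1_def F_def[symmetric] vec_lambda_beta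
      by (intro sum.cong refl) simp
    thus ?thesis by (simp add: inner_vec_def sum_distrib_left)
  qed
  hence "(\<lambda>v. (flat (0 + 2) (r - w \<bullet> w) - real 0 * flat (0 + 1) (r - w \<bullet> w)) * (- 2 * (w \<bullet> v))) =
    (\<lambda>v. (\<chi> i. ker1 r i w) \<bullet> v)"
    unfolding F_def by (simp add: fun_eq_iff numeral_2_eq_2)
  thus ?thesis using flat_norm_derivative[of 0 r w] by (simp add: ker_def[abs_def])
qed

lemma ker1_derivative: "(ker1 r i has_derivative (\<lambda>v. (\<chi> j. ker2 r i j w) \<bullet> v)) (at w)"
proof -
  have "(ker1 r i has_derivative (\<lambda>v. (-2) * w $ i * ((flat 4 (r - w \<bullet> w) - 2 * flat 3 (r - w \<bullet> w)) * (- 2 * (w \<bullet> v)))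
       + (-2) * v $ i * flat 2 (r - w \<bullet> w))) (at w)"
    unfolding ker1_def using flat_norm_derivative[of 2 r w]
    by (auto intro!: derivative_eq_intros bounded_linear_imp_has_derivative[OF bounded_linear_vec_nth])
  moreover have "(\<chi> j. ker2 r i j w) \<bullet> v = (-2) * w $ i * ((flat 4 (r - w \<bullet> w) - 2 * flat 3 (r - w \<bullet> w)) * (- 2 * (w \<bullet> v)))
       + (-2) * v $ i * flat 2 (r - w \<bullet> w)" for v
  proof -
    define p q where "p = flat 4 (r - w \<bullet> w) - 2 * flat 3 (r - w \<bullet> w)" and "q = flat 2 (r - w \<bullet> w)"
    have "(\<chi> j. ker2 r i j w) \<bullet> v = (\<Sum>j\<in>UNIV. (if i = j then - 2 * q * v $ j else 0) + 4 * w $ i * p * (w $ j * v $ j))"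
      unfolding inner_vec_def[of "vec_lambda _"] ker2_def p_def[symmetric] q_def[symmetric]
      by (intro sum.cong refl) (auto simp: algebra_simps)
    also have "\<dots> = - 2 * q * v $ i + 4 * w $ i * p * (w \<bullet> v)"
      by (simp add: sum.distrib sum_distrib_left[symmetric] inner_vec_def)
    finally show ?thesis by (simp add: p_def q_def)
  qed
  ultimately show ?thesis by presburger
qed

lemma continuous_ker: "continuous_on UNIV (ker r)" "continuous_on UNIV (ker1 r i)" "continuous_on UNIV (ker2 r i j)"
  unfolding ker_def ker1_def ker2_def by (intro continuous_intros)+

lemma ker_nonneg: "ker r w \<ge> 0" by (simp add: ker_def flat_nonneg)

lemma ker_eq_0: "ker (\<epsilon>\<^sup>2) w = 0" "ker1 (\<epsilon>\<^sup>2) i w = 0" "ker2 (\<epsilon>\<^sup>2) i j w = 0" if "\<epsilon> \<le> norm w" "\<epsilon> > 0"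
proof -
  have "\<epsilon>\<^sup>2 \<le> w \<bullet> w" using power_mono[OF that(1), of 2] that(2) by (simp add: power2_norm_eq_inner)
  thus "ker (\<epsilon>\<^sup>2) w = 0" "ker1 (\<epsilon>\<^sup>2) i w = 0" "ker2 (\<epsilon>\<^sup>2) i j w = 0"
    by (auto simp: ker_def ker1_def ker2_def flat_def)
qed

lemma ker_pos: "ker (\<epsilon>\<^sup>2) w > 0" if "norm w < \<epsilon>"
proof -
  have "w \<bullet> w < \<epsilon>\<^sup>2" using power_strict_mono[OF that, of 2] by (simp add: power2_norm_eq_inner)
  thus ?thesis by (simp add: ker_def flat_def)
qed

lemma ker_test_functions:
  fixes x :: "real ^ 'n"
  assumes "\<epsilon> > 0" "cball x \<epsilon> \<subseteq> \<Omega>"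
  shows "(\<lambda>y. ker (\<epsilon>\<^sup>2) (x - y)) \<in> test_functions \<Omega>" "(\<lambda>y. ker1 (\<epsilon>\<^sup>2) i (x - y)) \<in> test_functions \<Omega>"
proof -
  have sq: "(x - y) \<bullet> (x - y) = (y - x) \<bullet> (y - x)" for y by (simp add: inner_diff inner_commute algebra_simps)
  show "(\<lambda>y. ker (\<epsilon>\<^sup>2) (x - y)) \<in> test_functions \<Omega>"
  proof (rule bump_fun_test_function[OF _ _ assms(1) refl assms(2)])
    show "bump_fun x (\<epsilon>\<^sup>2) (\<lambda>y. ker (\<epsilon>\<^sup>2) (x - y))"
      unfolding ker_def sq by (rule bump_fun.bump)
  qed (simp add: ker_def sq flat_def)
  have "bump_fun x (\<epsilon>\<^sup>2) (\<lambda>y. (-2) * (x $ i + (-1) * y $ i) * flat 2 (\<epsilon>\<^sup>2 - (y - x) \<bullet> (y - x)))"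
    by (intro bump_fun.intros)
  thus "(\<lambda>y. ker1 (\<epsilon>\<^sup>2) i (x - y)) \<in> test_functions \<Omega>"
    by (intro bump_fun_test_function[OF _ _ assms(1) refl assms(2)])
      (auto simp: ker1_def sq flat_def)
qed

lemma classical_partial_reflect:
  assumes "\<And>w. (k has_derivative (\<lambda>v. (\<chi> i. k' i w) \<bullet> v)) (at w)"
  shows "classical_partial i (\<lambda>y. k (x - y)) y = - k' i (x - y)"
proof (rule classical_partial_eq)
  have "((\<lambda>y. x - y) has_derivative (\<lambda>v. - v)) (at y)" by (auto intro!: derivative_eq_intros)
  from has_derivative_compose[OF this assms]
  show "((\<lambda>y. k (x - y)) has_derivative (\<lambda>v. \<Sum>i\<in>UNIV. - k' i (x - y) * v $ i)) (at y)"
    by (simp add: inner_vec_def[of "vec_lambda _"] sum_negf)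
qed

text \<open>
  As functions of \<open>y\<close>, the kernel and its first derivatives, centred at \<open>x\<close>, are test functions. The
  sign in the definition of weak derivatives cancels the one from differentiating in \<open>x - y\<close>.
\<close>

lemma ker_weak_partial:
  assumes "has_weak_partial \<Omega> j u g" "\<epsilon> > 0" "cball x \<epsilon> \<subseteq> \<Omega>"
  shows "(LINT y:\<Omega>|lebesgue. ker1 (\<epsilon>\<^sup>2) j (x - y) * u y) = (LINT y:\<Omega>|lebesgue. ker (\<epsilon>\<^sup>2) (x - y) * g y)"
    and "(LINT y:\<Omega>|lebesgue. ker2 (\<epsilon>\<^sup>2) i j (x - y) * u y) = (LINT y:\<Omega>|lebesgue. ker1 (\<epsilon>\<^sup>2) i (x - y) * g y)"
proof -
  have weak: "(LINT y:\<Omega>|lebesgue. u y * classical_partial j \<phi> y) = - (LINT y:\<Omega>|lebesgue. g y * \<phi> y)"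
    if "\<phi> \<in> test_functions \<Omega>" for \<phi> using assms(1) that by (simp add: has_weak_partial_def)
  show "(LINT y:\<Omega>|lebesgue. ker1 (\<epsilon>\<^sup>2) j (x - y) * u y) = (LINT y:\<Omega>|lebesgue. ker (\<epsilon>\<^sup>2) (x - y) * g y)"
    using weak[OF ker_test_functions(1)[OF assms(2,3)]]
    by (simp add: classical_partial_reflect[OF ker_derivative] mult.commute set_lebesgue_integral_def)
  show "(LINT y:\<Omega>|lebesgue. ker2 (\<epsilon>\<^sup>2) i j (x - y) * u y) = (LINT y:\<Omega>|lebesgue. ker1 (\<epsilon>\<^sup>2) i (x - y) * g y)"
    using weak[OF ker_test_functions(2)[OF assms(2,3)]]
    by (simp add: classical_partial_reflect[OF ker1_derivative] mult.commute set_lebesgue_integral_def)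
qed

text \<open>
  Differentiation under the integral sign, for an integrand that is jointly continuous because \<open>w\<close>
  is.
\<close>

lemma convolution_derivative:
  fixes w :: "real ^ 'n \<Rightarrow> real"
  assumes k: "\<And>z. (k has_derivative (\<lambda>v. kg z \<bullet> v)) (at z)" and kg: "continuous_on UNIV kg"
    and w: "continuous_on UNIV w"
  shows "((\<lambda>x. integral (cbox a b) (\<lambda>y. k (x - y) * w y)) has_derivative
      (\<lambda>v. integral (cbox a b) (\<lambda>y. w y *\<^sub>R kg (x - y)) \<bullet> v)) (at x)"
proof -
  have contk: "continuous_on UNIV k"
    by (rule has_derivative_continuous_on[OF has_derivative_at_withinI[OF k]])
  have int: "(\<lambda>y. w y *\<^sub>R kg (x - y)) integrable_on cbox a b" for x
    by (intro integrable_continuous continuous_intros continuous_on_compose2[OF kg] continuous_on_subset[OF w]) auto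
  have "((\<lambda>x. integral (cbox a b) (\<lambda>y. k (x - y) * w y)) has_derivative
      blinfun_apply (integral (cbox a b) (\<lambda>y. blinfun_inner_right (w y *\<^sub>R kg (x - y))))) (at x within UNIV)"
  proof (rule leibniz_rule)
    fix x t :: "real ^ 'n"
    have "((\<lambda>x. x - t) has_derivative (\<lambda>v. v)) (at x)" by (auto intro!: derivative_eq_intros)
    from has_derivative_compose[OF this k]
    have "((\<lambda>x. k (x - t) * w t) has_derivative (\<lambda>v. (kg (x - t) \<bullet> v) * w t)) (at x)"
      by (auto intro!: derivative_eq_intros)
    moreover have "(\<lambda>v. (kg (x - t) \<bullet> v) * w t) = (\<bullet>) (w t *\<^sub>R kg (x - t))"
      by (auto simp: fun_eq_iff)
    ultimately show "((\<lambda>x. k (x - t) * w t) has_derivative blinfun_apply (blinfun_inner_right (w t *\<^sub>R kg (x - t)))) (at x within UNIV)"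
      by simp
  next
    fix x show "(\<lambda>y. k (x - y) * w y) integrable_on cbox a b"
      by (intro integrable_continuous continuous_intros continuous_on_compose2[OF contk] continuous_on_subset[OF w]) auto
  next
    have "continuous_on (UNIV \<times> cbox a b) (\<lambda>p. blinfun_inner_right (w (snd p) *\<^sub>R kg (fst p - snd p)))"
      by (intro bounded_linear.continuous_on[OF bounded_linear_blinfun_inner_right] continuous_intros
          continuous_on_compose2[OF kg] continuous_on_compose2[OF w]) auto
    thus "continuous_on (UNIV \<times> cbox a b) (\<lambda>(x, t). blinfun_inner_right (w t *\<^sub>R kg (x - t)))"
      by (simp add: case_prod_beta)
  qed auto
  moreover have "integral (cbox a b) (\<lambda>y. blinfun_inner_right (w y *\<^sub>R kg (x - y))) =
      blinfun_inner_right (integral (cbox a b) (\<lambda>y. w y *\<^sub>R kg (x - y)))"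
    using integral_linear[OF int bounded_linear_blinfun_inner_right] by (simp add: o_def)
  ultimately show ?thesis by simp
qed

lemma continuous_on_convolution:
  fixes w :: "real ^ 'n \<Rightarrow> real"
  assumes k: "continuous_on UNIV k" and w: "continuous_on UNIV w"
  shows "continuous_on UNIV (\<lambda>x. integral (cbox a b) (\<lambda>y. k (x - y) * w y))"
proof -
  have "continuous_on (UNIV \<times> cbox a b) (\<lambda>p. k (fst p - snd p) * w (snd p))"
    by (intro continuous_intros continuous_on_compose2[OF k] continuous_on_compose2[OF w]) auto
  thus ?thesis
    by (intro integral_continuous_on_param) (simp add: case_prod_beta)
qed

section \<open>Convergence of mollifications\<close>

lemma nn_integral_lborel_reflect:
  fixes f :: "'a::euclidean_space \<Rightarrow> ennreal"
  assumes [measurable]: "f \<in> borel_measurable borel"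
  shows "(\<integral>\<^sup>+y. f (x - y) \<partial>lborel) = (\<integral>\<^sup>+y. f y \<partial>lborel)"
proof -
  have "(lborel :: 'a measure) = distr lborel borel (\<lambda>y. x - y)"
    using lborel_affine[of "-1" x] by (simp add: density_1)
  hence "(\<integral>\<^sup>+y. f y \<partial>lborel) = (\<integral>\<^sup>+y. f y \<partial>distr lborel borel (\<lambda>y. x - y))"
    by simp
  also have "\<dots> = (\<integral>\<^sup>+y. f (x - y) \<partial>lborel)"
    by (subst nn_integral_distr) auto
  finally show ?thesis ..
qed

lemma nn_integral_lborel_translate:
  fixes f :: "'a::euclidean_space \<Rightarrow> ennreal"
  assumes [measurable]: "f \<in> borel_measurable borel"
  shows "(\<integral>\<^sup>+x. f (x - y) \<partial>lborel) = (\<integral>\<^sup>+x. f x \<partial>lborel)"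
proof -
  have "(\<integral>\<^sup>+x. f x \<partial>lborel) = (\<integral>\<^sup>+x. f x \<partial>distr lborel borel ((+) (- y)))"
    by (simp add: lborel_distr_plus)
  also have "\<dots> = (\<integral>\<^sup>+x. f (x - y) \<partial>lborel)"
    by (simp add: nn_integral_distr)
  finally show ?thesis ..
qed

lemma measurable_ker [measurable]: "ker r \<in> borel_measurable borel"
  by (rule borel_measurable_continuous_onI[OF continuous_ker(1)])

definition ker_mass :: "'n::finite itself \<Rightarrow> real \<Rightarrow> real" where
  "ker_mass _ \<epsilon> = (LINT w|lborel. ker (\<epsilon>\<^sup>2) (w :: real ^ 'n))"

lemma integrable_ker:
  assumes "\<epsilon> > 0"
  shows "integrable lborel (ker (\<epsilon>\<^sup>2) :: real ^ 'n \<Rightarrow> real)"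
proof -
  have "integrable lborel (\<lambda>w :: real ^ 'n. indicator (cball 0 \<epsilon>) w *\<^sub>R ker (\<epsilon>\<^sup>2) w)"
    by (rule borel_integrable_compact) (auto intro: continuous_on_subset[OF continuous_ker(1)])
  moreover have "indicator (cball 0 \<epsilon>) w *\<^sub>R ker (\<epsilon>\<^sup>2) w = ker (\<epsilon>\<^sup>2) w" for w :: "real ^ 'n"
    using ker_eq_0(1)[of \<epsilon> w] assms by (auto split: split_indicator)
  ultimately show ?thesis by (simp only:)
qed

lemma ker_mass_pos:
  assumes "\<epsilon> > 0"
  shows "ker_mass TYPE('n::finite) \<epsilon> > 0"
proof -
  have "ker_mass TYPE('n) \<epsilon> \<noteq> 0"
  proof
    assume "ker_mass TYPE('n) \<epsilon> = 0"
    hence "AE w in lborel. ker (\<epsilon>\<^sup>2) (w :: real ^ 'n) = 0"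
      unfolding ker_mass_def
      using integral_nonneg_eq_0_iff_AE[OF integrable_ker[OF assms, where 'n='n]] by (simp add: ker_nonneg)
    hence "AE w in lborel. (w :: real ^ 'n) \<notin> ball 0 \<epsilon>"
      by eventually_elim (use ker_pos in \<open>force simp: dist_norm\<close>)
    hence "emeasure lborel (ball (0 :: real ^ 'n) \<epsilon>) = 0"
      by (subst (asm) AE_iff_measurable[where N = "ball 0 \<epsilon>"]) auto
    thus False using content_ball_pos[OF assms, of "0 :: real ^ 'n"] by (simp add: measure_def)
  qed
  moreover have "ker_mass TYPE('n) \<epsilon> \<ge> 0"
    unfolding ker_mass_def by (intro Bochner_Integration.integral_nonneg ker_nonneg)
  ultimately show ?thesis by simp
qed

definition mollifier :: "real \<Rightarrow> real ^ 'n::finite \<Rightarrow> real" where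
  "mollifier \<epsilon> w = ker (\<epsilon>\<^sup>2) w / ker_mass TYPE('n) \<epsilon>"

lemma measurable_mollifier [measurable]: "mollifier \<epsilon> \<in> borel_measurable borel"
  unfolding mollifier_def[abs_def] by measurable

lemma mollifier_nonneg: "\<epsilon> > 0 \<Longrightarrow> mollifier \<epsilon> w \<ge> 0"
  unfolding mollifier_def by (intro divide_nonneg_pos ker_nonneg ker_mass_pos)

lemma mollifier_eq_0: "\<epsilon> > 0 \<Longrightarrow> \<epsilon> \<le> norm w \<Longrightarrow> mollifier \<epsilon> w = 0"
  by (simp add: mollifier_def ker_eq_0)

lemma nn_integral_mollifier:
  assumes "\<epsilon> > 0"
  shows "(\<integral>\<^sup>+w. ennreal (mollifier \<epsilon> (w :: real ^ 'n)) \<partial>lborel) = 1"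
proof -
  have "(LINT w|lborel. mollifier \<epsilon> (w :: real ^ 'n)) = 1"
    unfolding mollifier_def using ker_mass_pos[OF assms, where 'n='n]
    by (simp add: ker_mass_def)
  moreover have "integrable lborel (mollifier \<epsilon> :: real ^ 'n \<Rightarrow> real)"
    unfolding mollifier_def[abs_def] using integrable_ker[OF assms, where 'n='n] by (intro integrable_divide)
  ultimately show ?thesis
    by (subst nn_integral_eq_integral) (auto simp: mollifier_nonneg assms)
qed

text \<open>
  Lebesgue measure is invariant under reflections and translations.
\<close>

lemma nn_integral_mollifier_reflect:
  assumes "\<epsilon> > 0"
  shows "(\<integral>\<^sup>+y. ennreal (mollifier \<epsilon> (x - y :: real ^ 'n)) \<partial>lborel) = 1"
    and "(\<integral>\<^sup>+x. ennreal (mollifier \<epsilon> (x - y :: real ^ 'n)) \<partial>lborel) = 1"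
  using nn_integral_lborel_reflect[of "\<lambda>w. ennreal (mollifier \<epsilon> w)" x]
    nn_integral_lborel_translate[of "\<lambda>w. ennreal (mollifier \<epsilon> w)" y] nn_integral_mollifier[OF assms, where 'n='n]
  by simp_all

abbreviation mollify :: "real \<Rightarrow> (real ^ 'n::finite \<Rightarrow> real) \<Rightarrow> real ^ 'n \<Rightarrow> real" where
  "mollify \<epsilon> g x \<equiv> LINT y|lborel. mollifier \<epsilon> (x - y) * g y"

abbreviation mollify_on :: "(real ^ 'n::finite) set \<Rightarrow> real \<Rightarrow> (real ^ 'n \<Rightarrow> real) \<Rightarrow> real ^ 'n \<Rightarrow> real" where
  "mollify_on \<Omega> \<epsilon> g x \<equiv> (LINT y:\<Omega>|lebesgue. ker (\<epsilon>\<^sup>2) (x - y) * g y) / ker_mass TYPE('n) \<epsilon>"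

text \<open>
  Convexity of powers, in the form that gives Jensen's inequality when it is integrated against a
  probability density with \<open>s\<close> the mean.
\<close>

lemma power_above_tangent:
  fixes s t :: real
  assumes "s \<ge> 0" "t \<ge> 0"
  shows "t ^ Suc k \<ge> s ^ Suc k + real (Suc k) * s ^ k * (t - s)"
proof (induction k)
  case (Suc k)
  have "t * (s ^ Suc k + real (Suc k) * s ^ k * (t - s)) \<le> t * t ^ Suc k"
    using Suc assms by (intro mult_left_mono)
  moreover have "t * (s ^ Suc k + real (Suc k) * s ^ k * (t - s)) =
    s ^ Suc (Suc k) + real (Suc (Suc k)) * s ^ Suc k * (t - s) + real (Suc k) * s ^ k * (t - s)\<^sup>2"
    by (simp add: algebra_simps power2_eq_square)
  moreover have "real (Suc k) * s ^ k * (t - s)\<^sup>2 \<ge> 0" using assms by simp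
  ultimately show ?case by simp
qed simp

lemma power_sum3_le:
  fixes a b c :: real
  assumes "a \<ge> 0" "b \<ge> 0" "c \<ge> 0"
  shows "(a + b + c) ^ p \<le> 3 ^ p * (a ^ p + b ^ p + c ^ p)"
proof -
  define m where "m = max a (max b c)"
  have "(a + b + c) ^ p \<le> (3 * m) ^ p" using assms by (intro power_mono) (auto simp: m_def)
  also have "\<dots> = 3 ^ p * m ^ p" by (simp add: power_mult_distrib)
  also have "m ^ p \<le> a ^ p + b ^ p + c ^ p"
    using assms zero_le_power[of a p] zero_le_power[of b p] zero_le_power[of c p]
    unfolding m_def max_def by (auto simp del: zero_le_power)
  finally show ?thesis by simp
qed

text \<open>
  Jensen's inequality for the probability density \<open>mollifier \<epsilon> (x - y)\<close>. If the right-hand side is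
  finite, so is the mean of \<open>\<bar>g y - s\<bar>\<close>, since \<open>\<bar>t\<bar> \<le> 1 + \<bar>t\<bar>\<^sup>p\<close>.
\<close>

lemma mollification_power_le:
  fixes g :: "real ^ 'n \<Rightarrow> real"
  assumes [measurable]: "g \<in> borel_measurable borel" and \<epsilon>: "\<epsilon> > 0" and p: "p \<ge> 1"
  shows "ennreal (\<bar>mollify \<epsilon> g x - s\<bar> ^ p)
    \<le> (\<integral>\<^sup>+y. ennreal (mollifier \<epsilon> (x - y) * \<bar>g y - s\<bar> ^ p) \<partial>lborel)" (is "_ \<le> ?R")
proof (cases "?R = \<infinity>")
  case False
  obtain k where k: "p = Suc k" using p by (cases p) auto
  let ?\<kappa> = "\<lambda>y. mollifier \<epsilon> (x - y)"
  have \<kappa>0: "?\<kappa> y \<ge> 0" for y by (rule mollifier_nonneg[OF \<epsilon>])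
  have int\<kappa>: "integrable lborel ?\<kappa>"
    by (rule integrableI_nonneg) (auto simp: \<kappa>0 nn_integral_mollifier_reflect[OF \<epsilon>])
  have int1: "(LINT y|lborel. ?\<kappa> y) = 1"
    using nn_integral_eq_integral[OF int\<kappa>] \<kappa>0 nn_integral_mollifier_reflect(1)[OF \<epsilon>, of x]
    by simp
  have intp: "integrable lborel (\<lambda>y. ?\<kappa> y * \<bar>g y - s\<bar> ^ p)"
    by (rule integrableI_nonneg) (use False \<kappa>0 in \<open>auto simp: less_top\<close>)
  have le: "\<bar>t\<bar> \<le> 1 + \<bar>t\<bar> ^ p" for t :: real
  proof (cases "\<bar>t\<bar> \<le> 1")
    case True
    moreover have "0 \<le> \<bar>t\<bar> ^ p" by simp
    ultimately show ?thesis by linarith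
  next
    case False
    thus ?thesis using power_increasing[of 1 p "\<bar>t\<bar>"] p by simp
  qed
  have intabs: "integrable lborel (\<lambda>y. ?\<kappa> y * \<bar>g y - s\<bar>)"
  proof (rule Bochner_Integration.integrable_bound[OF Bochner_Integration.integrable_add[OF int\<kappa> intp]])
    show "AE y in lborel. norm (?\<kappa> y * \<bar>g y - s\<bar>) \<le> norm (?\<kappa> y + ?\<kappa> y * \<bar>g y - s\<bar> ^ p)"
    proof (rule AE_I2)
      fix y
      have "?\<kappa> y * \<bar>g y - s\<bar> \<le> ?\<kappa> y * (1 + \<bar>g y - s\<bar> ^ p)"
        by (rule mult_left_mono[OF le \<kappa>0])
      thus "norm (?\<kappa> y * \<bar>g y - s\<bar>) \<le> norm (?\<kappa> y + ?\<kappa> y * \<bar>g y - s\<bar> ^ p)"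
        using \<kappa>0[of y] by (simp add: abs_mult distrib_left)
    qed
  qed measurable
  have intd: "integrable lborel (\<lambda>y. ?\<kappa> y * (g y - s))"
    by (rule Bochner_Integration.integrable_bound[OF intabs]) (auto simp: abs_mult)
  define I where "I = (LINT y|lborel. ?\<kappa> y * \<bar>g y - s\<bar>)"
  have I0: "I \<ge> 0" unfolding I_def by (intro Bochner_Integration.integral_nonneg mult_nonneg_nonneg \<kappa>0) auto
  have "(\<lambda>y. ?\<kappa> y * g y) = (\<lambda>y. ?\<kappa> y * (g y - s) + s * ?\<kappa> y)" by (auto simp: algebra_simps)
  hence "(LINT y|lborel. ?\<kappa> y * g y) = (LINT y|lborel. ?\<kappa> y * (g y - s)) + s"
    using intd int\<kappa> int1 by simp
  hence "\<bar>(LINT y|lborel. ?\<kappa> y * g y) - s\<bar> = \<bar>LINT y|lborel. ?\<kappa> y * (g y - s)\<bar>" by simp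
  also have "\<dots> \<le> (LINT y|lborel. \<bar>?\<kappa> y * (g y - s)\<bar>)" by (rule integral_abs_bound)
  also have "\<dots> = I" unfolding I_def using \<kappa>0 by (simp add: abs_mult)
  finally have "\<bar>(LINT y|lborel. ?\<kappa> y * g y) - s\<bar> ^ p \<le> I ^ p" by (intro power_mono) auto
  also have "I ^ p \<le> (LINT y|lborel. ?\<kappa> y * \<bar>g y - s\<bar> ^ p)"
  proof -
    have "(LINT y|lborel. (I ^ p - real p * I ^ k * I) * ?\<kappa> y + real p * I ^ k * (?\<kappa> y * \<bar>g y - s\<bar>)) \<le>
      (LINT y|lborel. ?\<kappa> y * \<bar>g y - s\<bar> ^ p)"
    proof (rule integral_mono)
      fix y
      have "?\<kappa> y * (I ^ p + real p * I ^ k * (\<bar>g y - s\<bar> - I)) \<le> ?\<kappa> y * \<bar>g y - s\<bar> ^ p"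
        using power_above_tangent[OF I0, of "\<bar>g y - s\<bar>" k] unfolding k by (intro mult_left_mono \<kappa>0) auto
      thus "(I ^ p - real p * I ^ k * I) * ?\<kappa> y + real p * I ^ k * (?\<kappa> y * \<bar>g y - s\<bar>) \<le> ?\<kappa> y * \<bar>g y - s\<bar> ^ p"
        by (simp add: algebra_simps)
    qed (use int\<kappa> intabs intp in auto)
    also have "(LINT y|lborel. (I ^ p - real p * I ^ k * I) * ?\<kappa> y + real p * I ^ k * (?\<kappa> y * \<bar>g y - s\<bar>)) =
       (I ^ p - real p * I ^ k * I) * 1 + real p * I ^ k * I"
      using int\<kappa> intabs int1 by (simp add: I_def)
    finally show ?thesis by simp
  qed
  finally have "ennreal (\<bar>(LINT y|lborel. ?\<kappa> y * g y) - s\<bar> ^ p) \<le> ennreal (LINT y|lborel. ?\<kappa> y * \<bar>g y - s\<bar> ^ p)"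
    by (rule ennreal_leI)
  also have "\<dots> = ?R" using \<kappa>0 by (intro nn_integral_eq_integral[OF intp, symmetric]) auto
  finally show ?thesis .
qed simp

lemma clamp_abs_diff_le:
  fixes t :: real
  assumes "k \<ge> 0"
  shows "\<bar>t - max (- k) (min k t)\<bar> \<le> \<bar>t\<bar>"
  using assms by auto

lemma Lp_truncation_dense:
  fixes g :: "'a::euclidean_space \<Rightarrow> real"
  assumes [measurable]: "g \<in> borel_measurable borel" and fin: "(\<integral>\<^sup>+x. ennreal (\<bar>g x\<bar> ^ p) \<partial>lborel) < \<infinity>"
    and e: "e > 0" and p: "p \<ge> 1"
  shows "\<exists>k::nat. (\<integral>\<^sup>+x. ennreal (\<bar>g x - max (- real k) (min (real k) (g x))\<bar> ^ p) \<partial>lborel) < e"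
proof -
  let ?u = "\<lambda>k x. ennreal (\<bar>g x - max (- real k) (min (real k) (g x))\<bar> ^ p)"
  have "(\<lambda>k. \<integral>\<^sup>+x. ?u k x \<partial>lborel) \<longlonglongrightarrow> (\<integral>\<^sup>+x. 0 \<partial>(lborel :: 'a measure))"
  proof (rule nn_integral_dominated_convergence[where w = "\<lambda>x. ennreal (\<bar>g x\<bar> ^ p)"])
    show "AE x in lborel. (\<lambda>k. ?u k x) \<longlonglongrightarrow> 0"
    proof (rule AE_I2, rule tendsto_eventually)
      fix x
      obtain k0 :: nat where "\<bar>g x\<bar> \<le> real k0" using real_arch_simple by blast
      hence "?u k x = 0" if "k \<ge> k0" for k using that p by (auto simp: min_def max_def zero_power)
      thus "\<forall>\<^sub>F k in sequentially. ?u k x = 0" unfolding eventually_sequentially by blast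
    qed
    show "AE x in lborel. ?u k x \<le> ennreal (\<bar>g x\<bar> ^ p)" for k
      by (intro AE_I2 ennreal_leI power_mono clamp_abs_diff_le) auto
  qed (use fin in auto)
  hence "\<forall>\<^sub>F k in sequentially. (\<integral>\<^sup>+x. ?u k x \<partial>lborel) < e"
    by (rule order_tendstoD) (use e in simp)
  thus ?thesis using eventually_happens'[OF sequentially_bot] by blast
qed

text \<open>
  A measurable function is an almost everywhere limit of continuous ones. Truncating these at the
  level \<open>k\<close> and cutting them off outside a ball changes neither the limit nor continuity, and makes
  dominated convergence applicable.
\<close>

lemma bounded_continuous_dense:
  fixes g :: "'a::euclidean_space \<Rightarrow> real"
  assumes [measurable]: "g \<in> borel_measurable borel" and bd: "\<And>x. \<bar>g x\<bar> \<le> k" and R: "\<And>x. R \<le> norm x \<Longrightarrow> g x = 0"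
    and e: "e > 0" and p: "p \<ge> 1" and "k \<ge> 0"
  shows "\<exists>h. continuous_on UNIV h \<and> (\<forall>x. R + 1 \<le> norm x \<longrightarrow> h x = 0) \<and> (\<integral>\<^sup>+x. ennreal (\<bar>g x - h x\<bar> ^ p) \<partial>lborel) < e"
proof -
  have "g measurable_on UNIV"
    using measurable_completion[of g lborel borel] assms(1)
    by (subst measurable_on_iff_borel_measurable) (simp_all add: lebesgue_on_UNIV_eq)
  then obtain N h where N: "negligible N" and h: "\<And>n. continuous_on UNIV (h n)" "\<And>x. x \<notin> N \<Longrightarrow> (\<lambda>n. h n x) \<longlonglongrightarrow> g x"
    unfolding measurable_on_def by auto
  define cut where "cut x = max 0 (min 1 (R + 1 - norm x))" for x :: 'a
  define h' where "h' n x = max (- k) (min k (h n x)) * cut x" for n x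
  have cont: "continuous_on UNIV (h' n)" for n
    unfolding h'_def cut_def by (intro continuous_intros h)
  have [measurable]: "h' n \<in> borel_measurable borel" for n
    by (rule borel_measurable_continuous_onI[OF cont])
  have zero: "h' n x = 0" if "R + 1 \<le> norm x" for n x
    using that by (simp add: h'_def cut_def)
  have cut: "0 \<le> cut x" "cut x \<le> 1" for x by (auto simp: cut_def)
  have g_cut: "max (- k) (min k (g x)) * cut x = g x" for x
    using bd[of x] R[of x] by (cases "R \<le> norm x") (auto simp: cut_def max_def min_def abs_le_iff)
  have "(\<lambda>n. \<integral>\<^sup>+x. ennreal (\<bar>g x - h' n x\<bar> ^ p) \<partial>lborel) \<longlonglongrightarrow> (\<integral>\<^sup>+x. 0 \<partial>(lborel :: 'a measure))"
  proof (rule nn_integral_dominated_convergence[where w = "\<lambda>x. ennreal ((2 * k) ^ p) * indicator (cball 0 (R + 1)) x"])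
    have "AE x in lebesgue. x \<notin> N"
      using N by (intro AE_not_in) (simp add: negligible_iff_null_sets)
    hence "AE x in lborel. x \<notin> N" by (simp only: AE_completion_iff)
    thus "AE x in lborel. (\<lambda>n. ennreal (\<bar>g x - h' n x\<bar> ^ p)) \<longlonglongrightarrow> 0"
    proof eventually_elim
      case (elim x)
      have "(\<lambda>n. h' n x) \<longlonglongrightarrow> max (- k) (min k (g x)) * cut x"
        unfolding h'_def by (intro tendsto_intros h(2) elim)
      hence "(\<lambda>n. \<bar>g x - h' n x\<bar> ^ p) \<longlonglongrightarrow> \<bar>g x - g x\<bar> ^ p"
        unfolding g_cut by (intro tendsto_intros)
      from tendsto_ennrealI[OF this] show ?case using p by (simp add: zero_power)
    qed
    show "AE x in lborel. ennreal (\<bar>g x - h' n x\<bar> ^ p) \<le> ennreal ((2 * k) ^ p) * indicator (cball 0 (R + 1)) x" for n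
    proof (rule AE_I2)
      fix x
      show "ennreal (\<bar>g x - h' n x\<bar> ^ p) \<le> ennreal ((2 * k) ^ p) * indicator (cball 0 (R + 1)) x"
      proof (cases "norm x \<le> R + 1")
        case True
        have "\<bar>h' n x\<bar> = \<bar>max (- k) (min k (h n x))\<bar> * cut x" using cut by (simp add: h'_def abs_mult)
        also have "\<dots> \<le> k * 1" using cut \<open>k \<ge> 0\<close> by (intro mult_mono) auto
        finally have "\<bar>g x - h' n x\<bar> \<le> 2 * k" using bd[of x] by linarith
        hence "\<bar>g x - h' n x\<bar> ^ p \<le> (2 * k) ^ p" by (intro power_mono) auto
        thus ?thesis using True by (simp add: dist_norm ennreal_leI)
      next
        case False
        hence "g x = 0" "h' n x = 0" using R[of x] zero[of x n] by auto
        thus ?thesis using p by (simp add: zero_power)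
      qed
    qed
    show "(\<integral>\<^sup>+x. ennreal ((2 * k) ^ p) * indicator (cball (0::'a) (R + 1)) x \<partial>lborel) < \<infinity>"
      using emeasure_bounded_finite[OF bounded_cball[of "0::'a" "R + 1"]]
      by (subst nn_integral_cmult_indicator) (auto simp: ennreal_mult_less_top)
    have [measurable]: "cball (0 :: 'a) (R + 1) \<in> sets borel" by simp
    show "(\<lambda>x. ennreal ((2 * k) ^ p) * indicator (cball 0 (R + 1)) x) \<in> borel_measurable (lborel :: 'a measure)"
      by measurable
  qed auto
  hence "\<forall>\<^sub>F n in sequentially. (\<integral>\<^sup>+x. ennreal (\<bar>g x - h' n x\<bar> ^ p) \<partial>lborel) < e"
    by (rule order_tendstoD) (use e in simp)
  then obtain n where "(\<integral>\<^sup>+x. ennreal (\<bar>g x - h' n x\<bar> ^ p) \<partial>lborel) < e"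
    using eventually_happens'[OF sequentially_bot] by blast
  thus ?thesis using cont zero by blast
qed

lemma ennreal_cmult_plus:
  fixes c a b :: real
  assumes "0 \<le> c" "0 \<le> a" "0 \<le> b"
  shows "ennreal (c * (a + b)) = ennreal c * (ennreal a + ennreal b)"
proof -
  have "ennreal (c * (a + b)) = ennreal c * ennreal (a + b)" using assms by (intro ennreal_mult') auto
  thus ?thesis using ennreal_plus[OF assms(2,3)] by (simp only:)
qed

lemma Lp_continuous_dense:
  fixes g :: "'a::euclidean_space \<Rightarrow> real"
  assumes [measurable]: "g \<in> borel_measurable borel" and fin: "(\<integral>\<^sup>+x. ennreal (\<bar>g x\<bar> ^ p) \<partial>lborel) < \<infinity>"
    and R: "\<And>x. R \<le> norm x \<Longrightarrow> g x = 0" and e: "e > 0" and p: "p \<ge> 1"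
  shows "\<exists>h. continuous_on UNIV h \<and> (\<forall>x. R + 1 \<le> norm x \<longrightarrow> h x = 0) \<and> (\<integral>\<^sup>+x. ennreal (\<bar>g x - h x\<bar> ^ p) \<partial>lborel) \<le> ennreal e"
proof -
  define e' where "e' = e / (2 * 3 ^ p)"
  have e': "e' > 0" using e by (simp add: e'_def)
  obtain k :: nat where k: "(\<integral>\<^sup>+x. ennreal (\<bar>g x - max (- real k) (min (real k) (g x))\<bar> ^ p) \<partial>lborel) < ennreal e'"
    using Lp_truncation_dense[OF assms(1) fin _ p, of "ennreal e'"] e' by auto
  define g' where "g' x = max (- real k) (min (real k) (g x))" for x
  have [measurable]: "g' \<in> borel_measurable borel" unfolding g'_def[abs_def] by measurable
  have "g' x = 0" if "R \<le> norm x" for x using R[OF that] by (simp add: g'_def)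
  moreover have "\<bar>g' x\<bar> \<le> real k" for x by (auto simp: g'_def)
  ultimately obtain h where h: "continuous_on UNIV h" "\<And>x. R + 1 \<le> norm x \<Longrightarrow> h x = 0"
     "(\<integral>\<^sup>+x. ennreal (\<bar>g' x - h x\<bar> ^ p) \<partial>lborel) < ennreal e'"
    using bounded_continuous_dense[of g' "real k" R "ennreal e'" p] e' p by auto
  have [measurable]: "h \<in> borel_measurable borel" by (rule borel_measurable_continuous_onI[OF h(1)])
  have "(\<integral>\<^sup>+x. ennreal (\<bar>g x - h x\<bar> ^ p) \<partial>lborel) \<le>
    (\<integral>\<^sup>+x. ennreal (3 ^ p) * (ennreal (\<bar>g x - g' x\<bar> ^ p) + ennreal (\<bar>g' x - h x\<bar> ^ p)) \<partial>lborel)"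
  proof (rule nn_integral_mono)
    fix x
    have "\<bar>g x - h x\<bar> ^ p \<le> (\<bar>g x - g' x\<bar> + \<bar>g' x - h x\<bar> + 0) ^ p" by (intro power_mono) auto
    also have "\<dots> \<le> 3 ^ p * (\<bar>g x - g' x\<bar> ^ p + \<bar>g' x - h x\<bar> ^ p + 0 ^ p)" by (intro power_sum3_le) auto
    also have "\<dots> = 3 ^ p * (\<bar>g x - g' x\<bar> ^ p + \<bar>g' x - h x\<bar> ^ p)" using p by (simp add: zero_power)
    finally have "ennreal (\<bar>g x - h x\<bar> ^ p) \<le> ennreal (3 ^ p * (\<bar>g x - g' x\<bar> ^ p + \<bar>g' x - h x\<bar> ^ p))"
      by (rule ennreal_leI)
    thus "ennreal (\<bar>g x - h x\<bar> ^ p) \<le> ennreal (3 ^ p) * (ennreal (\<bar>g x - g' x\<bar> ^ p) + ennreal (\<bar>g' x - h x\<bar> ^ p))"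
      by (subst (asm) ennreal_cmult_plus) auto
  qed
  also have "\<dots> = ennreal (3 ^ p) * ((\<integral>\<^sup>+x. ennreal (\<bar>g x - g' x\<bar> ^ p) \<partial>lborel) + (\<integral>\<^sup>+x. ennreal (\<bar>g' x - h x\<bar> ^ p) \<partial>lborel))"
    by (simp add: nn_integral_cmult nn_integral_add)
  also have "\<dots> \<le> ennreal (3 ^ p) * (ennreal e' + ennreal e')"
    using k h(3) by (intro mult_left_mono add_mono) (auto simp: g'_def)
  also have "ennreal e' + ennreal e' = ennreal (e' + e')" using e' by (intro ennreal_plus[symmetric]) auto
  also have "ennreal (3 ^ p) * ennreal (e' + e') = ennreal (3 ^ p * (e' + e'))" by (rule ennreal_mult'[symmetric]) simp
  also have "3 ^ p * (e' + e') = e" by (simp add: e'_def)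
  finally show ?thesis using h by blast
qed

lemma continuous_mollification_error:
  fixes h :: "real ^ 'n \<Rightarrow> real"
  assumes h: "continuous_on UNIV h" and R: "\<And>x. R \<le> norm x \<Longrightarrow> h x = 0" and "e > 0" "p \<ge> 1"
  shows "\<exists>\<epsilon>0>0. \<forall>\<epsilon>. 0 < \<epsilon> \<and> \<epsilon> < \<epsilon>0 \<longrightarrow>
    (\<integral>\<^sup>+x. \<integral>\<^sup>+y. ennreal (mollifier \<epsilon> (x - y) * \<bar>h y - h x\<bar> ^ p) \<partial>lborel \<partial>lborel) \<le> ennreal e"
proof -
  define V where "V = measure lborel (cball (0 :: real ^ 'n) (R + 1))"
  have V: "V \<ge> 0" "emeasure lborel (cball (0 :: real ^ 'n) (R + 1)) = ennreal V"
    unfolding V_def using emeasure_bounded_finite[OF bounded_cball[of "0 :: real ^ 'n" "R + 1"]]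
    by (auto intro!: emeasure_eq_ennreal_measure)
  define \<eta> where "\<eta> = min 1 (e / (V + 1))"
  have \<eta>: "\<eta> > 0" "\<eta> \<le> 1" using assms(3) V by (auto simp: \<eta>_def)
  have \<eta>V: "\<eta> ^ p * V \<le> e"
  proof -
    have "\<eta> ^ p \<le> \<eta> ^ 1" using \<eta> assms(4) by (intro power_decreasing) auto
    also have "\<dots> \<le> e / (V + 1)" by (simp add: \<eta>_def)
    finally have "\<eta> ^ p * V \<le> e / (V + 1) * (V + 1)" using V assms(3) \<eta> by (intro mult_mono) auto
    thus ?thesis using V by simp
  qed
  have "uniformly_continuous_on (cball 0 (R + 2)) h"
    by (intro compact_uniformly_continuous continuous_on_subset[OF h]) auto
  then obtain d where d: "d > 0" "\<And>x y. x \<in> cball 0 (R + 2) \<Longrightarrow> y \<in> cball 0 (R + 2) \<Longrightarrow> dist y x < d \<Longrightarrow> dist (h y) (h x) < \<eta>"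
    unfolding uniformly_continuous_on_def using \<eta>(1) by metis
  have close: "\<bar>h y - h x\<bar> ^ p \<le> \<eta> ^ p * indicator (cball 0 (R + 1)) x" if "norm (x - y) < min d 1" for x y
  proof (cases "norm x \<le> R + 1")
    case True
    have "norm y \<le> norm x + norm (x - y)" using norm_triangle_sub[of y x] by (simp add: norm_minus_commute)
    hence "norm y \<le> R + 2" using True that by simp
    hence "\<bar>h y - h x\<bar> \<le> \<eta>" using d(2)[of x y] True that by (auto simp: dist_norm norm_minus_commute)
    hence "\<bar>h y - h x\<bar> ^ p \<le> \<eta> ^ p" by (intro power_mono) auto
    thus ?thesis using True by simp
  next
    case False
    have "norm x \<le> norm y + norm (x - y)" by (rule norm_triangle_sub)
    hence "h x = 0" "h y = 0" using False that by (auto intro!: R)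
    thus ?thesis using \<eta> assms(4) by (simp add: zero_power)
  qed
  have [measurable]: "h \<in> borel_measurable borel" by (rule borel_measurable_continuous_onI[OF h])
  show ?thesis
  proof (intro exI[of _ "min d 1"] conjI allI impI)
    fix \<epsilon> assume \<epsilon>: "0 < \<epsilon> \<and> \<epsilon> < min d 1"
    have "(\<integral>\<^sup>+x. \<integral>\<^sup>+y. ennreal (mollifier \<epsilon> (x - y) * \<bar>h y - h x\<bar> ^ p) \<partial>lborel \<partial>lborel) \<le>
      (\<integral>\<^sup>+x. \<integral>\<^sup>+y. ennreal (\<eta> ^ p) * indicator (cball 0 (R + 1)) x * ennreal (mollifier \<epsilon> (x - y :: real ^ 'n)) \<partial>lborel \<partial>lborel)"
    proof (intro nn_integral_mono)
      fix x y :: "real ^ 'n"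
      have "mollifier \<epsilon> (x - y) * \<bar>h y - h x\<bar> ^ p \<le> \<eta> ^ p * indicator (cball 0 (R + 1)) x * mollifier \<epsilon> (x - y)"
      proof (cases "norm (x - y) < \<epsilon>")
        case True
        thus ?thesis using mult_left_mono[OF close mollifier_nonneg, of x y \<epsilon> "x - y"] \<epsilon> by (simp add: mult.commute)
      next
        case False
        thus ?thesis using \<epsilon> by (simp add: mollifier_eq_0)
      qed
      hence "ennreal (mollifier \<epsilon> (x - y) * \<bar>h y - h x\<bar> ^ p) \<le> ennreal (\<eta> ^ p * indicator (cball 0 (R + 1)) x * mollifier \<epsilon> (x - y))"
        by (rule ennreal_leI)
      thus "ennreal (mollifier \<epsilon> (x - y) * \<bar>h y - h x\<bar> ^ p) \<le> ennreal (\<eta> ^ p) * indicator (cball 0 (R + 1)) x * ennreal (mollifier \<epsilon> (x - y))"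
        using \<eta> by (auto simp: ennreal_mult' split: split_indicator)
    qed
    also have "\<dots> = (\<integral>\<^sup>+x. ennreal (\<eta> ^ p) * indicator (cball 0 (R + 1)) x \<partial>(lborel :: (real ^ 'n) measure))"
      using \<epsilon> by (simp add: nn_integral_cmult nn_integral_mollifier_reflect)
    also have "\<dots> = ennreal (\<eta> ^ p * V)"
      using \<eta> V by (subst nn_integral_cmult_indicator) (auto simp: ennreal_mult')
    also have "\<dots> \<le> ennreal e" using \<eta>V by (rule ennreal_leI)
    finally show "(\<integral>\<^sup>+x. \<integral>\<^sup>+y. ennreal (mollifier \<epsilon> (x - y) * \<bar>h y - h x\<bar> ^ p) \<partial>lborel \<partial>lborel) \<le> ennreal e" .
  qed (use d in auto)
qed

text \<open>
  The error is at most the double integral of \<open>\<bar>g y - g x\<bar>\<^sup>p\<close> against the mollifier. Inserting a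
  continuous \<open>h\<close> close to \<open>g\<close> bounds it, up to the factor \<open>3\<^sup>p\<close>, by two terms equal to the integral
  of \<open>\<bar>g - h\<bar>\<^sup>p\<close>, by Tonelli's theorem, and the corresponding double integral for \<open>h\<close>, which is
  small by uniform continuity.
\<close>

lemma mollification_converges_Lp:
  fixes g :: "real ^ 'n \<Rightarrow> real"
  assumes [measurable]: "g \<in> borel_measurable borel" and fin: "(\<integral>\<^sup>+x. ennreal (\<bar>g x\<bar> ^ p) \<partial>lborel) < \<infinity>"
    and R: "\<And>x. R \<le> norm x \<Longrightarrow> g x = 0" and e: "e > 0" and p: "p \<ge> 1"
  shows "\<exists>\<epsilon>0>0. \<forall>\<epsilon>. 0 < \<epsilon> \<and> \<epsilon> < \<epsilon>0 \<longrightarrow>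
    (\<integral>\<^sup>+x. ennreal (\<bar>mollify \<epsilon> g x - g x\<bar> ^ p) \<partial>lborel) \<le> ennreal e"
proof -
  define e' where "e' = e / (3 * 3 ^ p)"
  have e': "e' > 0" using e by (simp add: e'_def)
  obtain h where h: "continuous_on UNIV h" "\<And>x. R + 1 \<le> norm x \<Longrightarrow> h x = 0"
    "(\<integral>\<^sup>+x. ennreal (\<bar>g x - h x\<bar> ^ p) \<partial>lborel) \<le> ennreal e'"
    using Lp_continuous_dense[OF assms(1) fin R e' p] by blast
  have [measurable]: "h \<in> borel_measurable borel" by (rule borel_measurable_continuous_onI[OF h(1)])
  obtain \<epsilon>0 where \<epsilon>0: "\<epsilon>0 > 0" "\<And>\<epsilon>. 0 < \<epsilon> \<Longrightarrow> \<epsilon> < \<epsilon>0 \<Longrightarrow>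
    (\<integral>\<^sup>+x. \<integral>\<^sup>+y. ennreal (mollifier \<epsilon> (x - y) * \<bar>h y - h x\<bar> ^ p) \<partial>lborel \<partial>lborel) \<le> ennreal e'"
    using continuous_mollification_error[OF h(1,2) e' p] by blast
  show ?thesis
  proof (intro exI[of _ \<epsilon>0] conjI allI impI \<epsilon>0(1))
    fix \<epsilon> assume \<epsilon>: "0 < \<epsilon> \<and> \<epsilon> < \<epsilon>0"
    let ?\<kappa> = "\<lambda>x y. ennreal (mollifier \<epsilon> (x - y :: real ^ 'n))"
    let ?G = "\<lambda>x. ennreal (\<bar>g x - h x\<bar> ^ p)"
    let ?H = "\<lambda>x y. ennreal (mollifier \<epsilon> (x - y) * \<bar>h y - h x\<bar> ^ p)"
    have "(\<integral>\<^sup>+x. ennreal (\<bar>mollify \<epsilon> g x - g x\<bar> ^ p) \<partial>lborel) \<le>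
      (\<integral>\<^sup>+x. \<integral>\<^sup>+y. ennreal (mollifier \<epsilon> (x - y) * \<bar>g y - g x\<bar> ^ p) \<partial>lborel \<partial>lborel)"
      using \<epsilon> by (intro nn_integral_mono mollification_power_le p) auto
    also have "\<dots> \<le> (\<integral>\<^sup>+x. \<integral>\<^sup>+y. ennreal (3 ^ p) * (?\<kappa> x y * ?G y + ?H x y + ?\<kappa> x y * ?G x) \<partial>lborel \<partial>lborel)"
    proof (intro nn_integral_mono)
      fix x y :: "real ^ 'n"
      have \<kappa>: "mollifier \<epsilon> (x - y) \<ge> 0" using \<epsilon> by (simp add: mollifier_nonneg)
      have "\<bar>g y - g x\<bar> ^ p \<le> (\<bar>g y - h y\<bar> + \<bar>h y - h x\<bar> + \<bar>g x - h x\<bar>) ^ p" by (intro power_mono) auto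
      also have "\<dots> \<le> 3 ^ p * (\<bar>g y - h y\<bar> ^ p + \<bar>h y - h x\<bar> ^ p + \<bar>g x - h x\<bar> ^ p)" by (intro power_sum3_le) auto
      finally have "mollifier \<epsilon> (x - y) * \<bar>g y - g x\<bar> ^ p \<le> mollifier \<epsilon> (x - y) * (3 ^ p * (\<bar>g y - h y\<bar> ^ p + \<bar>h y - h x\<bar> ^ p + \<bar>g x - h x\<bar> ^ p))"
        by (rule mult_left_mono[OF _ \<kappa>])
      also have "\<dots> = 3 ^ p * (mollifier \<epsilon> (x - y) * \<bar>g y - h y\<bar> ^ p + mollifier \<epsilon> (x - y) * \<bar>h y - h x\<bar> ^ p + mollifier \<epsilon> (x - y) * \<bar>g x - h x\<bar> ^ p)"
        by (simp add: algebra_simps)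
      finally have "ennreal (mollifier \<epsilon> (x - y) * \<bar>g y - g x\<bar> ^ p) \<le> ennreal (3 ^ p * (mollifier \<epsilon> (x - y) * \<bar>g y - h y\<bar> ^ p + mollifier \<epsilon> (x - y) * \<bar>h y - h x\<bar> ^ p + mollifier \<epsilon> (x - y) * \<bar>g x - h x\<bar> ^ p))"
        by (rule ennreal_leI)
      also have "\<dots> = ennreal (3 ^ p) * (?\<kappa> x y * ?G y + ?H x y + ?\<kappa> x y * ?G x)"
        using \<kappa> by (simp only: ennreal_cmult_plus ennreal_plus ennreal_mult' mult_nonneg_nonneg
            add_nonneg_nonneg zero_le_power abs_ge_zero zero_le_numeral)
      finally show "ennreal (mollifier \<epsilon> (x - y) * \<bar>g y - g x\<bar> ^ p) \<le> ennreal (3 ^ p) * (?\<kappa> x y * ?G y + ?H x y + ?\<kappa> x y * ?G x)" .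
    qed
    also have "\<dots> = ennreal (3 ^ p) * ((\<integral>\<^sup>+x. \<integral>\<^sup>+y. ?\<kappa> x y * ?G y \<partial>lborel \<partial>lborel) +
        (\<integral>\<^sup>+x. \<integral>\<^sup>+y. ?H x y \<partial>lborel \<partial>lborel) + (\<integral>\<^sup>+x. \<integral>\<^sup>+y. ?\<kappa> x y * ?G x \<partial>lborel \<partial>lborel))"
      by (simp add: nn_integral_cmult nn_integral_add)
    also have "(\<integral>\<^sup>+x. \<integral>\<^sup>+y. ?\<kappa> x y * ?G y \<partial>lborel \<partial>lborel) = (\<integral>\<^sup>+y. \<integral>\<^sup>+x. ?\<kappa> x y * ?G y \<partial>lborel \<partial>lborel)"
      by (rule lborel_pair.Fubini'[symmetric]) measurable
    also have "\<dots> = (\<integral>\<^sup>+y. ?G y \<partial>lborel)"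
      using \<epsilon> by (simp add: nn_integral_multc nn_integral_mollifier_reflect)
    also have "(\<integral>\<^sup>+x. \<integral>\<^sup>+y. ?\<kappa> x y * ?G x \<partial>lborel \<partial>lborel) = (\<integral>\<^sup>+x. ?G x \<partial>lborel)"
      using \<epsilon> by (simp add: nn_integral_multc nn_integral_mollifier_reflect)
    also have "ennreal (3 ^ p) * ((\<integral>\<^sup>+y. ?G y \<partial>lborel) + (\<integral>\<^sup>+x. \<integral>\<^sup>+y. ?H x y \<partial>lborel \<partial>lborel) + (\<integral>\<^sup>+x. ?G x \<partial>lborel))
       \<le> ennreal (3 ^ p) * (ennreal e' + ennreal e' + ennreal e')"
      using h(3) \<epsilon>0(2)[of \<epsilon>] \<epsilon> by (intro mult_left_mono add_mono) auto
    also have "ennreal e' + ennreal e' + ennreal e' = ennreal (e' + e' + e')" using e' by (simp only: ennreal_plus[symmetric] add_nonneg_nonneg less_imp_le)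
    also have "ennreal (3 ^ p) * ennreal (e' + e' + e') = ennreal (3 ^ p * (e' + e' + e'))" by (rule ennreal_mult'[symmetric]) simp
    also have "3 ^ p * (e' + e' + e') = e" by (simp add: e'_def)
    finally show "(\<integral>\<^sup>+x. ennreal (\<bar>mollify \<epsilon> g x - g x\<bar> ^ p) \<partial>lborel) \<le> ennreal e" .
  qed
qed

section \<open>The distance to the complement\<close>

lemma dist_compl_continuous: "continuous_on S (dist_compl \<Omega>)"
  unfolding dist_compl_def[abs_def] by (intro continuous_intros)

lemma inner_sets:
  fixes \<Omega> :: "'a::euclidean_space set"
  assumes "open \<Omega>" "bounded \<Omega>" "h > 0"
  shows "compact {y. h / 2 \<le> dist_compl \<Omega> y}" "{y. h / 2 \<le> dist_compl \<Omega> y} \<subseteq> \<Omega>"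
    "open {y. h < dist_compl \<Omega> y}" "{y. h < dist_compl \<Omega> y} \<subseteq> \<Omega>"
    "closure {y. h < dist_compl \<Omega> y} \<subseteq> {y. h \<le> dist_compl \<Omega> y}"
    "\<And>x. h \<le> dist_compl \<Omega> x \<Longrightarrow> cball x (h / 2) \<subseteq> {y. h / 2 \<le> dist_compl \<Omega> y}"
proof -
  have cl: "closed {y. s \<le> dist_compl \<Omega> y}" for s
    by (intro closed_Collect_le continuous_intros dist_compl_continuous)
  have sub: "{y. s \<le> dist_compl \<Omega> y} \<subseteq> \<Omega>" if "s > 0" for s
  proof (rule subsetI, rule ccontr)
    fix y assume "y \<in> {y. s \<le> dist_compl \<Omega> y}" "y \<notin> \<Omega>"
    moreover from \<open>y \<notin> \<Omega>\<close> have "infdist y (- \<Omega>) = 0" by simp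
    ultimately show False using that by (simp add: dist_compl_def)
  qed
  show "{y. h / 2 \<le> dist_compl \<Omega> y} \<subseteq> \<Omega>" by (rule sub) (use assms in simp)
  thus "compact {y. h / 2 \<le> dist_compl \<Omega> y}"
    using cl assms(2) bounded_subset compact_eq_bounded_closed by blast
  show "open {y. h < dist_compl \<Omega> y}"
    by (intro open_Collect_less continuous_intros dist_compl_continuous)
  show "{y. h < dist_compl \<Omega> y} \<subseteq> \<Omega>" using sub[OF assms(3)] by force
  show "closure {y. h < dist_compl \<Omega> y} \<subseteq> {y. h \<le> dist_compl \<Omega> y}"
    by (rule closure_minimal[OF _ cl]) auto
  show "cball x (h / 2) \<subseteq> {y. h / 2 \<le> dist_compl \<Omega> y}" if "h \<le> dist_compl \<Omega> x" for x
  proof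
    fix y assume "y \<in> cball x (h / 2)"
    thus "y \<in> {y. h / 2 \<le> dist_compl \<Omega> y}"
      using infdist_triangle[of x "- \<Omega>" y] that by (simp add: dist_compl_def)
  qed
qed

lemma dist_compl_pos:
  assumes "open \<Omega>" "\<Omega> \<noteq> UNIV" "x \<in> \<Omega>"
  shows "dist_compl \<Omega> x > 0"
proof -
  have "closed (- \<Omega>)" "- \<Omega> \<noteq> {}" using assms by auto
  hence "infdist x (- \<Omega>) \<noteq> 0" using assms(3) in_closed_iff_infdist_zero by blast
  thus ?thesis unfolding dist_compl_def using infdist_nonneg[of x "- \<Omega>"] by linarith
qed

text \<open>
  A nearest point of the complement lies on the boundary, because it is a limit of points of the open
  ball around \<open>x\<close>, which is contained in \<open>\<Omega>\<close>.
\<close>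

lemma nearest_boundary_point:
  fixes \<Omega> :: "'a::euclidean_space set"
  assumes "open \<Omega>" "\<Omega> \<noteq> UNIV" "x \<in> \<Omega>"
  obtains z where "z \<in> frontier \<Omega>" "dist x z = dist_compl \<Omega> x" "ball x (dist_compl \<Omega> x) \<subseteq> \<Omega>"
proof -
  have "closed (- \<Omega>)" "- \<Omega> \<noteq> {}" using assms by auto
  then obtain z where z: "z \<in> - \<Omega>" "infdist x (- \<Omega>) = dist x z" using infdist_attains_inf by blast
  have inball: "ball x (dist_compl \<Omega> x) \<subseteq> \<Omega>"
    using infdist_le[of _ "- \<Omega>" x] by (force simp: dist_compl_def)
  have dz: "dist x z = dist_compl \<Omega> x" using z by (simp add: dist_compl_def)
  moreover have "dist_compl \<Omega> x > 0" by (rule dist_compl_pos[OF assms])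
  ultimately have "z \<in> closure (ball x (dist_compl \<Omega> x))" by simp
  hence "z \<in> closure \<Omega>" using closure_mono[OF inball] by blast
  hence "z \<in> frontier \<Omega>" using z(1) assms(1) by (simp add: frontier_def interior_open)
  thus thesis using that dz inball by blast
qed

section \<open>Uniqueness of weak derivatives\<close>

text \<open>
  Product measures are taken over the Borel algebra, so a Lebesgue measurable function is replaced by
  a Borel function that agrees with it almost everywhere on \<open>K\<close>.
\<close>

lemma Lp_loc_borel_representative:
  fixes g :: "'a::euclidean_space \<Rightarrow> real"
  assumes g: "g \<in> Lp_loc (real p) \<Omega>" and p: "p \<ge> 1" and K: "compact K" "K \<subseteq> \<Omega>" "\<Omega> \<in> sets lebesgue"
  obtains g' where "g' \<in> borel_measurable borel" "AE x in lebesgue. x \<in> K \<longrightarrow> g x = g' x"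
    "\<And>x. x \<notin> K \<Longrightarrow> g' x = 0" "(\<integral>\<^sup>+x. ennreal (\<bar>g' x\<bar> ^ p) \<partial>lborel) < \<infinity>"
proof -
  have KB: "K \<in> sets borel" using K(1) by (rule borel_compact)
  hence KL: "K \<in> sets lebesgue" "K \<in> sets borel" by auto
  have "g \<in> borel_measurable (lebesgue_on \<Omega>)" using g by (simp add: Lp_loc_def)
  hence "g \<in> borel_measurable (lebesgue_on K)"
    by (rule measurable_restrict_mono) (use K in auto)
  hence "(\<lambda>x. indicator K x *\<^sub>R g x) \<in> borel_measurable lebesgue"
    using KL by (subst (asm) borel_measurable_restrict_space_iff) auto
  then obtain g0 where g0: "g0 \<in> borel_measurable lborel" "AE x in lborel. indicator K x *\<^sub>R g x = g0 x"
    using completion_ex_borel_measurable_real by blast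
  define g' where "g' x = indicator K x * g0 x" for x
  have [measurable]: "g0 \<in> borel_measurable borel" "K \<in> sets borel" using g0(1) KL by auto
  have m: "g' \<in> borel_measurable borel" unfolding g'_def[abs_def] by measurable
  have ae: "AE x in lebesgue. indicator K x *\<^sub>R g x = g0 x" using g0(2) by (rule AE_completion)
  have eq: "AE x in lebesgue. x \<in> K \<longrightarrow> g x = g' x"
    using ae by eventually_elim (auto simp: g'_def)
  have pow: "\<bar>t\<bar> powr real p = \<bar>t\<bar> ^ p" for t :: real
    using p by (cases "t = 0") (auto simp: powr_realpow)
  have "set_integrable lebesgue K (\<lambda>x. \<bar>g x\<bar> powr real p)" using g K by (simp add: Lp_loc_def)
  hence "integrable lebesgue (\<lambda>x. indicator K x *\<^sub>R \<bar>g x\<bar> ^ p)" by (simp add: set_integrable_def pow)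
  hence "(\<integral>\<^sup>+x. ennreal (norm (indicator K x *\<^sub>R \<bar>g x\<bar> ^ p)) \<partial>lebesgue) < \<infinity>"
    by (simp add: integrable_iff_bounded)
  also have "(\<integral>\<^sup>+x. ennreal (norm (indicator K x *\<^sub>R \<bar>g x\<bar> ^ p)) \<partial>lebesgue) = (\<integral>\<^sup>+x. ennreal (\<bar>g' x\<bar> ^ p) \<partial>lebesgue)"
    by (rule nn_integral_cong_AE, use eq in eventually_elim) (use p in \<open>auto simp: g'_def zero_power split: split_indicator\<close>)
  also have "\<dots> = (\<integral>\<^sup>+x. ennreal (\<bar>g' x\<bar> ^ p) \<partial>lborel)" by (rule nn_integral_completion)
  finally show thesis using that[OF m eq] by (auto simp: g'_def)
qed

lemma ker_integral_representative:
  fixes g :: "real ^ 'n \<Rightarrow> real"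
  assumes g': "g' \<in> borel_measurable borel" and eq: "AE x in lebesgue. x \<in> K \<longrightarrow> g x = g' x"
    and \<epsilon>: "\<epsilon> > 0" "cball x \<epsilon> \<subseteq> K" and K: "K \<subseteq> \<Omega>"
    and gm: "g \<in> borel_measurable (lebesgue_on \<Omega>)" "\<Omega> \<in> sets lebesgue"
  shows "(LINT y:\<Omega>|lebesgue. ker (\<epsilon>\<^sup>2) (x - y) * g y) = (LINT y|lborel. ker (\<epsilon>\<^sup>2) (x - y) * g' y)"
proof -
  have km: "(\<lambda>y. ker (\<epsilon>\<^sup>2) (x - y)) \<in> borel_measurable borel" by measurable
  have "(\<lambda>y. indicator \<Omega> y *\<^sub>R g y) \<in> borel_measurable lebesgue"
    using gm by (subst (asm) borel_measurable_restrict_space_iff) auto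
  hence "(\<lambda>y. ker (\<epsilon>\<^sup>2) (x - y) * (indicator \<Omega> y *\<^sub>R g y)) \<in> borel_measurable lebesgue"
    using km by (intro borel_measurable_times) (auto intro: measurable_completion)
  hence m1: "(\<lambda>y. indicator \<Omega> y *\<^sub>R (ker (\<epsilon>\<^sup>2) (x - y) * g y)) \<in> borel_measurable lebesgue"
    by (simp add: mult_ac)
  have m2': "(\<lambda>y. ker (\<epsilon>\<^sup>2) (x - y) * g' y) \<in> borel_measurable lborel" using g' by measurable
  hence m2: "(\<lambda>y. ker (\<epsilon>\<^sup>2) (x - y) * g' y) \<in> borel_measurable lebesgue" by (rule measurable_completion)
  have "(LINT y:\<Omega>|lebesgue. ker (\<epsilon>\<^sup>2) (x - y) * g y) = (LINT y|lebesgue. ker (\<epsilon>\<^sup>2) (x - y) * g' y)"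
    unfolding set_lebesgue_integral_def
  proof (rule integral_cong_AE[OF m1 m2])
    show "AE y in lebesgue. indicator \<Omega> y *\<^sub>R (ker (\<epsilon>\<^sup>2) (x - y) * g y) = ker (\<epsilon>\<^sup>2) (x - y) * g' y"
      using eq
    proof eventually_elim
      case (elim y)
      show ?case
      proof (cases "y \<in> K")
        case True
        thus ?thesis using elim K by auto
      next
        case False
        hence "y \<notin> cball x \<epsilon>" using \<epsilon>(2) by blast
        hence "\<epsilon> \<le> norm (x - y)" by (simp add: dist_norm)
        hence "ker (\<epsilon>\<^sup>2) (x - y) = 0" using \<epsilon>(1) by (rule ker_eq_0(1))
        thus ?thesis by simp
      qed
    qed
  qed
  also have "\<dots> = (LINT y|lborel. ker (\<epsilon>\<^sup>2) (x - y) * g' y)" by (rule integral_completion[OF m2'])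
  finally show ?thesis .
qed

lemma local_mollification_converges:
  fixes g :: "real ^ 'n \<Rightarrow> real"
  assumes g: "g \<in> Lp_loc (real p) \<Omega>" and p: "p \<ge> 1" and K: "compact K" "K \<subseteq> \<Omega>" "\<Omega> \<in> sets lebesgue"
    and D: "D \<in> sets borel" "\<And>x. x \<in> D \<Longrightarrow> cball x \<epsilon>1 \<subseteq> K" "\<epsilon>1 > 0" and e: "e > 0"
  shows "\<exists>\<epsilon>0>0. \<forall>\<epsilon>. 0 < \<epsilon> \<and> \<epsilon> < \<epsilon>0 \<longrightarrow>
    (\<integral>\<^sup>+x\<in>D. ennreal (\<bar>mollify_on \<Omega> \<epsilon> g x - g x\<bar> ^ p) \<partial>lebesgue) \<le> ennreal e"
proof -
  obtain g' where g': "g' \<in> borel_measurable borel" "AE x in lebesgue. x \<in> K \<longrightarrow> g x = g' x"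
    "\<And>x. x \<notin> K \<Longrightarrow> g' x = 0" "(\<integral>\<^sup>+x. ennreal (\<bar>g' x\<bar> ^ p) \<partial>lborel) < \<infinity>"
    using Lp_loc_borel_representative[OF g p K] by blast
  obtain R where "\<And>x. x \<in> K \<Longrightarrow> norm x \<le> R" using compact_imp_bounded[OF K(1)] bounded_iff by blast
  hence R: "g' x = 0" if "R + 1 \<le> norm x" for x using that g'(3)[of x] by force
  obtain \<epsilon>0 where \<epsilon>0: "\<epsilon>0 > 0" "\<And>\<epsilon>. 0 < \<epsilon> \<Longrightarrow> \<epsilon> < \<epsilon>0 \<Longrightarrow>
    (\<integral>\<^sup>+x. ennreal (\<bar>mollify \<epsilon> g' x - g' x\<bar> ^ p) \<partial>lborel) \<le> ennreal e"
    using mollification_converges_Lp[OF g'(1,4) R e p] by blast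
  have gm: "g \<in> borel_measurable (lebesgue_on \<Omega>)" using g by (simp add: Lp_loc_def)
  show ?thesis
  proof (intro exI[of _ "min \<epsilon>0 \<epsilon>1"] conjI allI impI)
    fix \<epsilon> assume \<epsilon>: "0 < \<epsilon> \<and> \<epsilon> < min \<epsilon>0 \<epsilon>1"
    have "(\<integral>\<^sup>+x\<in>D. ennreal (\<bar>mollify_on \<Omega> \<epsilon> g x - g x\<bar> ^ p) \<partial>lebesgue) \<le>
      (\<integral>\<^sup>+x. ennreal (\<bar>mollify \<epsilon> g' x - g' x\<bar> ^ p) \<partial>lebesgue)"
    proof (rule nn_integral_mono_AE, use g'(2) in eventually_elim)
      case (elim x)
      show ?case
      proof (cases "x \<in> D")
        case True
        have sub: "cball x \<epsilon> \<subseteq> K" using D(2)[OF True] \<epsilon> by auto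
        moreover have "x \<in> cball x \<epsilon>" using \<epsilon> by simp
        ultimately have "g x = g' x" using elim by blast
        moreover have "mollify_on \<Omega> \<epsilon> g x = mollify \<epsilon> g' x"
          using ker_integral_representative[OF g'(1,2) _ sub K(2) gm K(3)] \<epsilon> by (simp add: mollifier_def)
        ultimately show ?thesis using True by simp
      qed simp
    qed
    also have "\<dots> = (\<integral>\<^sup>+x. ennreal (\<bar>mollify \<epsilon> g' x - g' x\<bar> ^ p) \<partial>lborel)"
      by (rule nn_integral_completion)
    also have "\<dots> \<le> ennreal e" using \<epsilon>0(2) \<epsilon> by auto
    finally show "(\<integral>\<^sup>+x\<in>D. ennreal (\<bar>mollify_on \<Omega> \<epsilon> g x - g x\<bar> ^ p) \<partial>lebesgue) \<le> ennreal e" .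
  qed (use \<epsilon>0 D in auto)
qed

text \<open>
  Convolving either weak derivative with the kernel gives the convolution of \<open>f\<close> with a derivative of
  the kernel. So both have the same mollifications, and these converge to both in \<open>L\<^sub>1\<close>.
\<close>

lemma weak_partial_unique_local:
  fixes \<Omega> :: "(real ^ 'n) set"
  assumes g: "has_weak_partial \<Omega> i f g1" "has_weak_partial \<Omega> i f g2"
    and K: "compact K" "K \<subseteq> \<Omega>" "\<Omega> \<in> sets lebesgue"
    and D: "D \<in> sets borel" "D \<subseteq> \<Omega>" "\<And>x. x \<in> D \<Longrightarrow> cball x \<epsilon>1 \<subseteq> K" "\<epsilon>1 > 0"
  shows "AE x in lebesgue. x \<in> D \<longrightarrow> g1 x = g2 x"
proof -
  have L1: "g1 \<in> Lp_loc (real 1) \<Omega>" "g2 \<in> Lp_loc (real 1) \<Omega>" using g by (auto simp: has_weak_partial_def)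
  have m: "g1 \<in> borel_measurable (lebesgue_on \<Omega>)" "g2 \<in> borel_measurable (lebesgue_on \<Omega>)"
    using L1 by (auto simp: Lp_loc_def)
  have DL: "D \<in> sets lebesgue" using D(1) by auto
  have mD: "g1 \<in> borel_measurable (lebesgue_on D)" "g2 \<in> borel_measurable (lebesgue_on D)"
    using m by (auto intro: measurable_restrict_mono[OF _ D(2)])
  hence "(\<lambda>x. \<bar>g1 x - g2 x\<bar>) \<in> borel_measurable (lebesgue_on D)" by measurable
  from measurable_times_indicator[OF this DL]
  have meas: "(\<lambda>x. ennreal \<bar>g1 x - g2 x\<bar> * indicator D x) \<in> borel_measurable lebesgue" .
  have small: "(\<integral>\<^sup>+x\<in>D. ennreal \<bar>g1 x - g2 x\<bar> \<partial>lebesgue) \<le> 0 + ennreal e" if e: "e > 0" for e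
  proof -
    obtain \<epsilon>0 where \<epsilon>0: "\<epsilon>0 > 0" "\<And>\<epsilon>. 0 < \<epsilon> \<Longrightarrow> \<epsilon> < \<epsilon>0 \<Longrightarrow>
      (\<integral>\<^sup>+x\<in>D. ennreal (\<bar>mollify_on \<Omega> \<epsilon> g1 x - g1 x\<bar> ^ 1) \<partial>lebesgue) \<le> ennreal (e / 2)"
      using local_mollification_converges[OF L1(1) _ K D(1,3,4), of "e / 2"] e by auto
    obtain \<epsilon>0' where \<epsilon>0': "\<epsilon>0' > 0" "\<And>\<epsilon>. 0 < \<epsilon> \<Longrightarrow> \<epsilon> < \<epsilon>0' \<Longrightarrow>
      (\<integral>\<^sup>+x\<in>D. ennreal (\<bar>mollify_on \<Omega> \<epsilon> g2 x - g2 x\<bar> ^ 1) \<partial>lebesgue) \<le> ennreal (e / 2)"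
      using local_mollification_converges[OF L1(2) _ K D(1,3,4), of "e / 2"] e by auto
    define \<epsilon> where "\<epsilon> = min (min \<epsilon>0 \<epsilon>0') \<epsilon>1 / 2"
    have \<epsilon>: "0 < \<epsilon>" "\<epsilon> < \<epsilon>0" "\<epsilon> < \<epsilon>0'" "\<epsilon> < \<epsilon>1" using \<epsilon>0(1) \<epsilon>0'(1) D(4) by (auto simp: \<epsilon>_def)
    define m1 m2 where "m1 x = mollify_on \<Omega> \<epsilon> g1 x"
      and "m2 x = mollify_on \<Omega> \<epsilon> g2 x" for x
    obtain h1 where h1: "h1 \<in> borel_measurable borel" "AE x in lebesgue. x \<in> K \<longrightarrow> g1 x = h1 x"
      using Lp_loc_borel_representative[OF L1(1) _ K] by auto
    define c where "c x = (LINT y|lborel. ker (\<epsilon>\<^sup>2) (x - y) * h1 y) / ker_mass TYPE('n) \<epsilon>" for x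
    have [measurable]: "c \<in> borel_measurable borel" unfolding c_def[abs_def] using h1(1) by measurable
    have m12: "m1 x = c x" "m2 x = c x" if "x \<in> D" for x
    proof -
      have sub: "cball x \<epsilon> \<subseteq> \<Omega>" "cball x \<epsilon> \<subseteq> K" using D(3)[OF that] K(2) \<epsilon> by force+
      show 1: "m1 x = c x"
        unfolding m1_def c_def using ker_integral_representative[OF h1 \<epsilon>(1) sub(2) K(2) m(1) K(3)] by simp
      have "m1 x = m2 x"
        unfolding m1_def m2_def using ker_weak_partial(1)[OF g(1) \<epsilon>(1) sub(1)] ker_weak_partial(1)[OF g(2) \<epsilon>(1) sub(1)] by simp
      thus "m2 x = c x" using 1 by simp
    qed
    have mm: "(\<lambda>x. ennreal \<bar>c x - g x\<bar> * indicator D x) \<in> borel_measurable lebesgue"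
      if "g \<in> borel_measurable (lebesgue_on D)" for g
    proof -
      have "c \<in> borel_measurable (lebesgue_on D)" by (intro measurable_restrict_space1 measurable_completion) simp
      hence "(\<lambda>x. \<bar>c x - g x\<bar>) \<in> borel_measurable (lebesgue_on D)" using that by measurable
      thus ?thesis using DL by (rule measurable_times_indicator)
    qed
    have "(\<integral>\<^sup>+x\<in>D. ennreal \<bar>g1 x - g2 x\<bar> \<partial>lebesgue) \<le>
        (\<integral>\<^sup>+x. ennreal \<bar>c x - g1 x\<bar> * indicator D x + ennreal \<bar>c x - g2 x\<bar> * indicator D x \<partial>lebesgue)"
    proof (rule nn_integral_mono)
      fix x
      have "ennreal \<bar>g1 x - g2 x\<bar> \<le> ennreal (\<bar>c x - g1 x\<bar> + \<bar>c x - g2 x\<bar>)" by (rule ennreal_leI) linarith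
      thus "ennreal \<bar>g1 x - g2 x\<bar> * indicator D x \<le> ennreal \<bar>c x - g1 x\<bar> * indicator D x + ennreal \<bar>c x - g2 x\<bar> * indicator D x"
        by (auto split: split_indicator)
    qed
    also have "\<dots> = (\<integral>\<^sup>+x\<in>D. ennreal \<bar>c x - g1 x\<bar> \<partial>lebesgue) + (\<integral>\<^sup>+x\<in>D. ennreal \<bar>c x - g2 x\<bar> \<partial>lebesgue)"
      by (rule nn_integral_add[OF mm[OF mD(1)] mm[OF mD(2)]])
    also have "(\<integral>\<^sup>+x\<in>D. ennreal \<bar>c x - g1 x\<bar> \<partial>lebesgue) = (\<integral>\<^sup>+x\<in>D. ennreal (\<bar>m1 x - g1 x\<bar> ^ 1) \<partial>lebesgue)"
      by (rule nn_integral_cong) (auto simp: m12 split: split_indicator)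
    also have "(\<integral>\<^sup>+x\<in>D. ennreal \<bar>c x - g2 x\<bar> \<partial>lebesgue) = (\<integral>\<^sup>+x\<in>D. ennreal (\<bar>m2 x - g2 x\<bar> ^ 1) \<partial>lebesgue)"
      by (rule nn_integral_cong) (auto simp: m12 split: split_indicator)
    also have "(\<integral>\<^sup>+x\<in>D. ennreal (\<bar>m1 x - g1 x\<bar> ^ 1) \<partial>lebesgue) + (\<integral>\<^sup>+x\<in>D. ennreal (\<bar>m2 x - g2 x\<bar> ^ 1) \<partial>lebesgue) \<le> ennreal (e / 2) + ennreal (e / 2)"
      unfolding m1_def m2_def using \<epsilon>0(2)[OF \<epsilon>(1,2)] \<epsilon>0'(2)[OF \<epsilon>(1,3)] by (rule add_mono)
    also have "\<dots> = ennreal (e / 2 + e / 2)" using e by (intro ennreal_plus[symmetric]) auto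
    finally show ?thesis by simp
  qed
  have "(\<integral>\<^sup>+x\<in>D. ennreal \<bar>g1 x - g2 x\<bar> \<partial>lebesgue) \<le> 0" by (rule ennreal_le_epsilon, rule small)
  hence "(\<integral>\<^sup>+x. ennreal \<bar>g1 x - g2 x\<bar> * indicator D x \<partial>lebesgue) = 0" by simp
  hence "AE x in lebesgue. ennreal \<bar>g1 x - g2 x\<bar> * indicator D x = 0"
    using meas by (simp add: nn_integral_0_iff_AE)
  thus ?thesis by eventually_elim (auto split: split_indicator_asm)
qed

lemma weak_partial_unique:
  fixes \<Omega> :: "(real ^ 'n) set"
  assumes \<Omega>: "open \<Omega>" "bounded \<Omega>" and g: "has_weak_partial \<Omega> i f g1" "has_weak_partial \<Omega> i f g2"
  shows "AE x in lebesgue. x \<in> \<Omega> \<longrightarrow> g1 x = g2 x"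
proof -
  have ne: "\<Omega> \<noteq> UNIV" using \<Omega>(2) not_bounded_UNIV by blast
  have "AE x in lebesgue. x \<in> {y. 1 / real (Suc k) < dist_compl \<Omega> y} \<longrightarrow> g1 x = g2 x" for k
    by (rule weak_partial_unique_local[OF g inner_sets(1,2)[OF \<Omega>, of "1 / real (Suc k)"], where ?\<epsilon>1.0 = "1 / real (Suc k) / 2"])
      (use \<Omega> inner_sets(3,4,6)[OF \<Omega>, of "1 / real (Suc k)"] in auto)
  hence "AE x in lebesgue. \<forall>k. x \<in> {y. 1 / real (Suc k) < dist_compl \<Omega> y} \<longrightarrow> g1 x = g2 x"
    by (subst AE_all_countable) blast
  thus ?thesis
  proof eventually_elim
    case (elim x)
    show ?case
    proof
      assume "x \<in> \<Omega>"
      then obtain k where "1 / real (Suc k) < dist_compl \<Omega> x"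
        using dist_compl_pos[OF \<Omega>(1) ne] nat_approx_posE by blast
      thus "g1 x = g2 x" using elim by blast
    qed
  qed
qed

lemma Lp_loc_cong_AE:
  assumes f: "f \<in> Lp_loc p \<Omega>" and g: "g \<in> borel_measurable (lebesgue_on \<Omega>)" "\<Omega> \<in> sets lebesgue"
    and eq: "AE x in lebesgue. x \<in> \<Omega> \<longrightarrow> f x = g x"
  shows "g \<in> Lp_loc p \<Omega>"
proof -
  have "set_integrable lebesgue S (\<lambda>x. \<bar>g x\<bar> powr p)" if S: "compact S" "S \<subseteq> \<Omega>" for S
  proof -
    have int: "integrable lebesgue (\<lambda>x. indicator S x *\<^sub>R \<bar>f x\<bar> powr p)"
      using f S by (auto simp: Lp_loc_def set_integrable_def)
    have "S \<in> sets borel" using S(1) by (rule borel_compact)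
    hence SL: "S \<in> sets lebesgue" by auto
    have "g \<in> borel_measurable (lebesgue_on S)" using g(1) by (rule measurable_restrict_mono[OF _ S(2)])
    hence "(\<lambda>x. \<bar>g x\<bar> powr p) \<in> borel_measurable (lebesgue_on S)" by measurable
    hence m: "(\<lambda>x. indicator S x *\<^sub>R \<bar>g x\<bar> powr p) \<in> borel_measurable lebesgue"
      using SL by (subst (asm) borel_measurable_restrict_space_iff) auto
    show ?thesis unfolding set_integrable_def
      by (rule integrable_cong_AE_imp[OF int m], use eq in eventually_elim) (use S(2) in \<open>auto split: split_indicator\<close>)
  qed
  thus ?thesis using g(1) by (simp add: Lp_loc_def)
qed

text \<open>
  The function \<open>weak_partial\<close> selects some weak derivative; by uniqueness it agrees almost everywhere
  with the derivatives provided by the Sobolev space, hence is integrable like them and itself has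
  the expected weak derivatives.
\<close>

lemma W2_loc_weak_partials:
  fixes \<Omega> :: "(real ^ 'n) set"
  assumes \<Omega>: "open \<Omega>" "bounded \<Omega>" and u: "u \<in> W2_loc p \<Omega>"
  shows "has_weak_partial \<Omega> j u (weak_partial \<Omega> j u)"
    and "has_weak_partial \<Omega> i (weak_partial \<Omega> j u) (weak_partial \<Omega> i (weak_partial \<Omega> j u))"
    and "weak_partial \<Omega> j u \<in> Lp_loc p \<Omega>" and "weak_partial \<Omega> i (weak_partial \<Omega> j u) \<in> Lp_loc p \<Omega>"
proof -
  obtain Du D2u where W: "\<And>i. Du i \<in> Lp_loc p \<Omega>" "\<And>i. has_weak_partial \<Omega> i u (Du i)"
    "\<And>i j. D2u i j \<in> Lp_loc p \<Omega>" "\<And>i j. has_weak_partial \<Omega> i (Du j) (D2u i j)"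
    using u unfolding W2_loc_def by blast
  have \<Omega>L: "\<Omega> \<in> sets lebesgue" using \<Omega>(1) by auto
  let ?g = "weak_partial \<Omega> j u"
  show 1: "has_weak_partial \<Omega> j u ?g"
    unfolding weak_partial_def by (rule someI[of "has_weak_partial \<Omega> j u"]) (rule W(2))
  have eq: "AE x in lebesgue. x \<in> \<Omega> \<longrightarrow> Du j x = ?g x" by (rule weak_partial_unique[OF \<Omega> W(2) 1])
  have gm: "?g \<in> borel_measurable (lebesgue_on \<Omega>)" using 1 by (simp add: has_weak_partial_def Lp_loc_def)
  show "?g \<in> Lp_loc p \<Omega>" by (rule Lp_loc_cong_AE[OF W(1) gm \<Omega>L eq])
  have test_meas: "\<psi> \<in> borel_measurable lebesgue" if "\<forall>k. Ck k \<psi>" for \<psi> :: "real ^ 'n \<Rightarrow> real"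
  proof -
    have "Ck 0 \<psi>" using that by blast
    hence "continuous_on UNIV \<psi>" by simp
    thus ?thesis using borel_measurable_continuous_onI measurable_completion by (metis measurable_lborel2)
  qed
  have "has_weak_partial \<Omega> i ?g (D2u i j)"
    unfolding has_weak_partial_def
  proof (intro conjI ballI)
    show "?g \<in> Lp_loc 1 \<Omega>" "D2u i j \<in> Lp_loc 1 \<Omega>" using 1 W(4) by (auto simp: has_weak_partial_def)
    fix \<phi> assume \<phi>: "\<phi> \<in> test_functions \<Omega>"
    hence Ck: "\<forall>k. Ck k \<phi>" by (simp add: test_functions_def)
    hence "\<forall>k. Ck (Suc k) \<phi>" by blast
    hence "\<forall>k. Ck k (classical_partial i \<phi>)" by simp
    hence pm: "classical_partial i \<phi> \<in> borel_measurable lebesgue" by (rule test_meas)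
    have m: "(\<lambda>x. indicator \<Omega> x *\<^sub>R (h x * classical_partial i \<phi> x)) \<in> borel_measurable lebesgue"
      if "h \<in> borel_measurable (lebesgue_on \<Omega>)" for h
    proof -
      have "classical_partial i \<phi> \<in> borel_measurable (lebesgue_on \<Omega>)" using pm by (rule measurable_restrict_space1)
      hence "(\<lambda>x. h x * classical_partial i \<phi> x) \<in> borel_measurable (lebesgue_on \<Omega>)" using that by measurable
      thus ?thesis using \<Omega>L by (subst (asm) borel_measurable_restrict_space_iff) auto
    qed
    have "(LINT x:\<Omega>|lebesgue. ?g x * classical_partial i \<phi> x) = (LINT x:\<Omega>|lebesgue. Du j x * classical_partial i \<phi> x)"
      unfolding set_lebesgue_integral_def
      by (rule integral_cong_AE, rule m[OF gm], rule m, use W(1)[of j] in \<open>simp add: Lp_loc_def\<close>, use eq in eventually_elim)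
        (auto split: split_indicator)
    also have "\<dots> = - (LINT x:\<Omega>|lebesgue. D2u i j x * \<phi> x)" using W(4)[of i j] \<phi> by (simp add: has_weak_partial_def)
    finally show "(LINT x:\<Omega>|lebesgue. ?g x * classical_partial i \<phi> x) = - (LINT x:\<Omega>|lebesgue. D2u i j x * \<phi> x)" .
  qed
  moreover from this show 2: "has_weak_partial \<Omega> i ?g (weak_partial \<Omega> i ?g)"
    unfolding weak_partial_def[of \<Omega> i ?g] by (rule someI[of "has_weak_partial \<Omega> i ?g"])
  ultimately have eq2: "AE x in lebesgue. x \<in> \<Omega> \<longrightarrow> D2u i j x = weak_partial \<Omega> i ?g x"
    by (intro weak_partial_unique[OF \<Omega>])
  show "weak_partial \<Omega> i ?g \<in> Lp_loc p \<Omega>"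
    by (rule Lp_loc_cong_AE[OF W(3) _ \<Omega>L eq2]) (use 2 in \<open>simp add: has_weak_partial_def Lp_loc_def\<close>)
qed

section \<open>Exterior balls of \<open>C\<^sup>1\<^sup>,\<^sup>1\<close> domains\<close>

text \<open>
  By the mean value theorem the increment is \<open>\<gamma>' p \<bullet> w\<close> for some \<open>p\<close> on the segment, and
  \<open>\<gamma>' p\<close> differs from \<open>\<gamma>' x\<close> by at most \<open>M\<close> times the length of \<open>w\<close>.
\<close>

lemma lipschitz_gradient_lower_bound:
  fixes \<gamma> :: "'a::euclidean_space \<Rightarrow> real"
  assumes "\<And>y. GDERIV \<gamma> y :> \<gamma>' y" "M-lipschitz_on UNIV \<gamma>'"
  shows "\<gamma> x + \<gamma>' x \<bullet> w - M * (norm w)\<^sup>2 \<le> \<gamma> (x + w)"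
proof -
  have line: "((\<lambda>s. x + s *\<^sub>R w) has_derivative (\<lambda>s. s *\<^sub>R w)) (at s)" for s
    by (auto intro!: derivative_eq_intros)
  have der: "((\<lambda>s. \<gamma> (x + s *\<^sub>R w)) has_real_derivative \<gamma>' (x + s *\<^sub>R w) \<bullet> w) (at s)" for s
  proof -
    have "(\<gamma> has_derivative (\<lambda>h. h \<bullet> \<gamma>' (x + s *\<^sub>R w))) (at (x + s *\<^sub>R w))"
      using assms(1) by (simp add: gderiv_def)
    from has_derivative_compose[OF line this] show ?thesis
      by (simp add: has_field_derivative_def mult_commute_abs inner_commute)
  qed
  obtain t where t: "0 < t" "t < 1" "\<gamma> (x + 1 *\<^sub>R w) - \<gamma> (x + 0 *\<^sub>R w) = (1 - 0) * (\<gamma>' (x + t *\<^sub>R w) \<bullet> w)"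
    using MVT2[of 0 1 "\<lambda>s. \<gamma> (x + s *\<^sub>R w)" "\<lambda>s. \<gamma>' (x + s *\<^sub>R w) \<bullet> w"] der by auto
  have "(\<gamma>' x - \<gamma>' (x + t *\<^sub>R w)) \<bullet> w \<le> norm (\<gamma>' x - \<gamma>' (x + t *\<^sub>R w)) * norm w"
    by (rule norm_cauchy_schwarz)
  also have "\<dots> \<le> M * norm w * norm w"
  proof (rule mult_right_mono)
    have "norm (\<gamma>' x - \<gamma>' (x + t *\<^sub>R w)) \<le> M * norm (t *\<^sub>R w)"
      using lipschitz_onD[OF assms(2), of x "x + t *\<^sub>R w"] by (simp add: dist_norm)
    also have "\<dots> \<le> M * norm w"
      using t lipschitz_on_nonneg[OF assms(2)] by (intro mult_left_mono) (auto simp: mult_left_le_one_le)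
    finally show "norm (\<gamma>' x - \<gamma>' (x + t *\<^sub>R w)) \<le> M * norm w" .
  qed simp
  finally show ?thesis using t(3) by (simp add: inner_diff_left power2_eq_square)
qed

text \<open>
  Locally \<open>\<Omega>\<close> is the set where \<open>y \<bullet> \<nu> - \<gamma> (P y)\<close> is positive, with \<open>P\<close> the projection along \<open>\<nu>\<close>.
  The gradient \<open>g\<close> of this function has length at least one and is Lipschitz continuous, so near a
  boundary point \<open>z'\<close> the function is at most \<open>g \<bullet> w + M \<bar>w\<bar>\<^sup>2\<close> with \<open>w = y - z'\<close>. In a small ball
  touching \<open>z'\<close> from the side opposite to \<open>g\<close> the linear term outweighs the quadratic one.
\<close>

lemma C11_local_exterior_ball:
  fixes \<Omega> :: "'a::euclidean_space set"
  assumes "open \<Omega>" "C11_boundary \<Omega>" "z \<in> frontier \<Omega>"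
  shows "\<exists>s>0. \<forall>z' \<in> frontier \<Omega> \<inter> ball z s. \<exists>\<mu>. norm \<mu> = 1 \<and> ball (z' - s *\<^sub>R \<mu>) s \<inter> \<Omega> = {}"
proof -
  obtain r \<nu> \<gamma> \<gamma>' M where r: "r > 0" and \<nu>: "norm \<nu> = 1" and \<gamma>: "\<And>y. GDERIV \<gamma> y :> \<gamma>' y"
    and M: "M-lipschitz_on UNIV \<gamma>'"
    and \<Omega>: "\<Omega> \<inter> ball z r = {y \<in> ball z r. \<gamma> (y - (y \<bullet> \<nu>) *\<^sub>R \<nu>) < y \<bullet> \<nu>}"
    using assms(2,3) unfolding C11_boundary_def by blast
  have M0: "M \<ge> 0" by (rule lipschitz_on_nonneg[OF M])
  have \<nu>\<nu>: "\<nu> \<bullet> \<nu> = 1" using \<nu> by (simp add: dot_square_norm)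
  define P where "P w = w - (w \<bullet> \<nu>) *\<^sub>R \<nu>" for w
  have Padd: "P (v + w) = P v + P w" for v w by (simp add: P_def inner_add_left algebra_simps)
  have Psym: "v \<bullet> P w = P v \<bullet> w" for v w
    by (simp add: P_def inner_diff_left inner_diff_right inner_commute mult.commute)
  have Pnorm: "(norm (P w))\<^sup>2 \<le> (norm w)\<^sup>2" for w
  proof -
    have "(norm (P w))\<^sup>2 = (norm w)\<^sup>2 - (w \<bullet> \<nu>)\<^sup>2"
      unfolding P_def power2_norm_eq_inner
      by (simp add: inner_diff_left inner_diff_right \<nu>\<nu> inner_commute power2_eq_square)
    thus ?thesis by simp
  qed
  have P\<nu>: "P v \<bullet> \<nu> = 0" for v by (simp add: P_def inner_diff_left \<nu>\<nu>)
  \<comment> \<open>The first bound keeps a ball of radius \<open>s\<close> touching \<open>z'\<close> inside \<open>ball z r\<close>; the second lets the linear term dominate.\<close>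
  define s where "s = min (r / 4) (1 / (2 * (M + 1)))"
  have s: "s > 0" "s \<le> r / 4" "s \<le> 1 / (2 * (M + 1))" using r M0 by (auto simp: s_def)
  show ?thesis
  proof (intro exI[of _ s] conjI ballI s(1))
    fix z' assume z': "z' \<in> frontier \<Omega> \<inter> ball z s"
    have z'r: "z' \<in> ball z r" using z' s r by auto
    have "z' \<notin> \<Omega>" using z' assms(1) by (auto simp: frontier_def interior_open)
    hence base: "z' \<bullet> \<nu> \<le> \<gamma> (P z')" using z'r \<Omega> unfolding P_def by force
    define g where "g = \<nu> - P (\<gamma>' (P z'))"
    have g\<nu>: "g \<bullet> \<nu> = 1" by (simp add: g_def inner_diff_left P\<nu> \<nu>\<nu>)
    have g1: "norm g \<ge> 1" using norm_cauchy_schwarz[of g \<nu>] g\<nu> \<nu> by simp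
    define \<mu> where "\<mu> = g /\<^sub>R norm g"
    have "norm g \<noteq> 0" using g1 by linarith
    hence \<mu>: "norm \<mu> = 1" "g = norm g *\<^sub>R \<mu>" by (simp_all add: \<mu>_def)
    have \<mu>\<mu>: "\<mu> \<bullet> \<mu> = 1" using \<mu>(1) by (simp add: dot_square_norm)
    have "y \<notin> \<Omega>" if y: "y \<in> ball (z' - s *\<^sub>R \<mu>) s" for y
    proof -
      define w where "w = y - z'"
      have yw: "y = z' + w" by (simp add: w_def)
      have dw: "norm (w + s *\<^sub>R \<mu>) < s"
        using y by (simp add: dist_norm norm_minus_commute w_def algebra_simps)
      have "(norm (w + s *\<^sub>R \<mu>))\<^sup>2 < s\<^sup>2" using dw by (intro power_strict_mono) auto
      moreover have "(norm (w + s *\<^sub>R \<mu>))\<^sup>2 = (norm w)\<^sup>2 + 2 * s * (w \<bullet> \<mu>) + s\<^sup>2"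
        unfolding power2_norm_eq_inner
        by (simp add: inner_add_left inner_add_right inner_commute power2_eq_square \<mu>\<mu>)
      ultimately have w\<mu>: "(norm w)\<^sup>2 + 2 * s * (w \<bullet> \<mu>) < 0" by simp
      have "norm w \<le> norm (w + s *\<^sub>R \<mu>) + norm (s *\<^sub>R \<mu>)"
        using norm_triangle_ineq4[of "w + s *\<^sub>R \<mu>" "s *\<^sub>R \<mu>"] by simp
      hence "norm w < 2 * s" using dw \<mu>(1) s(1) by simp
      moreover have "dist z y \<le> dist z z' + norm w" unfolding yw
        using norm_triangle_ineq[of "z' - z" w] by (simp add: dist_norm norm_minus_commute algebra_simps)
      ultimately have yr: "y \<in> ball z r" using z' s(2) r by auto
      have "\<gamma> (P z') + \<gamma>' (P z') \<bullet> P w - M * (norm (P w))\<^sup>2 \<le> \<gamma> (P z' + P w)"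
        by (rule lipschitz_gradient_lower_bound[OF \<gamma> M])
      moreover have "M * (norm (P w))\<^sup>2 \<le> M * (norm w)\<^sup>2" by (intro mult_left_mono Pnorm M0)
      moreover have "g \<bullet> w = w \<bullet> \<nu> - \<gamma>' (P z') \<bullet> P w"
      proof -
        have "g \<bullet> w = \<nu> \<bullet> w - P (\<gamma>' (P z')) \<bullet> w" by (simp add: g_def inner_diff_left)
        thus ?thesis by (simp only: Psym inner_commute[of \<nu> w])
      qed
      ultimately have *: "y \<bullet> \<nu> - \<gamma> (P y) \<le> g \<bullet> w + M * (norm w)\<^sup>2"
        using base by (simp add: yw Padd inner_add_left)
      have gw: "g \<bullet> w = norm g * (w \<bullet> \<mu>)" by (subst \<mu>(2)) (simp add: inner_commute)
      have "M + 1 \<le> 1 / (2 * s)" using s(1,3) M0 by (simp add: field_simps)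
      from mult_right_mono[OF this, of "(norm w)\<^sup>2"]
      have "(M + 1) * (norm w)\<^sup>2 \<le> (norm w)\<^sup>2 / (2 * s)" by simp
      moreover have "w \<bullet> \<mu> \<le> - ((norm w)\<^sup>2 / (2 * s))" using w\<mu> s(1) by (simp add: field_simps)
      ultimately have le: "w \<bullet> \<mu> \<le> - ((M + 1) * (norm w)\<^sup>2)" by linarith
      moreover have "0 \<le> (M + 1) * (norm w)\<^sup>2" using M0 by simp
      ultimately have "w \<bullet> \<mu> \<le> 0" by linarith
      from mult_right_mono_neg[OF g1 this] have "g \<bullet> w \<le> - ((M + 1) * (norm w)\<^sup>2)"
        unfolding gw using le by linarith
      hence "y \<bullet> \<nu> - \<gamma> (P y) \<le> - ((M + 1) * (norm w)\<^sup>2) + M * (norm w)\<^sup>2" using * by linarith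
      also have "\<dots> \<le> 0" by (simp add: algebra_simps)
      finally show "y \<notin> \<Omega>" using yr \<Omega> unfolding P_def by force
    qed
    thus "\<exists>\<mu>. norm \<mu> = 1 \<and> ball (z' - s *\<^sub>R \<mu>) s \<inter> \<Omega> = {}" using \<mu>(1) by blast
  qed
qed

lemma exterior_ball_shrink:
  fixes z \<mu> :: "'a::euclidean_space"
  assumes "norm \<mu> = 1" "0 < r" "r \<le> s"
  shows "ball (z - r *\<^sub>R \<mu>) r \<subseteq> ball (z - s *\<^sub>R \<mu>) s"
proof
  fix y assume "y \<in> ball (z - r *\<^sub>R \<mu>) r"
  moreover have "dist (z - s *\<^sub>R \<mu>) (z - r *\<^sub>R \<mu>) = s - r"
    using assms by (simp add: dist_norm flip: scaleR_diff_left)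
  ultimately show "y \<in> ball (z - s *\<^sub>R \<mu>) s"
    using dist_triangle[of "z - s *\<^sub>R \<mu>" y "z - r *\<^sub>R \<mu>"] by simp
qed

text \<open>
  Finitely many of the neighbourhoods from \<open>C11_local_exterior_ball\<close> cover the compact boundary.
\<close>

lemma uniform_exterior_ball:
  fixes \<Omega> :: "'a::euclidean_space set"
  assumes "open \<Omega>" "bounded \<Omega>" "C11_boundary \<Omega>"
  shows "\<exists>r>0. \<forall>z \<in> frontier \<Omega>. \<exists>\<mu>. norm \<mu> = 1 \<and> ball (z - r *\<^sub>R \<mu>) r \<inter> \<Omega> = {}"
proof -
  obtain s where s: "\<And>z. z \<in> frontier \<Omega> \<Longrightarrow> s z > 0"
    "\<And>z z'. z \<in> frontier \<Omega> \<Longrightarrow> z' \<in> frontier \<Omega> \<inter> ball z (s z) \<Longrightarrow> \<exists>\<mu>. norm \<mu> = 1 \<and> ball (z' - s z *\<^sub>R \<mu>) (s z) \<inter> \<Omega> = {}"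
    using bchoice[of "frontier \<Omega>" "\<lambda>z s. s > 0 \<and> (\<forall>z' \<in> frontier \<Omega> \<inter> ball z s. \<exists>\<mu>. norm \<mu> = 1 \<and> ball (z' - s *\<^sub>R \<mu>) s \<inter> \<Omega> = {})"]
      C11_local_exterior_ball[OF assms(1,3)] by blast
  have cpt: "compact (frontier \<Omega>)" using assms(2) by (rule compact_frontier_bounded)
  have cover: "frontier \<Omega> \<subseteq> (\<Union>z\<in>frontier \<Omega>. ball z (s z))" using s(1) by auto
  obtain C where C: "C \<subseteq> frontier \<Omega>" "finite C" "frontier \<Omega> \<subseteq> (\<Union>z\<in>C. ball z (s z))"
    by (rule compactE_image[OF cpt _ cover]) auto
  define r where "r = Min (insert 1 (s ` C))"
  have r: "r > 0" using C s(1) by (auto simp: r_def)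
  have rs: "r \<le> s z" if "z \<in> C" for z using that C(2) by (auto simp: r_def)
  show ?thesis
  proof (intro exI[of _ r] conjI r ballI)
    fix z assume z: "z \<in> frontier \<Omega>"
    then obtain c where c: "c \<in> C" "z \<in> ball c (s c)" using C(3) by blast
    then obtain \<mu> where \<mu>: "norm \<mu> = 1" "ball (z - s c *\<^sub>R \<mu>) (s c) \<inter> \<Omega> = {}" using s(2)[of c z] C(1) z by blast
    thus "\<exists>\<mu>. norm \<mu> = 1 \<and> ball (z - r *\<^sub>R \<mu>) r \<inter> \<Omega> = {}"
      using exterior_ball_shrink[OF \<mu>(1) r rs[OF c(1)], of z] by blast
  qed
qed

text \<open>
  The centres of disjoint balls are at least the sum of the radii apart, which for two balls touching
  at \<open>z\<close> is equality in the triangle inequality.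
\<close>

lemma tangent_balls_aligned:
  fixes \<mu> \<nu> :: "'a::euclidean_space"
  assumes "norm \<mu> = 1" "norm \<nu> = 1" "r > 0" "s > 0"
    and disj: "ball (z - r *\<^sub>R \<mu>) r \<inter> ball (z + s *\<^sub>R \<nu>) s = {}"
  shows "\<mu> = \<nu>"
proof (rule ccontr)
  assume "\<mu> \<noteq> \<nu>"
  let ?p = "z - r *\<^sub>R \<mu>" and ?q = "z + s *\<^sub>R \<nu>"
  have "norm (s *\<^sub>R \<nu> + r *\<^sub>R \<mu>) \<noteq> norm (s *\<^sub>R \<nu>) + norm (r *\<^sub>R \<mu>)"
  proof
    assume "norm (s *\<^sub>R \<nu> + r *\<^sub>R \<mu>) = norm (s *\<^sub>R \<nu>) + norm (r *\<^sub>R \<mu>)"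
    hence "norm (s *\<^sub>R \<nu>) *\<^sub>R (r *\<^sub>R \<mu>) = norm (r *\<^sub>R \<mu>) *\<^sub>R (s *\<^sub>R \<nu>)" by (simp only: norm_triangle_eq)
    hence "(s * r) *\<^sub>R \<mu> = (s * r) *\<^sub>R \<nu>" using assms by (simp add: mult.commute)
    thus False using \<open>\<mu> \<noteq> \<nu>\<close> assms by simp
  qed
  moreover have "norm (s *\<^sub>R \<nu> + r *\<^sub>R \<mu>) \<le> norm (s *\<^sub>R \<nu>) + norm (r *\<^sub>R \<mu>)" by (rule norm_triangle_ineq)
  ultimately have lt: "dist ?p ?q < r + s" using assms by (simp add: dist_norm norm_minus_commute algebra_simps)
  define y where "y = ?p + (r / (r + s)) *\<^sub>R (?q - ?p)"
  have "dist ?p y = r / (r + s) * dist ?p ?q" using assms by (simp add: y_def dist_norm norm_minus_commute)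
  also have "\<dots> < r / (r + s) * (r + s)" using lt assms by (intro mult_strict_left_mono) auto
  finally have 1: "dist ?p y < r" using assms by simp
  have "?q - y = (1 - r / (r + s)) *\<^sub>R (?q - ?p)" by (simp add: y_def algebra_simps)
  also have "1 - r / (r + s) = s / (r + s)" using assms by (simp add: field_simps)
  finally have "dist ?q y = s / (r + s) * dist ?p ?q" using assms by (simp add: dist_norm norm_minus_commute)
  also have "\<dots> < s / (r + s) * (r + s)" using lt assms by (intro mult_strict_left_mono) auto
  finally have "dist ?q y < s" using assms by simp
  thus False using 1 disj by auto
qed

text \<open>
  The ball around \<open>x\<close> inscribed in \<open>\<Omega>\<close> and the exterior ball touch at the boundary point nearest to
  \<open>x\<close>, so their centres and that point are aligned. A point of the exterior ball shifted by \<open>h \<nu>\<close> is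
  at distance at most \<open>h\<close> from the complement of \<open>\<Omega>\<close>.
\<close>

lemma inner_domain_exterior_ball:
  fixes \<Omega> :: "'a::euclidean_space set"
  assumes \<Omega>: "open \<Omega>" "\<Omega> \<noteq> UNIV" and r: "r > 0"
    and ext: "\<And>z. z \<in> frontier \<Omega> \<Longrightarrow> \<exists>\<mu>. norm \<mu> = 1 \<and> ball (z - r *\<^sub>R \<mu>) r \<inter> \<Omega> = {}"
    and h: "h > 0" and x: "x \<in> \<Omega>" "dist_compl \<Omega> x = 2 * h"
  shows "\<exists>\<nu>. norm \<nu> = 1 \<and> {y. h < dist_compl \<Omega> y} \<inter> ball (x - (h + r) *\<^sub>R \<nu>) r = {}"
proof -
  obtain z where zf: "z \<in> frontier \<Omega>" and dz: "dist x z = 2 * h" and inball: "ball x (2 * h) \<subseteq> \<Omega>"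
    using nearest_boundary_point[OF \<Omega> x(1)] unfolding x(2) by blast
  from ext[OF zf] obtain \<mu> where \<mu>: "norm \<mu> = 1" "ball (z - r *\<^sub>R \<mu>) r \<inter> \<Omega> = {}" by blast
  define \<nu> where "\<nu> = (x - z) /\<^sub>R (2 * h)"
  have \<nu>: "norm \<nu> = 1" "x = z + (2 * h) *\<^sub>R \<nu>" using dz h by (auto simp: \<nu>_def dist_norm)
  have "\<mu> = \<nu>"
    by (rule tangent_balls_aligned[OF \<mu>(1) \<nu>(1) r, of "2 * h" z]) (use h inball \<mu>(2) \<nu>(2) in auto)
  have "y \<notin> ball (x - (h + r) *\<^sub>R \<nu>) r" if "h < dist_compl \<Omega> y" for y
  proof
    assume "y \<in> ball (x - (h + r) *\<^sub>R \<nu>) r"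
    moreover have "dist (x - (h + r) *\<^sub>R \<nu>) y = dist (z - r *\<^sub>R \<mu>) (y - h *\<^sub>R \<nu>)"
    proof -
      have "x = z + h *\<^sub>R \<nu> + h *\<^sub>R \<nu>" using \<nu>(2) by (simp only: mult_2 scaleR_left_distrib add.assoc)
      hence "x - (h + r) *\<^sub>R \<nu> - y = z - r *\<^sub>R \<nu> - (y - h *\<^sub>R \<nu>)" by (simp add: scaleR_left_distrib)
      thus ?thesis unfolding \<open>\<mu> = \<nu>\<close> dist_norm by (rule arg_cong)
    qed
    ultimately have "y - h *\<^sub>R \<nu> \<in> - \<Omega>" using \<mu>(2) by auto
    hence "dist_compl \<Omega> y \<le> dist y (y - h *\<^sub>R \<nu>)" unfolding dist_compl_def by (rule infdist_le)
    also have "\<dots> = h" using \<nu>(1) h by (simp add: dist_norm)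
    finally show False using that by simp
  qed
  thus ?thesis using \<nu>(1) by blast
qed

section \<open>Smooth approximation of Sobolev functions\<close>

lemma kernel_integral_cbox:
  fixes U u :: "real ^ 'n \<Rightarrow> real"
  assumes k: "continuous_on UNIV k" "\<And>w. \<epsilon> \<le> norm w \<Longrightarrow> k w = 0" and U: "continuous_on UNIV U" "\<And>y. y \<in> \<Omega> \<Longrightarrow> U y = u y"
    and sub: "cball x \<epsilon> \<subseteq> \<Omega>" "\<Omega> \<subseteq> cbox a b"
  shows "integral (cbox a b) (\<lambda>y. k (x - y) * U y) = (LINT y:\<Omega>|lebesgue. k (x - y) * u y)"
proof -
  have "continuous_on (cbox a b) (\<lambda>y. k (x - y) * U y)"
    by (intro continuous_intros continuous_on_compose2[OF k(1)] continuous_on_subset[OF U(1)]) auto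
  hence "(\<lambda>y. k (x - y) * U y) absolutely_integrable_on cbox a b"
    by (rule absolutely_integrable_continuous)
  hence "integral (cbox a b) (\<lambda>y. k (x - y) * U y) = (LINT y:cbox a b|lebesgue. k (x - y) * U y)"
    using set_lebesgue_integral_eq_integral(2) by metis
  also have "\<dots> = (LINT y:\<Omega>|lebesgue. k (x - y) * u y)"
    unfolding set_lebesgue_integral_def
  proof (rule Bochner_Integration.integral_cong[OF refl])
    fix y
    show "indicator (cbox a b) y *\<^sub>R (k (x - y) * U y) = indicator \<Omega> y *\<^sub>R (k (x - y) * u y)"
    proof (cases "y \<in> cball x \<epsilon>")
      case True
      hence "y \<in> \<Omega>" "y \<in> cbox a b" using sub by blast+
      thus ?thesis using U(2) by simp
    next
      case False
      hence "k (x - y) = 0" by (intro k(2)) (simp add: dist_norm)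
      thus ?thesis by simp
    qed
  qed
  finally show ?thesis .
qed

text \<open>
  Only the kernel is differentiated, so continuity of \<open>U\<close> is enough; symmetry of the second derivative
  is read off from the explicit formula for \<open>ker2\<close>.
\<close>

lemma convolution_C2:
  fixes U :: "real ^ 'n \<Rightarrow> real" and a b :: "real ^ 'n" and r :: real
  assumes U: "continuous_on UNIV U"
  defines "I0 \<equiv> \<lambda>x. integral (cbox a b) (\<lambda>y. ker r (x - y) * U y)"
    and "I1 \<equiv> \<lambda>x. \<chi> i. integral (cbox a b) (\<lambda>y. ker1 r i (x - y) * U y)"
    and "I2 \<equiv> \<lambda>x. \<chi> i j. integral (cbox a b) (\<lambda>y. ker2 r i j (x - y) * U y)"
  shows "(I0 has_derivative (\<lambda>w. I1 x \<bullet> w)) (at x)" "(I1 has_derivative (*v) (I2 x)) (at x)"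
    "continuous_on UNIV I2" "transpose (I2 x) = I2 x"
proof -
  have grad1: "continuous_on UNIV (\<lambda>z. \<chi> i. ker1 r i z)" and grad2: "continuous_on UNIV (\<lambda>z. \<chi> j. ker2 r i j z)" for i :: 'n
    by (intro continuous_on_vec_lambda continuous_ker)+
  have vec_int: "integral (cbox a b) (\<lambda>y. U y *\<^sub>R (\<chi> i. k i (x - y))) = (\<chi> i. integral (cbox a b) (\<lambda>y. k i (x - y) * U y))"
    if "continuous_on UNIV (\<lambda>z. \<chi> i. k i z)" for k :: "'n \<Rightarrow> real ^ 'n \<Rightarrow> real" and x
  proof -
    have int: "(\<lambda>y. U y *\<^sub>R (\<chi> i. k i (x - y))) integrable_on cbox a b"
      by (intro integrable_continuous continuous_intros continuous_on_compose2[OF that, of _ "\<lambda>y. x - y"] continuous_on_subset[OF U]) auto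
    show ?thesis
      using integral_component_eq_cart[OF int] by (simp add: vec_eq_iff mult.commute)
  qed
  show "(I0 has_derivative (\<lambda>w. I1 x \<bullet> w)) (at x)"
    unfolding I0_def I1_def vec_int[OF grad1, symmetric] by (rule convolution_derivative[OF ker_derivative grad1 U])
  have comp: "((\<lambda>x. I1 x $ i) has_derivative (\<lambda>w. I2 x $ i \<bullet> w)) (at x)" for i
    using convolution_derivative[OF ker1_derivative[of r i] grad2 U, where a = a and b = b and x = x]
    unfolding vec_int[OF grad2] I1_def I2_def by simp
  show "(I1 has_derivative (*v) (I2 x)) (at x)"
  proof (subst has_derivative_componentwise_within, rule ballI)
    fix v :: "real ^ 'n" assume "v \<in> Basis"
    then obtain k where v: "v = axis k 1" by (auto simp: Basis_vec_def)
    have "(\<lambda>w. (I2 x *v w) \<bullet> v) = (\<lambda>w. I2 x $ k \<bullet> w)"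
      by (simp add: v inner_axis fun_eq_iff matrix_vector_mul_component)
    thus "((\<lambda>x. I1 x \<bullet> v) has_derivative (\<lambda>w. (I2 x *v w) \<bullet> v)) (at x)"
      using comp[of k] by (simp add: v inner_axis)
  qed
  show "continuous_on UNIV I2"
    unfolding I2_def by (intro continuous_on_vec_lambda continuous_on_convolution continuous_ker U)
  show "transpose (I2 x) = I2 x"
    unfolding I2_def transpose_def vec_eq_iff by (simp add: ker2_sym[of r])
qed

lemma uniform_mollification:
  fixes U :: "real ^ 'n \<Rightarrow> real"
  assumes U: "continuous_on UNIV U" and K: "compact K" and \<epsilon>1: "\<epsilon>1 > 0" and e: "e > 0"
  shows "\<forall>\<^sub>F \<epsilon> in at_right 0. \<forall>x. cball x \<epsilon>1 \<subseteq> K \<longrightarrow> \<bar>mollify \<epsilon> U x - U x\<bar> \<le> e"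
proof -
  have [measurable]: "U \<in> borel_measurable borel" by (rule borel_measurable_continuous_onI[OF U])
  have "uniformly_continuous_on K U"
    by (intro compact_uniformly_continuous K continuous_on_subset[OF U]) auto
  then obtain d where d: "d > 0" "\<And>x y. x \<in> K \<Longrightarrow> y \<in> K \<Longrightarrow> dist y x < d \<Longrightarrow> dist (U y) (U x) < e"
    unfolding uniformly_continuous_on_def using e by blast
  have "\<bar>mollify \<epsilon> U x - U x\<bar> \<le> e" if \<epsilon>: "0 < \<epsilon>" "\<epsilon> < min d \<epsilon>1" and x: "cball x \<epsilon>1 \<subseteq> K" for \<epsilon> x
  proof -
    have "ennreal (\<bar>mollify \<epsilon> U x - U x\<bar> ^ 1) \<le> (\<integral>\<^sup>+y. ennreal (mollifier \<epsilon> (x - y) * \<bar>U y - U x\<bar> ^ 1) \<partial>lborel)"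
      by (rule mollification_power_le) (use \<epsilon> in auto)
    also have "\<dots> \<le> (\<integral>\<^sup>+y. ennreal e * ennreal (mollifier \<epsilon> (x - y)) \<partial>lborel)"
    proof (rule nn_integral_mono)
      fix y
      have "mollifier \<epsilon> (x - y) * \<bar>U y - U x\<bar> \<le> e * mollifier \<epsilon> (x - y)"
      proof (cases "\<epsilon> \<le> norm (x - y)")
        case False
        have "x \<in> cball x \<epsilon>1" "y \<in> cball x \<epsilon>1" "dist y x < d" using False \<epsilon> by (auto simp: dist_norm norm_minus_commute)
        moreover from this x have "x \<in> K" "y \<in> K" by blast+
        ultimately have "\<bar>U y - U x\<bar> \<le> e" using d(2)[of x y] by (simp add: dist_real_def)
        thus ?thesis using mult_left_mono[OF _ mollifier_nonneg[OF \<epsilon>(1)], of "\<bar>U y - U x\<bar>" e "x - y"] by (simp add: mult.commute)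
      qed (use \<epsilon> in \<open>simp add: mollifier_eq_0\<close>)
      thus "ennreal (mollifier \<epsilon> (x - y) * \<bar>U y - U x\<bar> ^ 1) \<le> ennreal e * ennreal (mollifier \<epsilon> (x - y))"
        using e by (simp add: ennreal_leI flip: ennreal_mult')
    qed
    also have "\<dots> = ennreal e" using \<epsilon> by (simp add: nn_integral_cmult nn_integral_mollifier_reflect)
    finally show ?thesis using e by (simp add: ennreal_le_iff)
  qed
  thus ?thesis
    unfolding eventually_at_right_field using d(1) \<epsilon>1 by (intro exI[of _ "min d \<epsilon>1"]) auto
qed

text \<open>
  Mollify a continuous extension of \<open>u\<close>. On \<open>D\<close>, and for a mollification radius below \<open>h / 2\<close>, the
  kernel only sees values inside \<open>\<Omega>\<close>, and there its derivatives can be moved onto \<open>u\<close>: the derivatives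
  of the mollification are the mollifications of the weak derivatives.
\<close>

lemma smooth_approximation:
  fixes \<Omega> :: "(real ^ 'n) set"
  assumes \<Omega>: "open \<Omega>" "bounded \<Omega>" and u: "u \<in> W2_loc (real p) \<Omega>" "continuous_on (closure \<Omega>) u" and p: "p \<ge> 1"
    and h: "h > 0" and e: "e > 0"
  defines "D \<equiv> {y. h < dist_compl \<Omega> y}"
  shows "\<exists>v Dv D2v. (\<forall>y. (v has_derivative (\<lambda>w. Dv y \<bullet> w)) (at y)) \<and> (\<forall>y. (Dv has_derivative (*v) (D2v y)) (at y)) \<and>
    continuous_on UNIV D2v \<and> (\<forall>y. transpose (D2v y) = D2v y) \<and>
    (\<forall>y\<in>closure D. \<bar>v y - u y\<bar> \<le> e) \<and>
    (\<forall>j. (\<integral>\<^sup>+y\<in>D. ennreal (\<bar>Dv y $ j - weak_partial \<Omega> j u y\<bar> ^ p) \<partial>lebesgue) \<le> ennreal e) \<and>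
    (\<forall>i j. (\<integral>\<^sup>+y\<in>D. ennreal (\<bar>D2v y $ i $ j - weak_partial \<Omega> i (weak_partial \<Omega> j u) y\<bar> ^ p) \<partial>lebesgue) \<le> ennreal e)"
proof -
  let ?g = "\<lambda>j. weak_partial \<Omega> j u" and ?H = "\<lambda>i j. weak_partial \<Omega> i (weak_partial \<Omega> j u)"
  note W = W2_loc_weak_partials[OF \<Omega> u(1)]
  define K where "K = {y. h / 2 \<le> dist_compl \<Omega> y}"
  have K: "compact K" "K \<subseteq> \<Omega>" unfolding K_def using inner_sets[OF \<Omega> h] by auto
  have D: "open D" "D \<subseteq> \<Omega>" "closure D \<subseteq> {y. h \<le> dist_compl \<Omega> y}" unfolding D_def using inner_sets[OF \<Omega> h] by auto
  have ball_cl: "cball x (h / 2) \<subseteq> K" if "x \<in> closure D" for x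
    unfolding K_def using inner_sets(6)[OF \<Omega> h] D(3) that by blast
  have ball: "cball x (h / 2) \<subseteq> K" if "x \<in> D" for x using ball_cl that closure_subset by blast
  have \<Omega>L: "\<Omega> \<in> sets lebesgue" and DB: "D \<in> sets borel" using \<Omega>(1) D(1) by auto
  obtain U where U: "continuous_on UNIV U" "\<And>y. y \<in> closure \<Omega> \<Longrightarrow> U y = u y"
    by (rule Tietze_unbounded[of "closure \<Omega>" u UNIV]) (use u(2) in auto)
  have U\<Omega>: "U y = u y" if "y \<in> \<Omega>" for y using U(2) closure_subset that by blast
  obtain a b where ab: "\<Omega> \<subseteq> cbox a b" using bounded_subset_cbox_symmetric[OF \<Omega>(2)] by metis
  have h2: "h / 2 > 0" using h by simp
  have ev_moll: "\<forall>\<^sub>F \<epsilon> in at_right 0. (\<integral>\<^sup>+x\<in>D. ennreal (\<bar>mollify_on \<Omega> \<epsilon> g x - g x\<bar> ^ p) \<partial>lebesgue) \<le> ennreal e"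
    if "g \<in> Lp_loc (real p) \<Omega>" for g
    using local_mollification_converges[OF that p K \<Omega>L DB ball h2 e] unfolding eventually_at_right_field by blast
  have ev0: "\<forall>\<^sub>F \<epsilon> in at_right 0. 0 < \<epsilon> \<and> \<epsilon> < h / 2"
    by (rule eventually_mono[OF eventually_at_right_real[OF h2]]) auto
  have "\<forall>\<^sub>F \<epsilon> in at_right 0. (0 < \<epsilon> \<and> \<epsilon> < h / 2) \<and>
      (\<forall>x. cball x (h / 2) \<subseteq> K \<longrightarrow> \<bar>mollify \<epsilon> U x - U x\<bar> \<le> e) \<and>
      (\<forall>j. (\<integral>\<^sup>+x\<in>D. ennreal (\<bar>mollify_on \<Omega> \<epsilon> (?g j) x - ?g j x\<bar> ^ p) \<partial>lebesgue) \<le> ennreal e) \<and>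
      (\<forall>i j. (\<integral>\<^sup>+x\<in>D. ennreal (\<bar>mollify_on \<Omega> \<epsilon> (?H i j) x - ?H i j x\<bar> ^ p) \<partial>lebesgue) \<le> ennreal e)"
    by (intro eventually_conj[OF ev0] eventually_conj eventually_all_finite allI ev_moll W uniform_mollification U K e h2)
  then obtain \<epsilon> where \<epsilon>: "0 < \<epsilon>" "\<epsilon> < h / 2"
    and uni: "\<And>x. cball x (h / 2) \<subseteq> K \<Longrightarrow> \<bar>mollify \<epsilon> U x - U x\<bar> \<le> e"
    and Lg: "\<And>j. (\<integral>\<^sup>+x\<in>D. ennreal (\<bar>mollify_on \<Omega> \<epsilon> (?g j) x - ?g j x\<bar> ^ p) \<partial>lebesgue) \<le> ennreal e"
    and LH: "\<And>i j. (\<integral>\<^sup>+x\<in>D. ennreal (\<bar>mollify_on \<Omega> \<epsilon> (?H i j) x - ?H i j x\<bar> ^ p) \<partial>lebesgue) \<le> ennreal e"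
    using eventually_happens'[OF trivial_limit_at_right_real] by blast
  define C where "C = ker_mass TYPE('n) \<epsilon>"
  define r where "r = \<epsilon>\<^sup>2"
  define I0 where "I0 x = integral (cbox a b) (\<lambda>y. ker r (x - y) * U y)" for x
  define I1 where "I1 x = (\<chi> i. integral (cbox a b) (\<lambda>y. ker1 r i (x - y) * U y))" for x
  define I2 where "I2 x = (\<chi> i j. integral (cbox a b) (\<lambda>y. ker2 r i j (x - y) * U y))" for x
  have C2: "(I0 has_derivative (\<lambda>w. I1 x \<bullet> w)) (at x)" "(I1 has_derivative (*v) (I2 x)) (at x)"
    "continuous_on UNIV I2" "transpose (I2 x) = I2 x" for x
    using convolution_C2(1)[OF U(1), where a = a and b = b and r = r and x = x]
      convolution_C2(2)[OF U(1), where a = a and b = b and r = r and x = x]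
      convolution_C2(3)[OF U(1), where a = a and b = b and r = r]
      convolution_C2(4)[OF U(1), where a = a and b = b and r = r and x = x]
    unfolding I0_def[abs_def] I1_def[abs_def] I2_def[abs_def] .
  have ball\<Omega>: "cball x \<epsilon> \<subseteq> \<Omega>" if "cball x (h / 2) \<subseteq> K" for x
    using that K(2) \<epsilon> subset_cball[of \<epsilon> "h / 2" x] by auto
  have rep0: "I0 x / C = mollify \<epsilon> U x" if "cball x (h / 2) \<subseteq> K" for x
  proof -
    have um: "u \<in> borel_measurable (lebesgue_on \<Omega>)"
      by (rule continuous_imp_measurable_on_sets_lebesgue[OF continuous_on_subset[OF u(2) closure_subset] \<Omega>L])
    have "I0 x = (LINT y:\<Omega>|lebesgue. ker r (x - y) * u y)"
      unfolding I0_def by (rule kernel_integral_cbox[OF continuous_ker(1) _ U(1) U\<Omega> ball\<Omega>[OF that] ab])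
        (use \<epsilon> ker_eq_0 in \<open>auto simp: r_def\<close>)
    also have "\<dots> = (LINT y|lborel. ker r (x - y) * U y)"
      unfolding r_def by (rule ker_integral_representative[where K = \<Omega>])
        (use U(1) U\<Omega> \<epsilon> ball\<Omega>[OF that] um \<Omega>L in \<open>auto intro: borel_measurable_continuous_onI\<close>)
    finally show ?thesis by (simp add: mollifier_def C_def r_def)
  qed
  have rep1: "I1 x $ j = (LINT y:\<Omega>|lebesgue. ker r (x - y) * ?g j y)" if "x \<in> D" for x j
  proof -
    have "I1 x $ j = (LINT y:\<Omega>|lebesgue. ker1 r j (x - y) * u y)"
      unfolding I1_def vec_lambda_beta
      by (rule kernel_integral_cbox[OF continuous_ker(2) _ U(1) U\<Omega> ball\<Omega>[OF ball[OF that]] ab])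
        (use \<epsilon> ker_eq_0 in \<open>auto simp: r_def\<close>)
    also have "\<dots> = (LINT y:\<Omega>|lebesgue. ker r (x - y) * ?g j y)"
      unfolding r_def by (rule ker_weak_partial(1)[OF W(1) \<epsilon>(1) ball\<Omega>[OF ball[OF that]]])
    finally show ?thesis .
  qed
  have rep2: "I2 x $ i $ j = (LINT y:\<Omega>|lebesgue. ker r (x - y) * ?H i j y)" if "x \<in> D" for x i j
  proof -
    note b = ball\<Omega>[OF ball[OF that]]
    have "I2 x $ i $ j = (LINT y:\<Omega>|lebesgue. ker2 r i j (x - y) * u y)"
      unfolding I2_def vec_lambda_beta
      by (rule kernel_integral_cbox[OF continuous_ker(3) _ U(1) U\<Omega> b ab])
        (use \<epsilon> ker_eq_0 in \<open>auto simp: r_def\<close>)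
    also have "\<dots> = (LINT y:\<Omega>|lebesgue. ker1 r i (x - y) * ?g j y)"
      unfolding r_def by (rule ker_weak_partial(2)[OF W(1) \<epsilon>(1) b])
    also have "\<dots> = (LINT y:\<Omega>|lebesgue. ker r (x - y) * ?H i j y)"
      unfolding r_def by (rule ker_weak_partial(1)[OF W(2) \<epsilon>(1) b])
    finally show ?thesis .
  qed
  show ?thesis
  proof (intro exI conjI allI ballI)
    show "((\<lambda>x. I0 x / C) has_derivative (\<lambda>w. (I1 y /\<^sub>R C) \<bullet> w)) (at y)" for y
      using has_derivative_mult_right[OF C2(1)[of y], of "1 / C"] by (simp add: divide_inverse_commute)
    show "((\<lambda>x. I1 x /\<^sub>R C) has_derivative (*v) (I2 y /\<^sub>R C)) (at y)" for y
      using has_derivative_scaleR_right[OF C2(2)[of y], of "inverse C"] by (simp add: scaleR_matrix_vector_assoc)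
    show "continuous_on UNIV (\<lambda>y. I2 y /\<^sub>R C)" by (intro continuous_intros C2(3))
    show "transpose (I2 y /\<^sub>R C) = I2 y /\<^sub>R C" for y
      using C2(4)[of y] unfolding transpose_def vec_eq_iff by simp
    show "\<bar>I0 y / C - u y\<bar> \<le> e" if "y \<in> closure D" for y
      using uni[OF ball_cl[OF that]] rep0[OF ball_cl[OF that]] U(2)[of y] closure_mono[OF D(2)] that by auto
    show "(\<integral>\<^sup>+y\<in>D. ennreal (\<bar>(I1 y /\<^sub>R C) $ j - ?g j y\<bar> ^ p) \<partial>lebesgue) \<le> ennreal e" for j
    proof -
      have "(\<integral>\<^sup>+y\<in>D. ennreal (\<bar>(I1 y /\<^sub>R C) $ j - ?g j y\<bar> ^ p) \<partial>lebesgue) =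
        (\<integral>\<^sup>+x\<in>D. ennreal (\<bar>mollify_on \<Omega> \<epsilon> (?g j) x - ?g j x\<bar> ^ p) \<partial>lebesgue)"
        by (rule nn_integral_cong) (auto simp: rep1 r_def C_def divide_inverse_commute split: split_indicator)
      thus ?thesis using Lg[of j] by simp
    qed
    show "(\<integral>\<^sup>+y\<in>D. ennreal (\<bar>(I2 y /\<^sub>R C) $ i $ j - ?H i j y\<bar> ^ p) \<partial>lebesgue) \<le> ennreal e" for i j
    proof -
      have "(\<integral>\<^sup>+y\<in>D. ennreal (\<bar>(I2 y /\<^sub>R C) $ i $ j - ?H i j y\<bar> ^ p) \<partial>lebesgue) =
        (\<integral>\<^sup>+x\<in>D. ennreal (\<bar>mollify_on \<Omega> \<epsilon> (?H i j) x - ?H i j x\<bar> ^ p) \<partial>lebesgue)"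
        by (rule nn_integral_cong) (auto simp: rep2 r_def C_def divide_inverse_commute split: split_indicator)
      thus ?thesis using LH[of i j] by simp
    qed
  qed
qed

section \<open>The exterior ball estimate for Sobolev functions\<close>

lemma power_sum_le:
  fixes a :: "'k \<Rightarrow> real"
  assumes "finite T" "\<And>k. k \<in> T \<Longrightarrow> a k \<ge> 0" "p \<ge> 1"
  shows "(\<Sum>k\<in>T. a k) ^ p \<le> real (card T) ^ p * (\<Sum>k\<in>T. a k ^ p)"
proof (cases "T = {}")
  case False
  have "Max (a ` T) \<in> a ` T" using False assms(1) by (intro Max_in) auto
  then obtain k where k: "k \<in> T" "Max (a ` T) = a k" by auto
  have "(\<Sum>k\<in>T. a k) \<le> real (card T) * a k"
    by (rule sum_bounded_above) (use assms(1) k(2) in \<open>metis Max_ge finite_imageI imageI\<close>)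
  hence "(\<Sum>k\<in>T. a k) ^ p \<le> (real (card T) * a k) ^ p" by (intro power_mono sum_nonneg assms)
  also have "\<dots> = real (card T) ^ p * a k ^ p" by (simp add: power_mult_distrib)
  finally have "(\<Sum>k\<in>T. a k) ^ p \<le> real (card T) ^ p * a k ^ p" .
  also have "\<dots> \<le> real (card T) ^ p * (\<Sum>k\<in>T. a k ^ p)"
    by (intro mult_left_mono member_le_sum[OF k(1)]) (use assms in auto)
  finally show ?thesis .
qed (use assms in \<open>simp add: zero_power\<close>)

lemma nn_integral_power_sum_le:
  fixes X :: "'k::finite \<Rightarrow> 'a::euclidean_space \<Rightarrow> real"
  assumes D: "D \<in> sets lebesgue" and X: "\<And>k. X k \<in> borel_measurable (lebesgue_on D)"
    and e: "\<And>k. (\<integral>\<^sup>+y\<in>D. ennreal (\<bar>X k y\<bar> ^ p) \<partial>lebesgue) \<le> ennreal e" "e \<ge> 0" and p: "p \<ge> 1"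
  shows "(\<integral>\<^sup>+y\<in>D. ennreal ((\<Sum>k\<in>UNIV. \<bar>X k y\<bar>) ^ p) \<partial>lebesgue) \<le> ennreal (real CARD('k) ^ p * (real CARD('k) * e))"
proof -
  have m: "(\<lambda>y. ennreal (\<bar>X k y\<bar> ^ p) * indicator D y) \<in> borel_measurable lebesgue" for k
    by (rule measurable_times_indicator[OF _ D]) (use X[of k] in measurable)
  have "(\<integral>\<^sup>+y\<in>D. ennreal ((\<Sum>k\<in>UNIV. \<bar>X k y\<bar>) ^ p) \<partial>lebesgue) \<le>
    (\<integral>\<^sup>+y. ennreal (real CARD('k) ^ p) * (\<Sum>k\<in>UNIV. ennreal (\<bar>X k y\<bar> ^ p) * indicator D y) \<partial>lebesgue)"
  proof (rule nn_integral_mono)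
    fix y
    show "ennreal ((\<Sum>k\<in>UNIV. \<bar>X k y\<bar>) ^ p) * indicator D y \<le> ennreal (real CARD('k) ^ p) * (\<Sum>k\<in>UNIV. ennreal (\<bar>X k y\<bar> ^ p) * indicator D y)"
    proof (cases "y \<in> D")
      case True
      have "ennreal ((\<Sum>k\<in>UNIV. \<bar>X k y\<bar>) ^ p) \<le> ennreal (real CARD('k) ^ p * (\<Sum>k\<in>UNIV. \<bar>X k y\<bar> ^ p))"
        by (intro ennreal_leI power_sum_le p) auto
      also have "\<dots> = ennreal (real CARD('k) ^ p) * ennreal (\<Sum>k\<in>UNIV. \<bar>X k y\<bar> ^ p)"
        by (rule ennreal_mult') simp
      also have "ennreal (\<Sum>k\<in>UNIV. \<bar>X k y\<bar> ^ p) = (\<Sum>k\<in>UNIV. ennreal (\<bar>X k y\<bar> ^ p))"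
        by (rule sum_ennreal[symmetric]) simp
      finally show ?thesis using True by simp
    qed simp
  qed
  also have "\<dots> = ennreal (real CARD('k) ^ p) * (\<Sum>k\<in>UNIV. (\<integral>\<^sup>+y\<in>D. ennreal (\<bar>X k y\<bar> ^ p) \<partial>lebesgue))"
    by (subst nn_integral_cmult[OF borel_measurable_sum[OF m]], subst nn_integral_sum[OF m]) (rule refl)
  also have "\<dots> \<le> ennreal (real CARD('k) ^ p) * (\<Sum>k\<in>(UNIV :: 'k set). ennreal e)"
    by (intro mult_left_mono sum_mono e) auto
  also have "(\<Sum>k\<in>(UNIV :: 'k set). ennreal e) = ennreal (real CARD('k) * e)"
    by (simp add: ennreal_mult' ennreal_of_nat_eq_real_of_nat)
  also have "ennreal (real CARD('k) ^ p) * ennreal (real CARD('k) * e) = ennreal (real CARD('k) ^ p * (real CARD('k) * e))"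
    by (rule ennreal_mult'[symmetric]) simp
  finally show ?thesis .
qed

text \<open>
  The index type \<open>('n \<times> 'n) + 'n option\<close> will enumerate the errors in the second derivatives, the first
  derivatives and the function itself, so that all of them are estimated in one sum.
\<close>

lemma sum_UNIV_index:
  fixes F :: "'a::finite + 'b::finite option \<Rightarrow> real"
  shows "(\<Sum>k\<in>UNIV. F k) = (\<Sum>a\<in>UNIV. F (Inl a)) + ((\<Sum>b\<in>UNIV. F (Inr (Some b))) + F (Inr None))"
proof -
  have "(\<Sum>k\<in>UNIV. F k) = (\<Sum>a\<in>UNIV. F (Inl a)) + (\<Sum>b\<in>UNIV. F (Inr b))"
    unfolding UNIV_Plus_UNIV[symmetric] by (subst sum.Plus) (auto simp: comp_def)
  also have "(\<Sum>b\<in>UNIV. F (Inr b)) = F (Inr None) + (\<Sum>b\<in>UNIV. F (Inr (Some b)))"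
    unfolding UNIV_option_conv by (subst sum.insert) (auto simp: sum.reindex)
  finally show ?thesis by simp
qed

lemma abs_operator_le:
  fixes A B :: "real ^ 'n ^ 'n" and b w :: "real ^ 'n" and M :: real
  assumes "\<And>i j. \<bar>A $ i $ j\<bar> \<le> M" "\<And>i. \<bar>b $ i\<bar> \<le> M" "\<bar>c\<bar> \<le> M"
  shows "\<bar>contract A B + b \<bullet> w - c * s\<bar> \<le> M * ((\<Sum>k\<in>UNIV. \<bar>B $ fst k $ snd k\<bar>) + ((\<Sum>j\<in>UNIV. \<bar>w $ j\<bar>) + \<bar>s\<bar>))"
proof -
  have 1: "\<bar>contract A B\<bar> \<le> M * (\<Sum>k\<in>UNIV. \<bar>B $ fst k $ snd k\<bar>)"
  proof -
    have "contract A B = (\<Sum>k\<in>UNIV. A $ fst k $ snd k * B $ fst k $ snd k)"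
      unfolding contract_def by (simp add: sum.cartesian_product case_prod_beta flip: UNIV_Times_UNIV)
    also have "\<bar>\<dots>\<bar> \<le> (\<Sum>k\<in>UNIV. \<bar>A $ fst k $ snd k * B $ fst k $ snd k\<bar>)" by (rule sum_abs)
    also have "\<dots> \<le> (\<Sum>k\<in>UNIV. M * \<bar>B $ fst k $ snd k\<bar>)"
      by (rule sum_mono) (use assms in \<open>auto simp: abs_mult intro: mult_right_mono\<close>)
    finally show ?thesis by (simp add: sum_distrib_left)
  qed
  have 2: "\<bar>b \<bullet> w\<bar> \<le> M * (\<Sum>j\<in>UNIV. \<bar>w $ j\<bar>)"
  proof -
    have "\<bar>b \<bullet> w\<bar> \<le> (\<Sum>j\<in>UNIV. \<bar>b $ j * w $ j\<bar>)" unfolding inner_vec_def by (simp add: sum_abs)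
    also have "\<dots> \<le> (\<Sum>j\<in>UNIV. M * \<bar>w $ j\<bar>)"
      by (rule sum_mono) (use assms in \<open>auto simp: abs_mult intro: mult_right_mono\<close>)
    finally show ?thesis by (simp add: sum_distrib_left)
  qed
  have 3: "\<bar>c * s\<bar> \<le> M * \<bar>s\<bar>" using assms(3) by (simp add: abs_mult mult_right_mono)
  show ?thesis using 1 2 3 by (simp add: distrib_left)
qed

lemma negp_nonneg: "negp t \<ge> 0" by (simp add: negp_def)

lemma negp_lower: "- negp t \<le> t" by (cases "0 \<le> t") (simp_all add: negp_def)

lemma posp_nonneg: "posp t \<ge> 0" by (cases "0 \<le> t") (simp_all add: posp_def)

lemma posp_upper: "t \<le> posp t" by (cases "0 \<le> t") (simp_all add: posp_def)

lemma coeff_conditions_bounds: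
  assumes "coeff_conditions \<delta> K a b c"
  shows "quad (a y) l \<le> inverse \<delta> * (norm l)\<^sup>2" "\<delta> * (norm l)\<^sup>2 \<le> quad (a y) l" "norm (b y) \<le> K" "0 \<le> c y"
    "transpose (a y) = a y" "a \<in> borel_measurable lebesgue" "b \<in> borel_measurable lebesgue" "c \<in> borel_measurable lebesgue"
    "bounded (range c)"
  using assms by (auto simp: coeff_conditions_def quad_def)

lemma coefficient_entry_bound:
  fixes A :: "real ^ 'n ^ 'n"
  assumes "\<delta> > 0" "transpose A = A" "\<And>l. \<delta> * (norm l)\<^sup>2 \<le> quad A l" "\<And>l. quad A l \<le> inverse \<delta> * (norm l)\<^sup>2"
  shows "\<bar>A $ i $ j\<bar> \<le> real CARD('n) * inverse \<delta>"
proof -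
  have "quad A l \<ge> 0" for l using assms(3)[of l] assms(1) by (meson less_imp_le mult_nonneg_nonneg order_trans zero_le_power2)
  hence "\<bar>A $ i $ j\<bar> \<le> trace A" by (rule psd_entry_le_trace[OF assms(2)])
  also have "\<dots> \<le> (\<Sum>i\<in>(UNIV :: 'n set). inverse \<delta>)"
    unfolding trace_def
  proof (rule sum_mono)
    fix i
    show "A $ i $ i \<le> inverse \<delta>"
      using assms(4)[of "axis i 1"] by (simp add: quad_eq_inner matrix_vector_mult_basis column_def inner_axis')
  qed
  finally show ?thesis by simp
qed

lemma measurable_entry:
  fixes a :: "'x \<Rightarrow> ('b::euclidean_space) ^ 'n"
  assumes "a \<in> borel_measurable M"
  shows "(\<lambda>x. a x $ i) \<in> borel_measurable M"
proof -
  have "(\<lambda>v :: 'b ^ 'n. v $ i) \<in> borel_measurable borel"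
    by (intro borel_measurable_continuous_onI continuous_intros)
  from measurable_compose[OF assms this] show ?thesis .
qed

lemma elliptic_op_eq:
  "elliptic_op \<Omega> a b c u y = contract (a y) (\<chi> i j. weak_partial \<Omega> i (weak_partial \<Omega> j u) y)
     + b y \<bullet> (\<chi> j. weak_partial \<Omega> j u y) - c y * u y"
  by (simp add: elliptic_op_def contract_def inner_vec_def)

lemma elliptic_op_measurable:
  fixes \<Omega> :: "(real ^ 'n) set"
  assumes \<Omega>: "open \<Omega>" "bounded \<Omega>" and coef: "coeff_conditions \<delta> K a b c"
    and u: "u \<in> W2_loc p \<Omega>" "continuous_on (closure \<Omega>) u"
  shows "elliptic_op \<Omega> a b c u \<in> borel_measurable (lebesgue_on \<Omega>)"
proof -
  note W = W2_loc_weak_partials[OF \<Omega> u(1)] and co = coeff_conditions_bounds[OF coef]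
  have gm: "weak_partial \<Omega> j u \<in> borel_measurable (lebesgue_on \<Omega>)"
    and Hm: "weak_partial \<Omega> i (weak_partial \<Omega> j u) \<in> borel_measurable (lebesgue_on \<Omega>)" for i j
    using W(3)[of j] W(4)[of i j] by (auto simp: Lp_loc_def)
  have um: "u \<in> borel_measurable (lebesgue_on \<Omega>)"
    by (rule continuous_imp_measurable_on_sets_lebesgue[OF continuous_on_subset[OF u(2) closure_subset]]) (use \<Omega> in auto)
  have "(\<lambda>y. a y $ i $ j) \<in> borel_measurable (lebesgue_on \<Omega>)" "(\<lambda>y. b y $ i) \<in> borel_measurable (lebesgue_on \<Omega>)"
    "c \<in> borel_measurable (lebesgue_on \<Omega>)" for i j
    by (intro measurable_restrict_space1 measurable_entry co)+
  thus ?thesis unfolding elliptic_op_def[abs_def]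
    by (intro borel_measurable_diff borel_measurable_add borel_measurable_sum borel_measurable_times gm Hm um) auto
qed

lemma limit_power_bound:
  fixes X B r C :: real
  assumes "X > 0" "\<And>e. 0 < e \<Longrightarrow> e \<le> 1 \<Longrightarrow> 2 * e < X \<Longrightarrow> (X - 2 * e) ^ n \<le> B * (r + C * e)"
  shows "X ^ n \<le> B * r"
proof -
  have "((\<lambda>e. B * (r + C * e) - (X - 2 * e) ^ n) \<longlongrightarrow> B * (r + C * 0) - (X - 2 * 0) ^ n) (at_right 0)"
    by (intro tendsto_intros)
  moreover have "\<forall>\<^sub>F e in at_right 0. 0 \<le> B * (r + C * e) - (X - 2 * e) ^ n"
  proof (rule eventually_mono[OF eventually_at_right_real[of 0 "min 1 (X / 2)"]])
    fix e assume "e \<in> {0<..<min 1 (X / 2)}"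
    thus "0 \<le> B * (r + C * e) - (X - 2 * e) ^ n" using assms(2)[of e] by auto
  qed (use assms in auto)
  ultimately have "0 \<le> B * (r + C * 0) - (X - 2 * 0) ^ n"
    by (rule tendsto_lowerbound) simp
  thus ?thesis by simp
qed

text \<open>
  Let \<open>v\<close> be a smooth function close to \<open>u\<close>. Since the coefficients are bounded by a constant \<open>M\<close>,
  \<open>\<bar>Lv - Lu\<bar>\<close> is at most \<open>E\<close>, which is \<open>M\<close> times the sum of the errors in all derivatives and is
  small in \<open>L\<^sub>d(D)\<close>. The smooth estimate applies to \<open>v\<close> with \<open>f + E\<close> in place of \<open>f\<close>, and
  \<open>(f + E)\<^sup>d \<le> 3\<^sup>d (f\<^sup>d + E\<^sup>d)\<close>. The factor \<open>3\<^sup>d\<close> survives the passage to the limit but only changes the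
  constant.
\<close>

lemma W2_exterior_ball_estimate:
  fixes \<Omega> :: "(real ^ 'n) set"
  assumes N: "smooth_estimate TYPE(real ^ 'n) r0 R1 \<delta> K N" and "N > 0" "\<delta> > 0" "K > 0"
    and \<Omega>: "open \<Omega>" "bounded \<Omega>" and coef: "coeff_conditions \<delta> K a b c"
    and u: "u \<in> W2_loc (real CARD('n)) \<Omega>" "continuous_on (closure \<Omega>) u"
    and h: "0 < h" "h \<le> R1" and x: "h < dist_compl \<Omega> x" and R1: "\<Omega> \<subseteq> cball x R1"
    and \<nu>: "norm \<nu> = 1" "{y. h < dist_compl \<Omega> y} \<inter> ball (x - (h + r0) *\<^sub>R \<nu>) r0 = {}"
    and S: "S \<ge> 0" "\<And>y. dist_compl \<Omega> y = h \<Longrightarrow> u y \<le> S" "S < u x"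
  shows "ennreal ((u x - S) ^ CARD('n)) \<le> ennreal (N * 3 ^ CARD('n) * h powr ((real CARD('n) + 1) / 2)) *
      (\<integral>\<^sup>+y\<in>{y. h < dist_compl \<Omega> y}. ennreal (negp (elliptic_op \<Omega> a b c u y) ^ CARD('n)) \<partial>lebesgue)"
    (is "_ \<le> ennreal ?B3 * ?I")
proof (cases "?I = \<infinity>")
  case True
  have "?B3 > 0" using assms(2) h by simp
  moreover have "ennreal r * top = top" if "r > 0" for r :: real using that by (simp add: ennreal_mult_top)
  ultimately show ?thesis unfolding True by (simp only: infinity_ennreal_def top_greatest)
next
  case False
  let ?n = "CARD('n)"
  define D where "D = {y. h < dist_compl \<Omega> y}"
  define B where "B = N * h powr ((real ?n + 1) / 2)"
  have B: "B > 0" using assms(2) h by (simp add: B_def)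
  have n: "?n \<ge> 1" using one_le_card_finite[where 'a='n] by simp
  note inn = inner_sets[OF \<Omega> h(1), folded D_def]
  have D: "open D" "D \<subseteq> \<Omega>" "D \<in> sets lebesgue" "x \<in> D" using inn(3,4) x by (auto simp: D_def)
  note co = coeff_conditions_bounds[OF coef]
  define f where "f y = negp (elliptic_op \<Omega> a b c u y)" for y
  obtain Cc where Cc: "\<And>y. \<bar>c y\<bar> \<le> Cc" using co(9) by (auto simp: bounded_iff)
  define M where "M = real ?n * inverse \<delta> + K + Cc"
  have Cc0: "Cc \<ge> 0" using Cc[of 0] by linarith
  have nd: "real ?n * inverse \<delta> \<ge> 0" using assms(3) by simp
  have aM: "\<bar>a y $ i $ j\<bar> \<le> M" for y i j
    using coefficient_entry_bound[OF assms(3) co(5) co(2) co(1), of y i j] Cc0 assms(4) unfolding M_def by linarith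
  have bM: "\<bar>b y $ i\<bar> \<le> M" for y i
    using component_le_norm_cart[of "b y" i] co(3)[of y] Cc0 nd unfolding M_def by linarith
  have cM: "\<bar>c y\<bar> \<le> M" for y using Cc[of y] nd assms(4) unfolding M_def by linarith
  have M0: "M \<ge> 0" using cM[of 0] by linarith
  let ?g = "\<lambda>j. weak_partial \<Omega> j u" and ?H = "\<lambda>i j. weak_partial \<Omega> i (weak_partial \<Omega> j u)"
  note W = W2_loc_weak_partials[OF \<Omega> u(1)]
  have mD: "w \<in> borel_measurable (lebesgue_on D)" if "w \<in> Lp_loc p \<Omega>" for w p
    using that by (auto simp: Lp_loc_def intro: measurable_restrict_mono[OF _ D(2)])
  have gm: "?g j \<in> borel_measurable (lebesgue_on D)" and Hm: "?H i j \<in> borel_measurable (lebesgue_on D)" for i j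
    using mD[OF W(3)] mD[OF W(4)] by auto
  have contm: "w \<in> borel_measurable (lebesgue_on D)" if "continuous_on D w" for w :: "real ^ 'n \<Rightarrow> real"
    by (rule continuous_imp_measurable_on_sets_lebesgue[OF that D(3)])
  have um: "u \<in> borel_measurable (lebesgue_on D)"
    by (rule contm, rule continuous_on_subset[OF u(2)]) (use D(2) closure_subset in blast)
  have "elliptic_op \<Omega> a b c u \<in> borel_measurable (lebesgue_on D)"
    by (rule measurable_restrict_mono[OF elliptic_op_measurable[OF \<Omega> coef u] D(2)])
  hence fm: "f \<in> borel_measurable (lebesgue_on D)"
    unfolding f_def[abs_def] negp_def by measurable
  have f0: "f y \<ge> 0" for y by (simp add: f_def negp_nonneg)
  define I where "I = enn2real ?I"
  have I: "(\<integral>\<^sup>+y\<in>D. ennreal (f y ^ ?n) \<partial>lebesgue) = ennreal I" "I \<ge> 0"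
    using False unfolding I_def f_def D_def by (auto simp: less_top)
  define V where "V = measure lebesgue D"
  have "emeasure lebesgue D < \<infinity>"
    using emeasure_bounded_finite[OF bounded_subset[OF \<Omega>(2) D(2)]] D(1) by (simp add: emeasure_completion)
  hence V: "emeasure lebesgue D = ennreal V" "V \<ge> 0" by (auto simp: V_def emeasure_eq_ennreal_measure)
  \<comment> \<open>Independent of \<open>e\<close>: the power integral of the total error is at most \<open>C * e\<close>.\<close>
  define C where "C = M ^ ?n * (real CARD(('n \<times> 'n) + 'n option) ^ ?n * (real CARD(('n \<times> 'n) + 'n option) * (1 + V)))"
  have main: "(u x - S - 2 * e) ^ ?n \<le> B * 3 ^ ?n * (I + C * e)" if e: "0 < e" "e \<le> 1" "2 * e < u x - S" for e
  proof -
    obtain v Dv D2v where v: "\<And>y. (v has_derivative (\<lambda>w. Dv y \<bullet> w)) (at y)" "\<And>y. (Dv has_derivative (*v) (D2v y)) (at y)"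
      "continuous_on UNIV D2v" "\<And>y. transpose (D2v y) = D2v y" "\<And>y. y \<in> closure D \<Longrightarrow> \<bar>v y - u y\<bar> \<le> e"
      "\<And>j. (\<integral>\<^sup>+y\<in>D. ennreal (\<bar>Dv y $ j - ?g j y\<bar> ^ ?n) \<partial>lebesgue) \<le> ennreal e"
      "\<And>i j. (\<integral>\<^sup>+y\<in>D. ennreal (\<bar>D2v y $ i $ j - ?H i j y\<bar> ^ ?n) \<partial>lebesgue) \<le> ennreal e"
      using smooth_approximation[OF \<Omega> u n h(1) e(1), folded D_def] by blast
    define X where "X k y = (case k of Inl q \<Rightarrow> D2v y $ fst q $ snd q - ?H (fst q) (snd q) y
        | Inr None \<Rightarrow> v y - u y | Inr (Some j) \<Rightarrow> Dv y $ j - ?g j y)" for k :: "('n \<times> 'n) + 'n option" and y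
    have contv: "continuous_on UNIV v" by (rule has_derivative_continuous_on[OF has_derivative_at_withinI[OF v(1)]])
    have contDv: "continuous_on UNIV Dv" by (rule has_derivative_continuous_on[OF has_derivative_at_withinI[OF v(2)]])
    have Xm: "X k \<in> borel_measurable (lebesgue_on D)" for k
    proof -
      have 1: "(\<lambda>y. D2v y $ i $ j - ?H i j y) \<in> borel_measurable (lebesgue_on D)" for i j
        by (intro borel_measurable_diff Hm contm continuous_intros continuous_on_subset[OF v(3)]) auto
      have 2: "(\<lambda>y. Dv y $ j - ?g j y) \<in> borel_measurable (lebesgue_on D)" for j
        by (intro borel_measurable_diff gm contm continuous_intros continuous_on_subset[OF contDv]) auto
      have 3: "(\<lambda>y. v y - u y) \<in> borel_measurable (lebesgue_on D)"
        by (intro borel_measurable_diff um contm continuous_on_subset[OF contv]) auto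
      show ?thesis
      proof (cases k)
        case (Inl q)
        thus ?thesis using 1[of "fst q" "snd q"] by (simp add: X_def[abs_def])
      next
        case (Inr q)
        thus ?thesis using 2 3 by (cases q) (simp_all add: X_def[abs_def])
      qed
    qed
    have Xe: "(\<integral>\<^sup>+y\<in>D. ennreal (\<bar>X k y\<bar> ^ ?n) \<partial>lebesgue) \<le> ennreal ((1 + V) * e)" for k
    proof -
      have le: "ennreal e \<le> ennreal ((1 + V) * e)" using e V(2) by (intro ennreal_leI) (simp add: distrib_right)
      have "(\<integral>\<^sup>+y\<in>D. ennreal (\<bar>v y - u y\<bar> ^ ?n) \<partial>lebesgue) \<le> (\<integral>\<^sup>+y\<in>D. ennreal e \<partial>lebesgue)"
      proof (rule nn_integral_mono)
        fix y
        show "ennreal (\<bar>v y - u y\<bar> ^ ?n) * indicator D y \<le> ennreal e * indicator D y"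
        proof (cases "y \<in> D")
          case True
          hence "\<bar>v y - u y\<bar> \<le> e" using v(5) closure_subset by blast
          hence "\<bar>v y - u y\<bar> ^ ?n \<le> e ^ ?n" by (intro power_mono) auto
          also have "\<dots> \<le> e ^ 1" using e n by (intro power_decreasing) auto
          finally show ?thesis using True by (simp add: ennreal_leI)
        qed simp
      qed
      also have "\<dots> = ennreal e * ennreal V" using D(3) by (subst nn_integral_cmult_indicator) (auto simp: V)
      also have "\<dots> \<le> ennreal ((1 + V) * e)" using e V(2) by (simp add: ennreal_leI distrib_right mult.commute flip: ennreal_mult')
      finally have "(\<integral>\<^sup>+y\<in>D. ennreal (\<bar>v y - u y\<bar> ^ ?n) \<partial>lebesgue) \<le> ennreal ((1 + V) * e)" .
      note 3 = this
      show ?thesis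
      proof (cases k)
        case (Inl q)
        thus ?thesis using order_trans[OF v(7) le, of "fst q" "snd q"] by (simp add: X_def)
      next
        case (Inr q)
        thus ?thesis using order_trans[OF v(6) le] 3 by (cases q) (simp_all add: X_def)
      qed
    qed
    define E where "E y = M * (\<Sum>k\<in>UNIV. \<bar>X k y\<bar>)" for y
    have E0: "E y \<ge> 0" for y unfolding E_def using M0 by (intro mult_nonneg_nonneg sum_nonneg) auto
    have Em: "E \<in> borel_measurable (lebesgue_on D)"
      unfolding E_def[abs_def] by (intro borel_measurable_times borel_measurable_const borel_measurable_sum borel_measurable_abs Xm)
    have Eint: "(\<integral>\<^sup>+y\<in>D. ennreal (E y ^ ?n) \<partial>lebesgue) \<le> ennreal (C * e)"
    proof -
      have ms: "(\<lambda>y. ennreal ((\<Sum>k\<in>UNIV. \<bar>X k y\<bar>) ^ ?n) * indicator D y) \<in> borel_measurable lebesgue"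
        by (intro measurable_times_indicator D(3) borel_measurable_power borel_measurable_sum borel_measurable_abs Xm)
      have "(\<integral>\<^sup>+y\<in>D. ennreal (E y ^ ?n) \<partial>lebesgue) = (\<integral>\<^sup>+y. ennreal (M ^ ?n) * (ennreal ((\<Sum>k\<in>UNIV. \<bar>X k y\<bar>) ^ ?n) * indicator D y) \<partial>lebesgue)"
        using M0 by (intro nn_integral_cong) (auto simp: E_def power_mult_distrib ennreal_mult' split: split_indicator)
      also have "\<dots> = ennreal (M ^ ?n) * (\<integral>\<^sup>+y\<in>D. ennreal ((\<Sum>k\<in>UNIV. \<bar>X k y\<bar>) ^ ?n) \<partial>lebesgue)"
        by (rule nn_integral_cmult[OF ms])
      also have "\<dots> \<le> ennreal (M ^ ?n) * ennreal (real CARD(('n \<times> 'n) + 'n option) ^ ?n * (real CARD(('n \<times> 'n) + 'n option) * ((1 + V) * e)))"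
        using e V(2) by (intro mult_left_mono nn_integral_power_sum_le D(3) Xm Xe n) auto
      also have "\<dots> = ennreal (C * e)"
        using M0 by (simp add: C_def mult_ac flip: ennreal_mult')
      finally show ?thesis .
    qed
    have Lv: "- (f y + E y) \<le> contract (a y) (D2v y) + b y \<bullet> Dv y - c y * v y" for y
    proof -
      let ?DD = "D2v y - (\<chi> i j. ?H i j y)" and ?d = "Dv y - (\<chi> j. ?g j y)"
      have "contract (a y) (D2v y) + b y \<bullet> Dv y - c y * v y - elliptic_op \<Omega> a b c u y =
          contract (a y) ?DD + b y \<bullet> ?d - c y * (v y - u y)"
        unfolding elliptic_op_eq by (simp add: contract_def inner_diff_right algebra_simps sum_subtractf)
      moreover have "\<bar>contract (a y) ?DD + b y \<bullet> ?d - c y * (v y - u y)\<bar> \<le> E y"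
        using abs_operator_le[OF aM[of y] bM[of y] cM[of y], where B = ?DD and w = ?d and s = "v y - u y"] unfolding E_def sum_UNIV_index by (simp add: X_def)
      ultimately show ?thesis using negp_lower[of "elliptic_op \<Omega> a b c u y"] unfolding f_def by linarith
    qed
    have x_cl: "x \<in> closure D" using D(4) closure_subset by blast
    have "\<forall>y\<in>frontier D. v y \<le> S + e"
    proof
      fix y assume y: "y \<in> frontier D"
      hence ycl: "y \<in> closure D" "y \<notin> D" using D(1) by (auto simp: frontier_def interior_open)
      hence "dist_compl \<Omega> y = h" using inn(5) by (force simp: D_def)
      thus "v y \<le> S + e" using S(2) v(5)[OF ycl(1)] by force
    qed
    moreover have "S + e < v x" using v(5)[OF x_cl] e(3) by linarith
    moreover have "(\<lambda>y. f y + E y) \<in> borel_measurable (lebesgue_on D)" using fm Em by measurable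
    moreover have "D \<subseteq> cball x R1" using D(2) R1 by blast
    moreover have "D \<inter> ball (x - (h + r0) *\<^sub>R \<nu>) r0 = {}" using \<nu>(2) by (simp add: D_def)
    ultimately have "ennreal ((v x - (S + e)) ^ ?n) \<le> ennreal B * (\<integral>\<^sup>+y\<in>D. ennreal ((f y + E y) ^ ?n) \<partial>lebesgue)"
      unfolding B_def
      by (intro N[unfolded smooth_estimate_def, rule_format, of D x \<nu> h a b c v Dv D2v "\<lambda>y. f y + E y" "S + e"])
        (use D h \<nu>(1) co v Lv S(1) e in auto)
    also have "(\<integral>\<^sup>+y\<in>D. ennreal ((f y + E y) ^ ?n) \<partial>lebesgue) \<le> ennreal (3 ^ ?n * (I + C * e))"
    proof -
      have m: "(\<lambda>y. ennreal (w y ^ ?n) * indicator D y) \<in> borel_measurable lebesgue" if "w \<in> borel_measurable (lebesgue_on D)" for w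
        by (intro measurable_times_indicator D(3) borel_measurable_power that)
      have "(\<integral>\<^sup>+y\<in>D. ennreal ((f y + E y) ^ ?n) \<partial>lebesgue) \<le>
        (\<integral>\<^sup>+y. ennreal (3 ^ ?n) * (ennreal (f y ^ ?n) * indicator D y + ennreal (E y ^ ?n) * indicator D y) \<partial>lebesgue)"
      proof (rule nn_integral_mono)
        fix y
        have "(f y + E y) ^ ?n \<le> 3 ^ ?n * (f y ^ ?n + E y ^ ?n)"
          using power_sum3_le[OF f0 E0, of 0 y y ?n] n by (simp add: zero_power)
        hence "ennreal ((f y + E y) ^ ?n) \<le> ennreal (3 ^ ?n * (f y ^ ?n + E y ^ ?n))" by (rule ennreal_leI)
        also have "\<dots> = ennreal (3 ^ ?n) * (ennreal (f y ^ ?n) + ennreal (E y ^ ?n))"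
          by (rule ennreal_cmult_plus) (use f0 E0 in auto)
        finally show "ennreal ((f y + E y) ^ ?n) * indicator D y \<le>
          ennreal (3 ^ ?n) * (ennreal (f y ^ ?n) * indicator D y + ennreal (E y ^ ?n) * indicator D y)"
          by (auto split: split_indicator)
      qed
      also have "\<dots> = ennreal (3 ^ ?n) * ((\<integral>\<^sup>+y\<in>D. ennreal (f y ^ ?n) \<partial>lebesgue) + (\<integral>\<^sup>+y\<in>D. ennreal (E y ^ ?n) \<partial>lebesgue))"
        using m[OF fm] m[OF Em] by (simp add: nn_integral_cmult nn_integral_add)
      also have "\<dots> \<le> ennreal (3 ^ ?n) * (ennreal I + ennreal (C * e))"
        unfolding I(1) using Eint by (intro mult_left_mono add_left_mono) auto
      also have "\<dots> = ennreal (3 ^ ?n * (I + C * e))"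
        by (rule ennreal_cmult_plus[symmetric]) (use I(2) e M0 V(2) in \<open>auto simp: C_def\<close>)
      finally show ?thesis .
    qed
    finally have "ennreal ((v x - (S + e)) ^ ?n) \<le> ennreal B * ennreal (3 ^ ?n * (I + C * e))"
      by (simp add: mult_left_mono)
    also have "\<dots> = ennreal (B * (3 ^ ?n * (I + C * e)))" using B by (intro ennreal_mult'[symmetric]) simp
    finally have le: "ennreal ((v x - (S + e)) ^ ?n) \<le> ennreal (B * (3 ^ ?n * (I + C * e)))" .
    have "C \<ge> 0" using M0 V(2) by (simp add: C_def)
    hence "0 \<le> B * (3 ^ ?n * (I + C * e))" using B I(2) e by simp
    with le have le': "(v x - (S + e)) ^ ?n \<le> B * (3 ^ ?n * (I + C * e))" by (simp add: ennreal_le_iff)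
    have "(u x - S - 2 * e) ^ ?n \<le> (v x - (S + e)) ^ ?n"
      using v(5)[OF x_cl] e(3) by (intro power_mono) linarith+
    thus ?thesis using le' by simp
  qed
  have "(u x - S) ^ ?n \<le> B * 3 ^ ?n * I"
    by (rule limit_power_bound[OF _ main]) (use S(3) in auto)
  hence "ennreal ((u x - S) ^ ?n) \<le> ennreal (B * 3 ^ ?n * I)" by (rule ennreal_leI)
  also have "\<dots> = ennreal (B * 3 ^ ?n) * ennreal I" using B by (intro ennreal_mult') simp
  also have "B * 3 ^ ?n = ?B3" by (simp add: B_def)
  finally show ?thesis using I(1) unfolding f_def D_def by simp
qed

section \<open>Doubling the distance to the boundary\<close>

lemma geometric_powr_sum:
  fixes t \<beta> :: real
  assumes "t > 0" "\<beta> > 0"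
  shows "(\<Sum>j<k. (2 ^ j * t) powr \<beta>) \<le> (2 ^ k * t) powr \<beta> / (2 powr \<beta> - 1)"
proof -
  define q where "q = 2 powr \<beta>"
  have q: "q > 1" unfolding q_def using assms by simp
  have eq: "(2 ^ j * t) powr \<beta> = q ^ j * t powr \<beta>" for j
    using assms by (simp add: powr_mult q_def powr_power[symmetric] powr_powr mult.commute flip: powr_realpow)
  have "(\<Sum>j<k. (2 ^ j * t) powr \<beta>) = (q ^ k - 1) / (q - 1) * t powr \<beta>"
    using q by (simp add: eq geometric_sum sum_distrib_right[symmetric])
  also have "\<dots> \<le> q ^ k / (q - 1) * t powr \<beta>"
    using q by (intro mult_right_mono divide_right_mono) auto
  finally show ?thesis by (simp add: eq q_def)
qed

lemma powr_card_eq_power: "t \<ge> 0 \<Longrightarrow> n \<ge> 1 \<Longrightarrow> t powr real n = t ^ n" for t :: real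
  by (cases "t = 0") (auto simp: powr_realpow)

text \<open>
  On \<open>{\<rho> > h}\<close> the weight \<open>\<rho>\<^sup>\<alpha>\<close> is at least \<open>h\<^sup>\<alpha>\<close>, because \<open>\<alpha>\<close> is nonnegative.
\<close>

lemma inner_domain_weighted_integral:
  fixes \<Omega> :: "(real ^ 'n) set"
  assumes \<Omega>: "open \<Omega>" "bounded \<Omega>" and h: "h > 0" and \<alpha>: "\<alpha> \<ge> 0" and f: "\<And>y. f y \<ge> 0"
    and J: "(\<integral>\<^sup>+y\<in>\<Omega>. ennreal (\<bar>dist_compl \<Omega> y powr (\<alpha> / real CARD('n)) * f y\<bar> powr real CARD('n)) \<partial>lebesgue) = ennreal J"
    and fm: "f \<in> borel_measurable (lebesgue_on \<Omega>)"
  shows "(\<integral>\<^sup>+y\<in>{y. h < dist_compl \<Omega> y}. ennreal (f y ^ CARD('n)) \<partial>lebesgue) \<le> ennreal (h powr (- \<alpha>) * J)"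
proof -
  let ?n = "CARD('n)" and ?D = "{y. h < dist_compl \<Omega> y}"
  let ?w = "\<lambda>y. \<bar>dist_compl \<Omega> y powr (\<alpha> / real ?n) * f y\<bar> powr real ?n"
  have n: "?n \<ge> 1" using one_le_card_finite[where 'a='n] by simp
  have weight: "?w y = dist_compl \<Omega> y powr \<alpha> * f y ^ ?n" for y
    using f[of y] n by (simp add: abs_mult powr_mult powr_powr powr_card_eq_power)
  have "dist_compl \<Omega> \<in> borel_measurable lebesgue"
    using borel_measurable_continuous_onI[OF dist_compl_continuous] by (intro measurable_completion) simp
  hence "dist_compl \<Omega> \<in> borel_measurable (lebesgue_on \<Omega>)" by (rule measurable_restrict_space1)
  hence "?w \<in> borel_measurable (lebesgue_on \<Omega>)" using fm by measurable
  hence m: "(\<lambda>y. ennreal (?w y) * indicator \<Omega> y) \<in> borel_measurable lebesgue"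
    by (rule measurable_times_indicator) (use \<Omega>(1) in auto)
  have "(\<integral>\<^sup>+y\<in>?D. ennreal (f y ^ ?n) \<partial>lebesgue) \<le> (\<integral>\<^sup>+y. ennreal (h powr (- \<alpha>)) * (ennreal (?w y) * indicator \<Omega> y) \<partial>lebesgue)"
  proof (rule nn_integral_mono)
    fix y
    show "ennreal (f y ^ ?n) * indicator ?D y \<le> ennreal (h powr (- \<alpha>)) * (ennreal (?w y) * indicator \<Omega> y)"
    proof (cases "y \<in> ?D")
      case True
      hence y: "h \<le> dist_compl \<Omega> y" "y \<in> \<Omega>" using inner_sets(4)[OF \<Omega> h] by auto
      have "1 = h powr (- \<alpha>) * h powr \<alpha>" using h by (simp flip: powr_add)
      also have "\<dots> \<le> h powr (- \<alpha>) * dist_compl \<Omega> y powr \<alpha>"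
        using y h \<alpha> by (intro mult_left_mono powr_mono2) auto
      finally have "1 * f y ^ ?n \<le> h powr (- \<alpha>) * dist_compl \<Omega> y powr \<alpha> * f y ^ ?n"
        using f[of y] by (intro mult_right_mono) auto
      hence "f y ^ ?n \<le> h powr (- \<alpha>) * ?w y" by (simp add: weight mult.assoc)
      hence "ennreal (f y ^ ?n) \<le> ennreal (h powr (- \<alpha>)) * ennreal (?w y)"
        by (simp add: ennreal_leI flip: ennreal_mult')
      thus ?thesis using True y by simp
    qed simp
  qed
  also have "\<dots> = ennreal (h powr (- \<alpha>)) * ennreal J" unfolding J[symmetric] by (rule nn_integral_cmult[OF m])
  also have "\<dots> = ennreal (h powr (- \<alpha>) * J)" by (simp add: ennreal_mult')
  finally show ?thesis .
qed

lemma le_powr_root: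
  fixes X Y :: real
  assumes "X \<ge> 0" "n \<ge> 1" "X ^ n \<le> Y"
  shows "X \<le> Y powr (1 / real n)"
proof -
  have "X = (X powr real n) powr (1 / real n)" using assms by (simp add: powr_powr)
  also have "X powr real n = X ^ n" using assms by (simp add: powr_card_eq_power)
  also have "(X ^ n) powr (1 / real n) \<le> Y powr (1 / real n)" using assms by (intro powr_mono2) auto
  finally show ?thesis .
qed

text \<open>
  The exterior ball estimate on \<open>{\<rho> > h}\<close>, with the unweighted integral replaced by the weighted one
  at the price of \<open>h\<^sup>-\<^sup>\<alpha>\<close>. The exponent \<open>\<beta>\<close> arises as \<open>((d + 1) / 2 - \<alpha>) / d\<close>.
\<close>

lemma doubling_step:
  fixes \<Omega> :: "(real ^ 'n) set"
  assumes "smooth_estimate TYPE(real ^ 'n) r0 R1 \<delta> K N" "N > 0" "\<delta> > 0" "K > 0" "r0 > 0"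
    and \<Omega>: "open \<Omega>" "bounded \<Omega>" and coef: "coeff_conditions \<delta> K a b c"
    and u: "u \<in> W2_loc (real CARD('n)) \<Omega>" "continuous_on (closure \<Omega>) u"
    and ext: "\<And>z. z \<in> frontier \<Omega> \<Longrightarrow> \<exists>\<mu>. norm \<mu> = 1 \<and> ball (z - r0 *\<^sub>R \<mu>) r0 \<inter> \<Omega> = {}"
    and h: "0 < h" and x: "dist_compl \<Omega> x = 2 * h" and R1: "closure \<Omega> \<subseteq> cball x R1"
    and S: "S \<ge> 0" "\<And>y. dist_compl \<Omega> y = h \<Longrightarrow> u y \<le> S" and \<alpha>: "\<alpha> \<ge> 0"
    and J: "(\<integral>\<^sup>+y\<in>\<Omega>. ennreal (\<bar>dist_compl \<Omega> y powr (\<alpha> / real CARD('n)) * negp (elliptic_op \<Omega> a b c u y)\<bar> powr real CARD('n)) \<partial>lebesgue) = ennreal J" "J \<ge> 0"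
  shows "u x \<le> S + (N * 3 ^ CARD('n)) powr (1 / real CARD('n)) * h powr ((real CARD('n) + 1 - 2 * \<alpha>) / (2 * real CARD('n))) * J powr (1 / real CARD('n))"
proof (cases "u x \<le> S")
  case True
  thus ?thesis by (smt (verit) mult_nonneg_nonneg powr_ge_zero)
next
  case False
  let ?n = "CARD('n)"
  define d where "d = real ?n"
  have n: "?n \<ge> 1" "d > 0" using one_le_card_finite[where 'a='n] by (simp_all add: d_def)
  have ne: "\<Omega> \<noteq> UNIV" using \<Omega>(2) not_bounded_UNIV by blast
  have x\<Omega>: "x \<in> \<Omega>" using x h inner_sets(4)[OF \<Omega> h] by auto
  obtain z where z: "z \<in> frontier \<Omega>" "dist x z = dist_compl \<Omega> x" by (rule nearest_boundary_point[OF \<Omega>(1) ne x\<Omega>])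
  have "z \<in> cball x R1" using z(1) R1 by (auto simp: frontier_def)
  hence hR: "h \<le> R1" using z(2) x h by simp
  obtain \<nu> where \<nu>: "norm \<nu> = 1" "{y. h < dist_compl \<Omega> y} \<inter> ball (x - (h + r0) *\<^sub>R \<nu>) r0 = {}"
    using inner_domain_exterior_ball[OF \<Omega>(1) ne assms(5) ext h x\<Omega> x] by blast
  let ?f = "\<lambda>y. negp (elliptic_op \<Omega> a b c u y)"
  have fm: "?f \<in> borel_measurable (lebesgue_on \<Omega>)"
    using elliptic_op_measurable[OF \<Omega> coef u] unfolding negp_def by measurable
  have le: "(\<integral>\<^sup>+y\<in>{y. h < dist_compl \<Omega> y}. ennreal (?f y ^ ?n) \<partial>lebesgue) \<le> ennreal (h powr (- \<alpha>) * J)"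
    by (rule inner_domain_weighted_integral[OF \<Omega> h \<alpha> negp_nonneg J(1) fm])
  define B where "B = N * 3 ^ ?n"
  have B: "B > 0" using assms(2) by (simp add: B_def)
  have "ennreal ((u x - S) ^ ?n) \<le> ennreal (B * h powr ((d + 1) / 2)) * (\<integral>\<^sup>+y\<in>{y. h < dist_compl \<Omega> y}. ennreal (?f y ^ ?n) \<partial>lebesgue)"
    unfolding B_def d_def
    by (rule W2_exterior_ball_estimate[OF assms(1-4) \<Omega> coef u h hR _ _ \<nu> S]) (use x h R1 False closure_subset in auto)
  also have "\<dots> \<le> ennreal (B * h powr ((d + 1) / 2)) * ennreal (h powr (- \<alpha>) * J)"
    by (intro mult_left_mono le) auto
  also have "\<dots> = ennreal (B * h powr ((d + 1) / 2) * (h powr (- \<alpha>) * J))"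
    using B by (intro ennreal_mult'[symmetric]) simp
  also have "B * h powr ((d + 1) / 2) * (h powr (- \<alpha>) * J) = B * h powr ((d + 1) / 2 - \<alpha>) * J"
    using powr_add[of h "(d + 1) / 2" "- \<alpha>"] by simp
  finally have "(u x - S) ^ ?n \<le> B * h powr ((d + 1) / 2 - \<alpha>) * J"
    using B J(2) by (simp add: ennreal_le_iff)
  hence "u x - S \<le> (B * h powr ((d + 1) / 2 - \<alpha>) * J) powr (1 / d)"
    unfolding d_def using False n by (intro le_powr_root) auto
  also have "\<dots> = B powr (1 / d) * h powr (((d + 1) / 2 - \<alpha>) * (1 / d)) * J powr (1 / d)"
    using B J(2) by (simp add: powr_mult powr_powr)
  also have "((d + 1) / 2 - \<alpha>) * (1 / d) = (d + 1 - 2 * \<alpha>) / (2 * d)" using n(2) by (simp add: field_simps)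
  finally show ?thesis by (simp add: B_def d_def)
qed

theorem theorem3p1:
  fixes \<Omega> :: "(real ^ 'n) set" and \<delta> K \<alpha> \<beta> d :: real
  defines "d \<equiv> real CARD('n)"
  defines "\<beta> \<equiv> (d + 1 - 2 * \<alpha>) / (2 * d)"
  assumes "CARD('n) \<ge> 2"
    and "bounded_C11_domain \<Omega>"
    and "\<delta> > 0" and "K > 0"
    and "0 \<le> \<alpha>" and "\<alpha> < (d + 1) / 2"
  shows "\<exists>N > 0. \<forall>a b c u.
    coeff_conditions \<delta> K a b c \<and> u \<in> W2_loc d \<Omega> \<and> continuous_on (closure \<Omega>) u \<longrightarrow>
    (\<forall>x \<in> \<Omega>. ereal (u x) \<le> (SUP z \<in> frontier \<Omega>. ereal (posp (u z)))
       + ereal (N * dist_compl \<Omega> x powr \<beta>)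
         * enn2ereal (Lp_norm d \<Omega>
             (\<lambda>y. dist_compl \<Omega> y powr (\<alpha> / d) * negp (elliptic_op \<Omega> a b c u y))))"
proof -
  let ?n = "CARD('n)"
  have \<Omega>: "open \<Omega>" "bounded \<Omega>" "C11_boundary \<Omega>" "\<Omega> \<noteq> {}"
    using assms(4) by (auto simp: bounded_C11_domain_def)
  have ne: "\<Omega> \<noteq> UNIV" using \<Omega>(2) not_bounded_UNIV by blast
  have d: "d > 0" using assms(3) by (simp add: d_def)
  have \<beta>: "\<beta> > 0" using assms(8) d by (simp add: \<beta>_def)
  obtain r0 where r0: "r0 > 0" "\<And>z. z \<in> frontier \<Omega> \<Longrightarrow> \<exists>\<mu>. norm \<mu> = 1 \<and> ball (z - r0 *\<^sub>R \<mu>) r0 \<inter> \<Omega> = {}"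
    using uniform_exterior_ball[OF \<Omega>(1-3)] by blast
  obtain R where R: "R > 0" "\<And>y. y \<in> closure \<Omega> \<Longrightarrow> norm y \<le> R"
    using bounded_closure[OF \<Omega>(2)] bounded_pos by blast
  define R1 where "R1 = 2 * R"
  have R1: "R1 > 0" "closure \<Omega> \<subseteq> cball x R1" if "x \<in> \<Omega>" for x
  proof -
    show "R1 > 0" using R by (simp add: R1_def)
    show "closure \<Omega> \<subseteq> cball x R1"
    proof
      fix y assume "y \<in> closure \<Omega>"
      moreover have "norm x \<le> R" using R(2) that closure_subset by blast
      ultimately show "y \<in> cball x R1"
        using R(2)[of y] norm_triangle_ineq4[of x y] by (simp add: dist_norm R1_def)
    qed
  qed
  obtain N0 where N0: "N0 > 0" "smooth_estimate TYPE(real ^ 'n) r0 R1 \<delta> K N0"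
    using smooth_exterior_ball_estimate[OF r0(1) _ assms(5,6), of R1, where 'n='n] R1(1) \<Omega>(4)
    unfolding smooth_estimate_def by blast
  define N1 where "N1 = (N0 * 3 ^ ?n) powr (1 / d)"
  \<comment> \<open>The geometric series of the increments contributes the factor \<open>1 / q\<close>.\<close>
  define q where "q = 2 powr \<beta> - 1"
  have N1: "N1 > 0" using N0(1) by (simp add: N1_def)
  have q: "q > 0" using \<beta> by (simp add: q_def)
  show ?thesis
  proof (intro exI[of _ "N1 / q"] conjI allI impI ballI, goal_cases)
    case 1
    show ?case using N1 q by simp
  next
    case (2 a b c u x)
    hence coef: "coeff_conditions \<delta> K a b c" and u: "u \<in> W2_loc (real ?n) \<Omega>" "continuous_on (closure \<Omega>) u" and x: "x \<in> \<Omega>"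
      by (auto simp: d_def)
    have \<rho>x: "dist_compl \<Omega> x > 0" by (rule dist_compl_pos[OF \<Omega>(1) ne x])
    define I where "I = (\<integral>\<^sup>+y\<in>\<Omega>. ennreal (\<bar>dist_compl \<Omega> y powr (\<alpha> / d) * negp (elliptic_op \<Omega> a b c u y)\<bar> powr d) \<partial>lebesgue)"
    let ?L = "Lp_norm d \<Omega> (\<lambda>y. dist_compl \<Omega> y powr (\<alpha> / d) * negp (elliptic_op \<Omega> a b c u y))"
    let ?S = "SUP z \<in> frontier \<Omega>. ereal (posp (u z))"
    have cptc: "compact (closure \<Omega>)" using \<Omega>(2) by simp
    have fr: "frontier \<Omega> \<subseteq> closure \<Omega>" by (auto simp: frontier_def)
    obtain z0 where z0: "z0 \<in> frontier \<Omega>" using nearest_boundary_point[OF \<Omega>(1) ne x] by blast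
    have "bounded (u ` closure \<Omega>)" by (intro compact_imp_bounded compact_continuous_image u cptc)
    then obtain Bu where Bu: "\<And>y. y \<in> closure \<Omega> \<Longrightarrow> \<bar>u y\<bar> \<le> Bu" by (auto simp: bounded_iff)
    have "?S \<le> ereal Bu"
    proof (rule SUP_least)
      fix z assume "z \<in> frontier \<Omega>"
      hence "\<bar>u z\<bar> \<le> Bu" using Bu fr by blast
      thus "ereal (posp (u z)) \<le> ereal Bu" by (simp add: posp_def)
    qed
    moreover have "0 \<le> ?S"
      by (rule order_trans[OF _ SUP_upper[OF z0]]) (simp add: posp_nonneg)
    ultimately obtain s where s: "?S = ereal s" "s \<ge> 0"
      by (cases ?S) auto
    have us: "u z \<le> s" if "z \<in> frontier \<Omega>" for z
    proof -
      have "ereal (posp (u z)) \<le> ereal s" unfolding s(1)[symmetric] by (rule SUP_upper[OF that])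
      thus ?thesis using posp_upper[of "u z"] by simp
    qed
    show ?case
    proof (cases "I = \<infinity>")
      case True
      hence "?L = \<infinity>" unfolding Lp_norm_def Let_def I_def by simp
      moreover have "ereal (N1 / q * dist_compl \<Omega> x powr \<beta>) * \<infinity> = \<infinity>" using N1 q \<rho>x by simp
      ultimately show ?thesis unfolding s(1) by (simp add: top_ennreal.rep_eq)
    next
      case False
      define J where "J = enn2real I"
      have J: "I = ennreal J" "J \<ge> 0" using False by (auto simp: J_def less_top)
      define F where "F = J powr (1 / d)"
      have F: "F \<ge> 0" by (simp add: F_def)
      have L: "?L = ennreal F"
        unfolding Lp_norm_def Let_def I_def[symmetric] using False by (simp add: F_def J_def)
      have step: "u y \<le> S + N1 * h powr \<beta> * F" if "h > 0" "dist_compl \<Omega> y = 2 * h" "S \<ge> 0"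
        "\<And>y. dist_compl \<Omega> y = h \<Longrightarrow> u y \<le> S" for h y S
      proof -
        have "y \<in> \<Omega>" using that(1,2) inner_sets(4)[OF \<Omega>(1,2) that(1)] by auto
        from doubling_step[OF N0(2,1) assms(5,6) r0(1) \<Omega>(1,2) coef u r0(2) that(1,2) R1(2)[OF this] that(3,4) assms(7)]
        show ?thesis using J unfolding I_def N1_def F_def \<beta>_def d_def by simp
      qed
      \<comment> \<open>Iterating the step from distance \<open>t\<close> to \<open>2\<^sup>k t\<close>.\<close>
      have chain: "u y \<le> S + N1 * F * (\<Sum>j<k. (2 ^ j * t) powr \<beta>)"
        if "t > 0" "S \<ge> 0" "\<And>y. dist_compl \<Omega> y = t \<Longrightarrow> u y \<le> S" "dist_compl \<Omega> y = 2 ^ k * t" for t S k y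
        using that(4)
      proof (induction k arbitrary: y)
        case 0
        thus ?case using that(3) by simp
      next
        case (Suc k)
        have "u y \<le> (S + N1 * F * (\<Sum>j<k. (2 ^ j * t) powr \<beta>)) + N1 * (2 ^ k * t) powr \<beta> * F"
          by (rule step) (use that(1,2) Suc N1 F in \<open>auto intro!: add_nonneg_nonneg mult_nonneg_nonneg sum_nonneg\<close>)
        thus ?case by (simp add: algebra_simps)
      qed
      have "u x \<le> s + N1 / q * dist_compl \<Omega> x powr \<beta> * F + e" if e: "e > 0" for e
      proof -
        have "uniformly_continuous_on (closure \<Omega>) u" by (rule compact_uniformly_continuous[OF u(2) cptc])
        then obtain r where r: "r > 0" "\<And>y z. y \<in> closure \<Omega> \<Longrightarrow> z \<in> closure \<Omega> \<Longrightarrow> dist z y < r \<Longrightarrow> dist (u z) (u y) < e"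
          unfolding uniformly_continuous_on_def using e by blast
        obtain k where k: "dist_compl \<Omega> x / r < 2 ^ k" using real_arch_pow[of 2] by auto
        define t where "t = dist_compl \<Omega> x / 2 ^ k"
        have t: "t > 0" "t < r" "dist_compl \<Omega> x = 2 ^ k * t" using \<rho>x k r(1) by (auto simp: t_def field_simps)
        have near: "u y \<le> s + e" if y: "dist_compl \<Omega> y = t" for y
        proof -
          have y\<Omega>: "y \<in> \<Omega>" using y t(1) inner_sets(4)[OF \<Omega>(1,2), of "t / 2"] by auto
          obtain z where z: "z \<in> frontier \<Omega>" "dist y z = dist_compl \<Omega> y" by (rule nearest_boundary_point[OF \<Omega>(1) ne y\<Omega>])
          have "dist (u z) (u y) < e"
            by (rule r(2)) (use y\<Omega> closure_subset z fr y t in \<open>auto simp: dist_commute\<close>)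
          thus ?thesis using us[OF z(1)] by (simp add: dist_real_def)
        qed
        have "u x \<le> (s + e) + N1 * F * (\<Sum>j<k. (2 ^ j * t) powr \<beta>)"
          by (rule chain[OF t(1) _ near t(3)]) (use s(2) e in auto)
        also have "\<dots> \<le> (s + e) + N1 * F * (dist_compl \<Omega> x powr \<beta> / q)"
          using geometric_powr_sum[OF t(1) \<beta>, of k] N1 F unfolding t(3) q_def by (intro add_left_mono mult_left_mono) auto
        finally show ?thesis by (simp add: field_simps)
      qed
      hence "u x \<le> s + N1 / q * dist_compl \<Omega> x powr \<beta> * F" by (rule field_le_epsilon)
      moreover have "enn2ereal ?L = ereal F" unfolding L using F by simp
      ultimately show ?thesis unfolding s(1) by simp
    qed
  qed
qed

end
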